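(* Let $\tau_1$ be an SRCT of straight shape $\alpha\vDash n$, let $j_1,\ldots,j_m$ be positive integers such that the slides below are all defined, and let $\tau_2=\mu_{j_m}\cdots\mu_{j_1}(\tau_1)$ in the bullet convention. Let $w=j_m\cdots j_1$, $\omega=\mathrm{std}(w)\in\mathfrak{S}_m$, $\beta=u_{j_m}\cdots u_{j_1}(\alpha)$ and $\gamma=\mathrm{sh}(\rho^{-1}(Q(\omega)))$. Then $\tau_2$ is an SRCT of shape $\beta/\!\!/\gamma$.
   Context: Compositions as reverse composition diagrams (row $r$ from top has $\alpha_r$ left-justified boxes); $\mathrm{sh}$ denotes shape. For a skew shape $\beta/\!\!/\gamma$, the inner shape $\gamma$ occupies, left-justified, the last $l(\gamma)$ rows of $\beta$. An SSRCT of shape $\beta/\!\!/\gamma$: filling of the non-inner boxes, rows weakly decreasing left to right, filled first-column entries strictly increasing top to bottom, and for rows $r<s$ and column $c$ with $(s,c+1)$ filled: if $(r,c)$ is inner or $\tau(r,c)\geq\tau(s,c+1)$, then $(r,c+1)$ is inner or filled with $\tau(r,c+1)>\tau(s,c+1)$. An SRCT is an SSRCT whose entries are $1,\ldots,N$ each once ($N$ the number of filled boxes). $\rho$ sorts each column of an SSRCT of straight shape decreasingly bottom to top, bottom-justified, giving an SSRT (French convention); it is a known bijection. Operators: $\mathfrak{d}_t$ subtracts $1$ from the rightmost part equal to $t$ (omitting $0$; $0$ if none), $\mathfrak{v}_{[t-1]}=\mathfrak{d}_1\cdots\mathfrak{d}_{t-1}$ ($\mathfrak{d}_{t-1}$ first),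 $a_t$ appends $t$, $u_t=a_t\mathfrak{v}_{[t-1]}$. $\mathrm{std}(w)$: replace the letters of $w$ (read left to right) by $1,\ldots,m$, smaller letters first, ties broken left to right. Variant RS: insert $\omega(1),\ldots,\omega(m)$ into SRTs with decreasing rows, starting in the bottom row: $y$ bumps the greatest entry $x<y$ of the row (if any) and $x$ is inserted in the next row up; otherwise $y$ is appended at the end of the row; the $k$-th new box receives $m-k+1$ in the recording tableau $Q(\omega)$. $\phi_{t+1}$ on an SSRCT $\tau$ of straight shape with a part equal to $t$ ($\tau=0$ outside): $r_1$ largest row index of a part equal to $t$; $r_p$ ($p\geq2$) the largest $r<r_{p-1}$ with $\tau(r,t)>\tau(r_{p-1},t)\geq\tau(r,t+1)$, ending at $r_k$; for $p=k,\ldots,2$ put the original $\tau(r_{p-1},t)$ into $(r_p,t)$, delete box $(r_1,t)$ (and its row if empty); $\tau(r_k,t)$ exits. $\mu_i$ with the max-convention: $\tau'=\tau$, $H=\varnothing$ if $i=1$, else $\tau'=\phi_2(\cdots\phi_i(\tau)\cdots)$ with $H$ the exiting entries; $\mu_i(\tau)$ is $\tau'$ with a new last row of length $i$ containing $\max(\tau)+1$ in its first box followed by $H$ decreasingly. A slide $\mu_i$ is defined when the sorted partition of the current shape has an addable node in column $i$. Bullet convention: compute $\mu_{j_m}\cdots\mu_{j_1}(\tau_1)$ with the max-convention and then replace every entry greater than $n$ by an empty (inner) box. *)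

theory Defs
  imports Main
begin

(* Conventions.
   A composition is a list of positive naturals (parts alpha_1,...,alpha_l).
   A (possibly skew) reverse composition tableau is a list of rows, listed from
   TOP (row 1) to BOTTOM (row l); each row lists its entries left to right.
   Filled boxes carry positive entries; an inner (empty) box carries 0.
   Reverse tableaux (SRT/SSRT, French convention) are lists of rows listed from
   BOTTOM to TOP, each row left to right.
   Boxes are addressed 1-indexed as (row, column). *)

type_synonym comp = "nat list"
type_synonym tab = "nat list list"

definition is_comp :: "nat list \<Rightarrow> bool" where
  "is_comp \<alpha> \<longleftrightarrow> (\<forall>p\<in>set \<alpha>. 0 < p)"

definition ent :: "tab \<Rightarrow> nat \<Rightarrow> nat \<Rightarrow> nat" where
  "ent T r c = (if 1 \<le> r \<and> r \<le> length T \<and> 1 \<le> c \<and> c \<le> length (T!(r-1))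
                then T!(r-1)!(c-1) else 0)"

definition in_shape :: "comp \<Rightarrow> nat \<Rightarrow> nat \<Rightarrow> bool" where
  "in_shape \<beta> r c \<longleftrightarrow> 1 \<le> r \<and> r \<le> length \<beta> \<and> 1 \<le> c \<and> c \<le> \<beta>!(r-1)"

definition inner :: "comp \<Rightarrow> comp \<Rightarrow> nat \<Rightarrow> nat \<Rightarrow> bool" where
  "inner \<beta> \<gamma> r c \<longleftrightarrow> length \<beta> - length \<gamma> < r \<and> r \<le> length \<beta> \<and> 1 \<le> c \<and>
                      c \<le> \<gamma>!(r - 1 - (length \<beta> - length \<gamma>))"

definition filled :: "comp \<Rightarrow> comp \<Rightarrow> nat \<Rightarrow> nat \<Rightarrow> bool" where
  "filled \<beta> \<gamma> r c \<longleftrightarrow> in_shape \<beta> r c \<and> \<not> inner \<beta> \<gamma> r c"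

definition is_SSRCT :: "tab \<Rightarrow> comp \<Rightarrow> comp \<Rightarrow> bool" where
  "is_SSRCT T \<beta> \<gamma> \<longleftrightarrow>
     is_comp \<beta> \<and> is_comp \<gamma> \<and> length \<gamma> \<le> length \<beta> \<and> map length T = \<beta> \<and>
     (\<forall>r c. inner \<beta> \<gamma> r c \<longrightarrow> in_shape \<beta> r c) \<and>
     (\<forall>r c. in_shape \<beta> r c \<longrightarrow> (ent T r c = 0 \<longleftrightarrow> inner \<beta> \<gamma> r c)) \<and>
     (\<forall>r c. filled \<beta> \<gamma> r c \<and> filled \<beta> \<gamma> r (c+1) \<longrightarrow> ent T r (c+1) \<le> ent T r c) \<and>
     (\<forall>r s. r < s \<and> filled \<beta> \<gamma> r 1 \<and> filled \<beta> \<gamma> s 1 \<longrightarrow> ent T r 1 < ent T s 1) \<and>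
     (\<forall>r s c. r < s \<and> 1 \<le> c \<and> filled \<beta> \<gamma> s (c+1) \<and>
        (inner \<beta> \<gamma> r c \<or> (filled \<beta> \<gamma> r c \<and> ent T s (c+1) \<le> ent T r c)) \<longrightarrow>
        (inner \<beta> \<gamma> r (c+1) \<or> (filled \<beta> \<gamma> r (c+1) \<and> ent T s (c+1) < ent T r (c+1))))"

definition is_SRCT :: "tab \<Rightarrow> comp \<Rightarrow> comp \<Rightarrow> bool" where
  "is_SRCT T \<beta> \<gamma> \<longleftrightarrow> is_SSRCT T \<beta> \<gamma> \<and>
     (let xs = filter (\<lambda>x. x \<noteq> 0) (concat T) in distinct xs \<and> set xs = {1..length xs})"

definition shape :: "tab \<Rightarrow> comp" where
  "shape T = map length T"

definition col :: "tab \<Rightarrow> nat \<Rightarrow> nat list" where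
  "col T c = map (\<lambda>r. T!r!(c-1)) (filter (\<lambda>r. c \<le> length (T!r)) [0..<length T])"

text \<open>rho: sort each column decreasingly bottom to top, bottom-justified; the
  result is a reverse tableau given as rows from bottom to top.\<close>
definition rho :: "tab \<Rightarrow> nat list list" where
  "rho T = (let w = foldr max (map length T) 0 in
     map (\<lambda>i. map (\<lambda>c. rev (sort (col T c)) ! i)
                    (filter (\<lambda>c. i < length (col T c)) [1..<w+1]))
         [0..<length T])"

definition rho_inv :: "nat list list \<Rightarrow> tab" where
  "rho_inv P = (THE T. is_SSRCT T (shape T) [] \<and> rho T = P)"

subsection \<open>Operators on compositions (0 represented by None)\<close>

definition dop :: "nat \<Rightarrow> comp option \<Rightarrow> comp option" where
  "dop t a = (case a of None \<Rightarrow> None | Some \<alpha> \<Rightarrow>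
     (if t \<in> set \<alpha> then
        (let i = Max (set (filter (\<lambda>i. \<alpha>!i = t) [0..<length \<alpha>])) in
          Some (if t = 1 then take i \<alpha> @ drop (Suc i) \<alpha> else \<alpha>[i := t - 1]))
      else None))"

text \<open>v_[t-1] = d_1 ... d_{t-1}, with d_{t-1} applied first.\<close>
definition vop :: "nat \<Rightarrow> comp option \<Rightarrow> comp option" where
  "vop t a = foldl (\<lambda>b s. dop s b) a (rev [1..<t])"

definition aop :: "nat \<Rightarrow> comp option \<Rightarrow> comp option" where
  "aop t a = map_option (\<lambda>\<alpha>. \<alpha> @ [t]) a"

definition uop :: "nat \<Rightarrow> comp option \<Rightarrow> comp option" where
  "uop t a = aop t (vop t a)"

definition useq :: "nat list \<Rightarrow> comp \<Rightarrow> comp option" where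
  "useq js \<alpha> = foldl (\<lambda>a j. uop j a) (Some \<alpha>) js"

definition std :: "nat list \<Rightarrow> nat list" where
  "std w = map (\<lambda>i. 1 + length (filter (\<lambda>j. w!j < w!i) [0..<length w])
                     + length (filter (\<lambda>j. w!j = w!i) [0..<i])) [0..<length w]"

text \<open>Insertion of y into a reverse tableau (rows bottom to top) with decreasing rows,
  starting in the bottom row; returns the new tableau and the (0-based, from bottom)
  index of the row where the new box appears.\<close>
fun rs_ins :: "nat \<Rightarrow> nat list list \<Rightarrow> nat list list \<times> nat" where
  "rs_ins y [] = ([[y]], 0)"
| "rs_ins y (row # rows) =
     (let pre = takeWhile (\<lambda>x. y \<le> x) row; suf = dropWhile (\<lambda>x. y \<le> x) row in
      if suf = [] then ((row @ [y]) # rows, 0)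
      else (let (rows', k) = rs_ins (hd suf) rows in
            ((pre @ y # tl suf) # rows', Suc k)))"

definition add_at :: "nat \<Rightarrow> nat \<Rightarrow> nat list list \<Rightarrow> nat list list" where
  "add_at r v Q = (if r < length Q then Q[r := Q!r @ [v]] else Q @ [[v]])"

definition rs_step :: "nat \<Rightarrow> nat list list \<times> nat list list \<times> nat \<Rightarrow> nat
                        \<Rightarrow> nat list list \<times> nat list list \<times> nat" where
  "rs_step m s y = (case s of (P, Q, k) \<Rightarrow>
      (case rs_ins y P of (P', r) \<Rightarrow> (P', add_at r (m - k) Q, Suc k)))"

definition Qtab :: "nat list \<Rightarrow> nat list list" where
  "Qtab \<omega> = fst (snd (foldl (rs_step (length \<omega>)) ([], [], 0) \<omega>))"

definition upd :: "tab \<Rightarrow> nat \<Rightarrow> nat \<Rightarrow> nat \<Rightarrow> tab" where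
  "upd T r c v = T[r-1 := (T!(r-1))[c-1 := v]]"

definition chain :: "tab \<Rightarrow> nat \<Rightarrow> nat \<Rightarrow> nat list" where
  "chain T t r1 = foldl (\<lambda>ch r. if ent T (last ch) t < ent T r t \<and> ent T r (t+1) \<le> ent T (last ch) t
                                 then ch @ [r] else ch) [r1] (rev [1..<r1])"

definition phi :: "nat \<Rightarrow> tab \<Rightarrow> tab \<times> nat" where
  "phi s T = (let t = s - 1;
                  r1 = Max (set (filter (\<lambda>r. length (T!(r-1)) = t) [1..<length T + 1]));
                  ch = chain T t r1;
                  T1 = foldl (\<lambda>U p. upd U (ch!(Suc p)) t (ent T (ch!p) t)) T [0..<length ch - 1];
                  T2 = (if t = 1 then take (r1-1) T1 @ drop r1 T1
                        else T1[r1-1 := butlast (T1!(r1-1))])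
              in (T2, ent T (last ch) t))"

definition maxent :: "tab \<Rightarrow> nat" where
  "maxent T = foldr max (concat T) 0"

definition mu :: "nat \<Rightarrow> tab \<Rightarrow> tab" where
  "mu i T = (case foldl (\<lambda>(U, H) s. case phi s U of (U', e) \<Rightarrow> (U', H @ [e]))
                        (T, []) (rev [2..<i+1]) of
             (T', H) \<Rightarrow> T' @ [(maxent T + 1) # rev (sort H)])"

definition part :: "nat list \<Rightarrow> nat \<Rightarrow> nat" where
  "part lam r = (if 1 \<le> r \<and> r \<le> length lam then lam!(r-1) else 0)"

definition addable_in_col :: "nat list \<Rightarrow> nat \<Rightarrow> bool" where
  "addable_in_col lam c \<longleftrightarrow> 1 \<le> c \<and>
     (\<exists>r. 1 \<le> r \<and> part lam r = c - 1 \<and> (r = 1 \<or> c \<le> part lam (r-1)))"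

definition sorted_partition :: "tab \<Rightarrow> nat list" where
  "sorted_partition T = rev (sort (shape T))"

fun slides_defined :: "nat list \<Rightarrow> tab \<Rightarrow> bool" where
  "slides_defined [] T = True"
| "slides_defined (j # js) T = (addable_in_col (sorted_partition T) j \<and> slides_defined js (mu j T))"

definition museq :: "nat list \<Rightarrow> tab \<Rightarrow> tab" where
  "museq js T = foldl (\<lambda>U j. mu j U) T js"

text \<open>Bullet convention: entries greater than n become empty (inner) boxes.\<close>
definition bullet :: "nat \<Rightarrow> tab \<Rightarrow> tab" where
  "bullet n T = map (map (\<lambda>x. if n < x then 0 else x)) T"

end

theory Submission
  imports "HOL-Library.Multiset" Defs
begin

text \<open>
  The operator \<open>\<mu>\<^sub>i\<close> acts on the column contents of an SRCT as a jeu de taquin slide on its image under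
  \<open>\<rho>\<close>. Restricting attention to the entries greater than \<open>s\<close>, each slide adds one box; let \<open>J\<^sub>s\<close> be the
  word of the columns of these boxes. Then \<open>J\<^sub>0\<close> is the word of the slides \<open>j\<^sub>1 \<dots> j\<^sub>m\<close>, whereas \<open>J\<^sub>n\<close> is
  a lattice word whose content is the sequence of column lengths of the part with entries greater than \<open>n\<close>.
  Passing from \<open>s\<close> to \<open>s + 1\<close> changes the word by a sequence of crystal operators, each replacing a
  letter \<open>a + 1\<close> by \<open>a\<close>; such an operator does not change the shape of the insertion tableau of the
  reversed word. For a lattice word this shape is given by the content. Applied to the slides from
  the \<open>k\<close>-th one on, for all \<open>k\<close>, this identifies the columns of the entries greater than \<open>n\<close> with those of the recording tableau, and an
  SSRCT of straight shape is determined by the contents of its columns.\<close>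

text \<open>A slide carries the entry leaving column \<open>c\<close> into column
  \<open>c + 1\<close> of the new row, behind a new maximum; hence for every threshold
  \<open>s\<close> exactly one column gains an entry greater than \<open>s\<close>. As entries are
  distinct, the new row contains \<open>s + 1\<close> at most once, so the letters at levels
  \<open>s\<close> and \<open>s + 1\<close> differ by at most one. If they are \<open>b + 1\<close>
  and \<open>b\<close>, the triple rule for the entry \<open>s + 1\<close> of the last row makes
  columns \<open>b\<close> and \<open>b + 1\<close> equally long, before the slide at level
  \<open>s + 1\<close> and after it at level \<open>s\<close>. Since column lengths weakly decrease
  to the right, these two equalities are the bracket conditions on the earlier and on the later
  slides. So the letters are changed one slide at a time, through hybrid words with level
  \<open>s + 1\<close> on the earlier slides and level \<open>s\<close> on the others.

  Tableaux are described throughout by the number of entries above a threshold. A box of the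
  recording tableau has an entry greater than \<open>s\<close> exactly if it is created by the first
  \<open>m - s\<close> letters of the reversed word, that is, by the slides after the first
  \<open>s\<close>.\<close>

section \<open>Row insertion of words\<close>

text \<open>A row with strictly decreasing entries is represented by its set of entries; the second component
  of the result is the word of bumped letters, which is inserted into the next row.\<close>
fun row_run :: "nat set \<Rightarrow> nat list \<Rightarrow> nat set \<times> nat list" where
  "row_run R [] = (R, [])"
| "row_run R (y # u) =
    (if \<exists>x\<in>R. x \<le> y
     then (let z = Max {x \<in> R. x \<le> y} in apsnd ((#) z) (row_run (insert y (R - {z})) u))
     else row_run (insert y R) u)"

declare row_run.simps(2) [simp del]

lemma row_run_bump:
  assumes "z \<in> R" "z \<le> y" "\<And>x. x \<in> R \<Longrightarrow> x \<le> y \<Longrightarrow> x \<le> z"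
  shows "row_run R (y # u) = apsnd ((#) z) (row_run (insert y (R - {z})) u)"
proof -
  have "Max {x \<in> R. x \<le> y} = z"
    using assms by (intro Max_eqI) auto
  then show ?thesis using assms by (auto simp: row_run.simps(2))
qed

lemma row_run_new:
  assumes "\<And>x. x \<in> R \<Longrightarrow> y < x"
  shows "row_run R (y # u) = row_run (insert y R) u"
  using assms by (auto simp: row_run.simps(2) not_le[symmetric])

lemma row_cases:
  obtains (bump) z where "z \<in> R" "z \<le> y" "\<And>x. x \<in> R \<Longrightarrow> x \<le> y \<Longrightarrow> x \<le> z"
  | (new) "\<And>x. x \<in> R \<Longrightarrow> y < (x::nat)"
proof (cases "\<exists>x\<in>R. x \<le> y")
  case True
  then have ne: "{x \<in> R. x \<le> y} \<noteq> {}" by auto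
  have "Max {x \<in> R. x \<le> y} \<in> {x \<in> R. x \<le> y}" by (rule Max_in[OF _ ne]) simp
  then show ?thesis by (intro bump[of "Max {x \<in> R. x \<le> y}"]) auto
next
  case False
  then show ?thesis by (intro new) (auto simp: not_le[symmetric])
qed

text \<open>Removes \<open>Max\<close> from the later proofs: in the bump case the bumped letter
  \<open>z\<close> is known only as the greatest entry of the row not exceeding
  \<open>y\<close>.\<close>

lemma row_run_induct [consumes 1, case_names Nil bump new]:
  assumes "row_run R u = (R', v)"
    and "\<And>R. P R [] R []"
    and "\<And>R y u R' v z. \<lbrakk>z \<in> R; z \<le> y; \<And>x. x \<in> R \<Longrightarrow> x \<le> y \<Longrightarrow> x \<le> z;
          row_run (insert y (R - {z})) u = (R', v); P (insert y (R - {z})) u R' v\<rbrakk>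
          \<Longrightarrow> P R (y # u) R' (z # v)"
    and "\<And>R y u R' v. \<lbrakk>\<And>x. x \<in> R \<Longrightarrow> y < x;
          row_run (insert y R) u = (R', v); P (insert y R) u R' v\<rbrakk>
          \<Longrightarrow> P R (y # u) R' v"
  shows "P R u R' v"
  using assms(1)
proof (induction u arbitrary: R v)
  case Nil
  then show ?case using assms(2) by simp
next
  case (Cons y u)
  show ?case
  proof (cases rule: row_cases[of R y])
    case (bump z)
    obtain S w where r: "row_run (insert y (R - {z})) u = (S, w)" by fastforce
    with Cons.prems row_run_bump[OF bump] have "R' = S" "v = z # w" by auto
    with r show ?thesis using assms(3)[OF bump r] Cons.IH[OF r[folded \<open>R' = S\<close>]] by simp
  next
    case new
    then show ?thesis using Cons.prems row_run_new[OF new] assms(4)[OF new] Cons.IH by simp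
  qed
qed

lemma row_run_append:
  "row_run R (u @ u') = (case row_run R u of (S, v) \<Rightarrow> apsnd ((@) v) (row_run S u'))"
proof (induction u arbitrary: R)
  case Nil
  then show ?case by (simp add: apsnd_def map_prod_def split: prod.splits)
next
  case (Cons y u)
  show ?case
  proof (cases rule: row_cases[of R y])
    case (bump z)
    show ?thesis using Cons.IH
      by (auto simp: row_run_bump[OF bump] apsnd_def map_prod_def split: prod.splits)
  next
    case new
    then show ?thesis using Cons.IH by (simp add: row_run_new[OF new])
  qed
qed

lemma finite_row_run: "row_run R u = (R', v) \<Longrightarrow> finite R \<Longrightarrow> finite R'"
  by (induction rule: row_run_induct) auto

text \<open>Letters \<open>Suc a\<close> are opening and letters \<open>a\<close> closing brackets; the state counts the open brackets,
  and truncated subtraction discards an unmatched \<open>a\<close>.\<close>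
definition bracket_step :: "nat \<Rightarrow> nat \<Rightarrow> nat \<Rightarrow> nat" where
  "bracket_step a M y = (if y = Suc a then Suc M else if y = a then M - 1 else M)"

lemma bracket_step_simps [simp]: "bracket_step a M (Suc a) = Suc M" "bracket_step a M a = M - 1"
  by (simp_all add: bracket_step_def)

lemma bracket_step_other [simp]: "z \<noteq> a \<Longrightarrow> z \<noteq> Suc a \<Longrightarrow> bracket_step a M z = M"
  by (simp add: bracket_step_def)

abbreviation unmatched :: "nat \<Rightarrow> nat \<Rightarrow> nat list \<Rightarrow> nat" where
  "unmatched a \<equiv> foldl (bracket_step a)"

text \<open>Every closing bracket \<open>a\<close> finds an opening one, either among the
  \<open>N\<close> already open or earlier in the word. In contrast with
  \<open>bracket_step\<close>, an unmatched \<open>a\<close> is not discarded but makes the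
  condition fail.\<close>

fun prefix_matched :: "nat \<Rightarrow> nat \<Rightarrow> nat list \<Rightarrow> bool" where
  "prefix_matched a N [] = True"
| "prefix_matched a N (y # u) = (if y = Suc a then prefix_matched a (Suc N) u
     else if y = a then 0 < N \<and> prefix_matched a (N - 1) u else prefix_matched a N u)"

text \<open>The indicators account for brackets held in the row: a \<open>Suc a\<close> there has
  opened a bracket of the input but not yet of the output, and an \<open>a\<close> there has closed
  one of the input but not yet of the output. Corrected in this way, the output never has more open
  brackets than the input. Only an inequality survives, because the subtraction is truncated on both
  sides.\<close>

lemma unmatched_row_run:
  assumes "row_run R u = (R', v)"
    and "Mv + of_bool (Suc a \<in> R) \<le> Mw + of_bool (a \<in> R)"
  shows "unmatched a Mv v + of_bool (Suc a \<in> R') \<le> unmatched a Mw u + of_bool (a \<in> R')"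
  using assms
proof (induction arbitrary: Mv Mw rule: row_run_induct)
  case (bump R y u R' v z)
  have "bracket_step a Mv z + of_bool (Suc a \<in> insert y (R - {z}))
     \<le> bracket_step a Mw y + of_bool (a \<in> insert y (R - {z}))"
    using bump(1,2,6) bump(3)[of a] bump(3)[of "Suc a"]
    by (auto simp: bracket_step_def of_bool_def split: if_splits)
  from bump(5)[OF this] show ?case by simp
next
  case (new R y u R' v)
  have "Mv + of_bool (Suc a \<in> insert y R) \<le> bracket_step a Mw y + of_bool (a \<in> insert y R)"
    using new(4) new(1)[of a] new(1)[of "Suc a"]
    by (auto simp: bracket_step_def of_bool_def split: if_splits)
  from new(3)[OF this] show ?case by simp
qed simp

text \<open>The same balance as in \<open>unmatched_row_run\<close>, now an equality, since without
  unmatched closing brackets no subtraction is truncated.\<close>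

lemma prefix_matched_row_run:
  assumes "row_run R u = (R', v)" "prefix_matched a N u"
    and "N + of_bool (a \<in> R) = N' + of_bool (Suc a \<in> R)"
  shows "prefix_matched a N' v"
  using assms
proof (induction arbitrary: N N' rule: row_run_induct)
  case (bump R y u R' v z)
  define N2 where "N2 = (if y = Suc a then Suc N else if y = a then N - 1 else N)"
  define N2' where "N2' = (if z = Suc a then Suc N' else if z = a then N' - 1 else N')"
  have n2: "prefix_matched a N2 u" using bump(6) by (auto simp: N2_def split: if_splits)
  have pos: "y = a \<Longrightarrow> 0 < N" using bump(6) by (auto split: if_splits)
  \<comment> \<open>An emitted \<open>a\<close> needs an open bracket of the output. If the row also
    contains \<open>Suc a\<close>, then \<open>a\<close> can only be bumped by an equal letter, for
    which the input has an open bracket.\<close>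
  have pos': "0 < N'" if "z = a"
  proof (cases "Suc a \<in> R")
    case True
    with that bump(2) bump(3)[of "Suc a"] have "y = a" by fastforce
    with True that bump(1,7) pos show ?thesis by simp
  next
    case False
    with that bump(1,7) show ?thesis by simp
  qed
  have "N2 + of_bool (a \<in> insert y (R - {z})) = N2' + of_bool (Suc a \<in> insert y (R - {z}))"
    using bump(1,2,7) bump(3)[of a] bump(3)[of "Suc a"] pos pos'
    by (auto simp: N2_def N2'_def of_bool_def split: if_splits)
  from bump(5)[OF n2 this] pos' show ?case by (auto simp: N2'_def split: if_splits)
next
  case (new R y u R' v)
  define N2 where "N2 = (if y = Suc a then Suc N else if y = a then N - 1 else N)"
  have n2: "prefix_matched a N2 u" using new(4) by (auto simp: N2_def split: if_splits)
  have pos: "y = a \<Longrightarrow> 0 < N" using new(4) by (auto split: if_splits)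
  have "N2 + of_bool (a \<in> insert y R) = N' + of_bool (Suc a \<in> insert y R)"
    using new(5) new(1)[of a] new(1)[of "Suc a"] pos
    by (auto simp: N2_def of_bool_def split: if_splits)
  from new(3)[OF n2 this] show ?case .
qed simp

text \<open>The bracketing condition says that the changed letter is the one on which the crystal operator acts.\<close>
definition lowers :: "nat \<Rightarrow> nat list \<Rightarrow> nat list \<Rightarrow> bool" where
  "lowers a w w' \<longleftrightarrow> (\<exists>w1 w2. w = w1 @ Suc a # w2 \<and> w' = w1 @ a # w2 \<and>
                        unmatched a 0 w1 = 0 \<and> prefix_matched a 0 w2)"

lemma lowers_appendI: "unmatched a 0 v1 = 0 \<Longrightarrow> prefix_matched a 0 v2 \<Longrightarrow> lowers a (v1 @ Suc a # v2) (v1 @ a # v2)"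
  by (auto simp: lowers_def)

text \<open>The two rows differ only in having \<open>Suc a\<close> in place of \<open>a\<close>.
  The difference persists until both entries are bumped by the same letter; then the rows coincide
  and the emitted words differ in exactly this place. If it persists to the end, the emitted words
  are equal. \<open>v0\<close> is what the row has emitted before; it enters the bracket condition
  to the left of the changed letter.\<close>

lemma row_run_pending:
  assumes "prefix_matched a 0 u" "finite A" "a \<notin> A" "Suc a \<notin> A"
    and "row_run (insert (Suc a) A) u = (R, v)" "row_run (insert a A) u = (R', v')"
    and "unmatched a 0 v0 = 0"
  shows "card R = card R' \<and> (v = v' \<or> lowers a (v0 @ v) (v0 @ v'))"
  using assms
proof (induction u arbitrary: A R R' v v' v0)
  case Nil
  then have "R = insert (Suc a) A" "R' = insert a A" "v = v'" by auto
  then show ?case using Nil by simp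
next
  case (Cons y u)
  \<comment> \<open>With no bracket open, a matched word cannot continue with the closing bracket
    \<open>a\<close>.\<close>
  have ya: "y \<noteq> a" using Cons.prems(1) by auto
  show ?case
  proof (cases "y = Suc a")
    case True
    obtain S w where r: "row_run (insert (Suc a) A) u = (S, w)" by fastforce
    have e1: "insert y (insert (Suc a) A - {Suc a}) = insert (Suc a) A" using Cons.prems True by auto
    have e2: "insert y (insert a A - {a}) = insert (Suc a) A" using Cons.prems True by auto
    have "row_run (insert (Suc a) A) (y # u) = apsnd ((#) (Suc a)) (row_run (insert (Suc a) A) u)"
      by (subst row_run_bump[of "Suc a"]) (use True e1 in auto)
    then have 1: "R = S" "v = Suc a # w" using Cons.prems(5) r by auto
    have "row_run (insert a A) (y # u) = apsnd ((#) a) (row_run (insert (Suc a) A) u)"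
      by (subst row_run_bump[of "a"]) (use True e2 Cons.prems(4) in \<open>auto simp: le_Suc_eq\<close>)
    then have 2: "R' = S" "v' = a # w" using Cons.prems(6) r by auto
    have "prefix_matched a 0 w" using prefix_matched_row_run[OF r, of a "Suc 0" 0] Cons.prems(1,3) True by auto
    then show ?thesis using 1 2 Cons.prems(7) by (auto intro: lowers_appendI)
  next
    case ns: False
    have nk: "prefix_matched a 0 u" using Cons.prems(1) ns ya by auto
    show ?thesis
    \<comment> \<open>For the remaining letters, this is exactly the case where \<open>y\<close>
      bumps the pending entry in both rows.\<close>
    proof (cases "Suc a < y \<and> (\<forall>x\<in>A. x \<le> y \<longrightarrow> x < a)")
      case True
      obtain S w where r: "row_run (insert y A) u = (S, w)" by fastforce
      have e1: "insert y (insert (Suc a) A - {Suc a}) = insert y A"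
        and e2: "insert y (insert a A - {a}) = insert y A" using Cons.prems by auto
      have "row_run (insert (Suc a) A) (y # u) = apsnd ((#) (Suc a)) (row_run (insert y A) u)"
        by (subst row_run_bump[of "Suc a"]) (use True e1 in \<open>auto simp: less_Suc_eq_le[symmetric] less_SucI\<close>)
      then have 1: "R = S" "v = Suc a # w" using Cons.prems(5) r by auto
      have "row_run (insert a A) (y # u) = apsnd ((#) a) (row_run (insert y A) u)"
        by (subst row_run_bump[of "a"]) (use True e2 in \<open>auto simp: less_imp_le\<close>)
      then have 2: "R' = S" "v' = a # w" using Cons.prems(6) r by auto
      have "prefix_matched a 0 w" using prefix_matched_row_run[OF r, of a 0 0] nk Cons.prems(3,4) ns ya by auto
      then show ?thesis using 1 2 Cons.prems(7) by (auto intro: lowers_appendI)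
    next
      case F: False
      show ?thesis
      proof (cases rule: row_cases[of A y])
        case (bump z)
        have zna: "z \<noteq> a" "z \<noteq> Suc a" using bump(1) Cons.prems(3,4) by auto
        have zz: "y < a \<or> Suc a < z"
          using F ya ns zna bump by (metis Suc_lessI dual_order.strict_trans1 leD le_less_linear linorder_neqE_nat)
        let ?A = "insert y (A - {z})"
        obtain S w where r: "row_run (insert (Suc a) ?A) u = (S, w)" by fastforce
        obtain S' w' where r': "row_run (insert a ?A) u = (S', w')" by fastforce
        have e1: "insert y (insert (Suc a) A - {z}) = insert (Suc a) ?A"
          and e2: "insert y (insert a A - {z}) = insert a ?A" using zna by auto
        have "row_run (insert (Suc a) A) (y # u) = apsnd ((#) z) (row_run (insert (Suc a) ?A) u)"
          by (subst row_run_bump[of z]) (use bump zz e1 in auto)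
        then have 1: "R = S" "v = z # w" using Cons.prems(5) r by auto
        have "row_run (insert a A) (y # u) = apsnd ((#) z) (row_run (insert a ?A) u)"
          by (subst row_run_bump[of z]) (use bump zz e2 in auto)
        then have 2: "R' = S'" "v' = z # w'" using Cons.prems(6) r' by auto
        have m: "unmatched a 0 (v0 @ [z]) = 0" using Cons.prems(7) zna by (simp add: bracket_step_other)
        have "card S = card S' \<and> (w = w' \<or> lowers a ((v0 @ [z]) @ w) ((v0 @ [z]) @ w'))"
          by (rule Cons.IH[OF nk _ _ _ r r' m]) (use Cons.prems ns ya in auto)
        then show ?thesis using 1 2 by auto
      next
        case new
        have yl: "y < a" using F new ya ns by (metis Suc_lessI leD linorder_neqE_nat)
        let ?A = "insert y A"
        have "row_run (insert (Suc a) A) (y # u) = row_run (insert (Suc a) ?A) u"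
          by (subst row_run_new) (use new yl in \<open>auto simp: insert_commute\<close>)
        moreover have "row_run (insert a A) (y # u) = row_run (insert a ?A) u"
          by (subst row_run_new) (use new yl in \<open>auto simp: insert_commute\<close>)
        ultimately have r: "row_run (insert (Suc a) ?A) u = (R, v)" "row_run (insert a ?A) u = (R', v')"
          using Cons.prems(5,6) by auto
        show ?thesis
          by (rule Cons.IH[OF nk _ _ _ r Cons.prems(7)]) (use Cons.prems ns ya in auto)
      qed
    qed
  qed
qed

text \<open>Inserting the changed letter either emits it at once (if both \<open>a\<close> and
  \<open>Suc a\<close> are in the row) or leaves two rows with a pending difference. A row thus
  keeps its length and hands the next row either equal words or words related by the same operator,
  which allows an induction over the rows.\<close>

lemma lowers_row_run:
  assumes "lowers a w w'" "row_run {} w = (R, v)" "row_run {} w' = (R', v')"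
  shows "card R = card R' \<and> (v = v' \<or> lowers a v v')"
proof -
  obtain w1 w2 where w: "w = w1 @ Suc a # w2" "w' = w1 @ a # w2"
    and u0: "unmatched a 0 w1 = 0" and nk: "prefix_matched a 0 w2"
    using assms(1) by (auto simp: lowers_def)
  obtain S v1 where r1: "row_run {} w1 = (S, v1)" by fastforce
  have fS: "finite S" using finite_row_run[OF r1] by simp
  have inv: "unmatched a 0 v1 + of_bool (Suc a \<in> S) \<le> of_bool (a \<in> S)"
    using unmatched_row_run[OF r1, of 0 a 0] u0 by simp
  obtain B x where B: "row_run S (Suc a # w2) = (B, x)" by fastforce
  obtain B' x' where B': "row_run S (a # w2) = (B', x')" by fastforce
  have R: "R = B" "v = v1 @ x" "R' = B'" "v' = v1 @ x'"
    using assms(2,3) r1 B B' by (auto simp: w row_run_append)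
  show ?thesis
  proof (cases "a \<in> S")
    case a: True
    show ?thesis
    proof (cases "Suc a \<in> S")
      case True
      obtain C y where C: "row_run S w2 = (C, y)" by fastforce
      have e: "insert (Suc a) (S - {Suc a}) = S" "insert a (S - {a}) = S" using a True by auto
      have "row_run S (Suc a # w2) = apsnd ((#) (Suc a)) (row_run S w2)"
        by (subst row_run_bump[of "Suc a"]) (use True e in auto)
      moreover have "row_run S (a # w2) = apsnd ((#) a) (row_run S w2)"
        by (subst row_run_bump[of "a"]) (use a e in auto)
      ultimately have 1: "B = C" "B' = C" "x = Suc a # y" "x' = a # y" using B B' C by auto
      have "prefix_matched a 0 y" using prefix_matched_row_run[OF C nk, of 0] a True by auto
      then show ?thesis using R 1 inv a True by (auto intro: lowers_appendI)
    next
      case False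
      let ?A = "S - {a}"
      obtain C y where C: "row_run (insert (Suc a) ?A) w2 = (C, y)" by fastforce
      obtain C' y' where C': "row_run (insert a ?A) w2 = (C', y')" by fastforce
      have "row_run S (Suc a # w2) = apsnd ((#) a) (row_run (insert (Suc a) ?A) w2)"
        by (subst row_run_bump[of "a"]) (use a False in \<open>auto simp: le_Suc_eq\<close>)
      moreover have "row_run S (a # w2) = apsnd ((#) a) (row_run (insert a ?A) w2)"
        by (subst row_run_bump[of "a"]) (use a in auto)
      ultimately have 1: "B = C" "B' = C'" "x = a # y" "x' = a # y'" using B B' C C' by auto
      \<comment> \<open>Here \<open>v1\<close> may leave one bracket open, which is closed by the
        \<open>a\<close> bumped in both rows.\<close>
      have "unmatched a 0 (v1 @ [a]) = 0" using inv a by (auto simp: bracket_step_def of_bool_def split: if_splits)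
      from row_run_pending[OF nk _ _ _ C C' this] fS False
      show ?thesis using R 1 by auto
    qed
  next
    case a: False
    \<comment> \<open>A row containing \<open>Suc a\<close> but not \<open>a\<close> is excluded by
      \<open>inv\<close>.\<close>
    then have sa: "Suc a \<notin> S" and u1: "unmatched a 0 v1 = 0" using inv by (auto simp: of_bool_def split: if_splits)
    show ?thesis
    proof (cases rule: row_cases[of S a])
      case (bump z)
      let ?A = "S - {z}"
      obtain C y where C: "row_run (insert (Suc a) ?A) w2 = (C, y)" by fastforce
      obtain C' y' where C': "row_run (insert a ?A) w2 = (C', y')" by fastforce
      have za: "z \<noteq> a" "z \<noteq> Suc a" using bump a sa by auto
      have "row_run S (Suc a # w2) = apsnd ((#) z) (row_run (insert (Suc a) ?A) w2)"
        by (subst row_run_bump[of z]) (use bump sa in \<open>auto simp: le_Suc_eq\<close>)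
      moreover have "row_run S (a # w2) = apsnd ((#) z) (row_run (insert a ?A) w2)"
        by (subst row_run_bump[of z]) (use bump in auto)
      ultimately have 1: "B = C" "B' = C'" "x = z # y" "x' = z # y'" using B B' C C' by auto
      have "unmatched a 0 (v1 @ [z]) = 0" using u1 za by (simp add: bracket_step_other)
      from row_run_pending[OF nk _ _ _ C C' this] fS a sa
      show ?thesis using R 1 by auto
    next
      case new
      have "row_run S (Suc a # w2) = row_run (insert (Suc a) S) w2"
        by (rule row_run_new) (use new sa a in \<open>metis Suc_lessI\<close>)
      moreover have "row_run S (a # w2) = row_run (insert a S) w2"
        by (rule row_run_new) (use new in auto)
      ultimately have "row_run (insert (Suc a) S) w2 = (B, x)" "row_run (insert a S) w2 = (B', x')"
        using B B' by auto
      from row_run_pending[OF nk fS a sa this u1] show ?thesis using R by auto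
    qed
  qed
qed

text \<open>Length of row \<open>i\<close>, counted from 0 at the bottom, of the insertion tableau
  of \<open>w\<close>. Bumped letters only move upwards, so a row may process its whole word before
  the next row starts.\<close>

fun rowlen :: "nat \<Rightarrow> nat list \<Rightarrow> nat" where
  "rowlen 0 w = card (fst (row_run {} w))"
| "rowlen (Suc i) w = rowlen i (snd (row_run {} w))"

lemma rowlen_lowers: "lowers a w w' \<Longrightarrow> rowlen i w = rowlen i w'"
proof (induction i arbitrary: w w')
  case 0
  obtain R v R' v' where "row_run {} w = (R, v)" "row_run {} w' = (R', v')" by fastforce
  with lowers_row_run[OF 0 this] show ?case by simp
next
  case (Suc i)
  obtain R v R' v' where "row_run {} w = (R, v)" "row_run {} w' = (R', v')" by fastforce
  with lowers_row_run[OF Suc.prems this] Suc.IH[of v v'] show ?case by auto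
qed

section \<open>Insertion of lattice words\<close>

lemma set_row_run: "row_run R u = (R', v) \<Longrightarrow> set v \<union> R' \<subseteq> R \<union> set u"
  by (induction rule: row_run_induct) auto

text \<open>An entry is only ever replaced by one at least as large, so the row keeps an upper bound
  for every letter it has seen.\<close>

lemma row_run_dom: "row_run R u = (R', v) \<Longrightarrow> b \<in> R \<union> set u \<Longrightarrow> \<exists>x\<in>R'. b \<le> x"
proof (induction arbitrary: b rule: row_run_induct)
  case (bump R y u R' v z)
  show ?case
  proof (cases "b = z")
    case True
    with bump(2) bump(5)[of y] show ?thesis by (auto intro: order_trans)
  next
    case False
    with bump(5)[of b] bump(6) show ?thesis by auto
  qed
qed auto

lemma count_row_run:
  "row_run R u = (R', v) \<Longrightarrow>
   count_list u b + of_bool (b \<in> R) = count_list v b + of_bool (b \<in> R')"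
proof (induction rule: row_run_induct)
  case (bump R y u R' v z)
  moreover have "y = z" if "y \<in> R" using bump(2) bump(3)[OF that] by simp
  ultimately show ?case by (cases "b = y"; cases "b = z"; cases "b \<in> R") auto
next
  case (new R y u R' v)
  then show ?case by (cases "b = y"; cases "b \<in> R") auto
qed auto

lemma unmatched_notin: "Suc a \<notin> set v \<Longrightarrow> unmatched a 0 v = 0"
proof -
  have "Suc a \<notin> set v \<Longrightarrow> unmatched a M v \<le> M" for M
  proof (induction v arbitrary: M)
    case (Cons y v)
    then have "unmatched a (bracket_step a M y) v \<le> bracket_step a M y" by simp
    also have "\<dots> \<le> M" using Cons.prems by (auto simp: bracket_step_def)
    finally show ?case by simp
  qed simp
  from this[of 0] show "Suc a \<notin> set v \<Longrightarrow> unmatched a 0 v = 0" by simp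
qed

text \<open>Yamanouchi condition read from the right: every suffix has at least as many letters
  \<open>a\<close> as letters \<open>Suc a\<close>. In crystal terms, no operator lowering
  \<open>Suc a\<close> to \<open>a\<close> applies. Letters are columns, hence positive.\<close>

definition lattice_word :: "nat list \<Rightarrow> bool" where
  "lattice_word w \<longleftrightarrow> 0 \<notin> set w \<and> (\<forall>a\<ge>1. unmatched a 0 w = 0)"

text \<open>By \<open>unmatched_row_run\<close>, an entry \<open>Suc a\<close> of the row forces the
  entry \<open>a\<close>, so the row is an interval starting at 1; by \<open>row_run_dom\<close> it
  contains every letter that occurs. The row thus takes one copy of each letter and passes on a
  lattice word.\<close>

lemma lattice_word_row_run:
  assumes "lattice_word w" "row_run {} w = (R, v)"
  shows "lattice_word v" "R = {1..card R}" "b \<in> R \<longleftrightarrow> b \<in> set w"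
proof -
  have inv: "unmatched a 0 v + of_bool (Suc a \<in> R) \<le> of_bool (a \<in> R)" if "a \<ge> 1" for a
    using unmatched_row_run[OF assms(2), of 0 a 0] assms(1) that by (simp add: lattice_word_def)
  have sub: "set v \<union> R \<subseteq> set w" using set_row_run[OF assms(2)] by simp
  have step: "a \<in> R" if "a \<ge> 1" "Suc a \<in> R" for a
    using inv[OF that(1)] that(2) by (auto simp: of_bool_def split: if_splits)
  have down: "b \<in> R" if "1 \<le> b" "b \<le> c" "c \<in> R" for b c
    using that(2,3)
  proof (induction c rule: dec_induct)
    case (step n)
    have "n \<in> R" by (rule \<open>\<And>a. 1 \<le> a \<Longrightarrow> Suc a \<in> R \<Longrightarrow> a \<in> R\<close>) (use step that(1) in auto)
    then show ?case by (rule step.IH)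
  qed
  show br: "b \<in> R \<longleftrightarrow> b \<in> set w" for b
  proof
    assume b: "b \<in> set w"
    then have "b \<noteq> 0" using assms(1) by (intro notI) (simp add: lattice_word_def)
    then have "1 \<le> b" by simp
    moreover obtain x where "x \<in> R" "b \<le> x" using row_run_dom[OF assms(2), of b] b by auto
    ultimately show "b \<in> R" using down by blast
  qed (use sub in auto)
  have R: "R = {1..Max R}" if "R \<noteq> {}"
  proof -
    have f: "finite R" using finite_row_run[OF assms(2)] by simp
    have "0 \<notin> R" using br assms(1) by (auto simp: lattice_word_def)
    show ?thesis
    proof
      show "R \<subseteq> {1..Max R}"
        using \<open>0 \<notin> R\<close> Max_ge[OF f] by (auto simp: Suc_le_eq) (metis gr0I)
      show "{1..Max R} \<subseteq> R"
        using down[OF _ _ Max_in[OF f that]] by (intro subsetI) (auto simp del: Max_in)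
    qed
  qed
  obtain M where "R = {1..M}"
  proof (cases "R = {}")
    case True
    then show ?thesis using that[of 0] by simp
  next
    case False
    from that[OF R[OF this]] show ?thesis .
  qed
  then show "R = {1..card R}" by simp
  show "lattice_word v"
    unfolding lattice_word_def
  proof (intro conjI allI impI)
    show "0 \<notin> set v" using sub assms(1) by (auto simp: lattice_word_def)
    fix a :: nat assume a: "1 \<le> a"
    show "unmatched a 0 v = 0"
    proof (cases "Suc a \<in> R")
      case True
      then show ?thesis using inv[OF a] by (auto simp: of_bool_def split: if_splits)
    next
      case False
      then show ?thesis using sub br by (intro unmatched_notin) auto
    qed
  qed
qed

text \<open>Each row takes one copy of every remaining letter, so row \<open>i\<close> consists of
  the letters occurring more than \<open>i\<close> times: the content gives the column lengths of
  the tableau.\<close>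

lemma rowlen_lattice_word: "lattice_word w \<Longrightarrow> j < rowlen i w \<longleftrightarrow> i < count_list w (Suc j)"
proof (induction i arbitrary: w)
  case 0
  obtain R v where r: "row_run {} w = (R, v)" by fastforce
  note y = lattice_word_row_run[OF 0 r]
  have "j < card R \<longleftrightarrow> Suc j \<in> R" by (subst (2) y(2)) auto
  then show ?case using y(3)[of "Suc j"] r count_list_0_iff[of w "Suc j"] by (simp add: neq0_conv[symmetric] del: neq0_conv)
next
  case (Suc i)
  obtain R v where r: "row_run {} w = (R, v)" by fastforce
  note y = lattice_word_row_run[OF Suc.prems r]
  have "count_list w (Suc j) = count_list v (Suc j) + of_bool (Suc j \<in> R)"
    using count_row_run[OF r, of "Suc j"] by simp
  moreover have "count_list w (Suc j) = 0" if "Suc j \<notin> R"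
    using that y(3)[of "Suc j"] by (simp add: count_list_0_iff)
  ultimately show ?case using Suc.IH[OF y(1)] r by (cases "Suc j \<in> R") auto
qed

text \<open>The suffix \<open>s\<close> starts after the last discarded closing bracket; from there
  on no subtraction is truncated and the state is a plain difference of counts.\<close>

lemma unmatched_suffix: "\<exists>p s. w = p @ s \<and> count_list s (Suc a) = count_list s a + unmatched a 0 w"
proof (induction w rule: rev_induct)
  case (snoc y w)
  then obtain p s where ps: "w = p @ s" "count_list s (Suc a) = count_list s a + unmatched a 0 w" by auto
  show ?case
  proof (cases "y = a \<and> unmatched a 0 w = 0")
    case True
    then show ?thesis by (intro exI[of _ "w @ [y]"] exI[of _ "[]"]) auto
  next
    case False
    then show ?thesis using ps
      by (intro exI[of _ p] exI[of _ "s @ [y]"]) (cases "y = a"; cases "y = Suc a"; auto)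
  qed
qed auto

text \<open>Together with \<open>prefix_matchedI\<close> this turns the bracket conditions into
  comparisons of letter counts, which for words of slides are differences of column lengths.\<close>

lemma unmatched_zeroI:
  assumes "\<And>p s. w = p @ s \<Longrightarrow> count_list s (Suc a) \<le> count_list s a"
  shows "unmatched a 0 w = 0"
  using unmatched_suffix[of w a] assms by fastforce

lemma prefix_matchedI:
  assumes "\<And>p s. w = p @ s \<Longrightarrow> count_list p a \<le> N + count_list p (Suc a)"
  shows "prefix_matched a N w"
  using assms
proof (induction w arbitrary: N)
  case (Cons y w)
  have *: "count_list (y # p) a \<le> N + count_list (y # p) (Suc a)" if "w = p @ s" for p s
    using Cons.prems[of "y # p" s] that by simp
  show ?case
  proof (cases "y = Suc a")
    case True
    then show ?thesis using Cons.IH[of "Suc N"] * by fastforce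
  next
    case F: False
    show ?thesis
    proof (cases "y = a")
      case True
      have "0 < N" using *[of "[]" w] True by simp
      moreover have "prefix_matched a (N - 1) w" using *  True \<open>0 < N\<close> by (intro Cons.IH) fastforce
      ultimately show ?thesis using True by simp
    next
      case False
      then show ?thesis using F Cons.IH[of N] * by fastforce
    qed
  qed
qed simp

section \<open>Standardization and the recording tableau\<close>

text \<open>The insertion \<open>rs_ins\<close> read on letters instead of labels. An entry equal to
  \<open>y\<close> is bumped too, since it stands for a smaller label.\<close>

fun word_ins :: "nat \<Rightarrow> nat list list \<Rightarrow> nat list list \<times> nat" where
  "word_ins y [] = ([[y]], 0)"
| "word_ins y (row # rows) =
     (let pre = takeWhile (\<lambda>x. y < x) row; suf = dropWhile (\<lambda>x. y < x) row in
      if suf = [] then ((row @ [y]) # rows, 0)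
      else (let (rows', k) = word_ins (hd suf) rows in
            ((pre @ y # tl suf) # rows', Suc k)))"

abbreviation word_run :: "nat list list \<Rightarrow> nat list \<Rightarrow> nat list list" where
  "word_run \<equiv> foldl (\<lambda>P y. fst (word_ins y P))"

text \<open>The bottom row sees only \<open>w\<close> and the rows above see only the word of bumped
  letters, so inserting letter by letter into the tableau agrees with processing row after
  row.\<close>

lemma word_run_Cons:
  assumes "sorted_wrt (>) R"
  shows "\<exists>R'. sorted_wrt (>) R' \<and> set R' = fst (row_run (set R) w) \<and>
              word_run (R # P) w = R' # word_run P (snd (row_run (set R) w))"
  using assms
proof (induction w arbitrary: R P)
  case Nil
  then show ?case by simp
next
  case (Cons y w)
  let ?p = "\<lambda>x. y < x"
  show ?case
  proof (cases "dropWhile ?p R")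
    case Nil
    then have all: "\<And>x. x \<in> set R \<Longrightarrow> y < x" by (auto simp: dropWhile_eq_Nil_conv)
    have "sorted_wrt (>) (R @ [y])" using Cons.prems all by (simp add: sorted_wrt_append)
    from Cons.IH[OF this, of P] show ?thesis
      using Nil row_run_new[OF all, of _ w] by simp
  next
    case (Cons z zs)
    have R: "R = takeWhile ?p R @ z # zs" using Cons by (metis takeWhile_dropWhile_id)
    have zy: "z \<le> y" using Cons by (metis dropWhile_eq_Cons_conv leI)
    have tw: "y < x" if "x \<in> set (takeWhile ?p R)" for x using set_takeWhileD[OF that] by simp
    have s: "sorted_wrt (>) (takeWhile ?p R @ z # zs)" using R Cons.prems by metis
    have zs: "x < z" if "x \<in> set zs" for x using s that by (auto simp: sorted_wrt_append)
    have s': "sorted_wrt (>) (takeWhile ?p R @ y # zs)"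
      using s tw zy zs by (auto simp: sorted_wrt_append) fastforce+
    have setR: "set R = set (takeWhile ?p R) \<union> {z} \<union> set zs" by (subst R) auto
    have zR: "z \<in> set R" using setR by auto
    have mx: "x \<le> z" if "x \<in> set R" "x \<le> y" for x
      using that zs tw unfolding setR by force
    have "z \<notin> set (takeWhile ?p R)" "z \<notin> set zs" using tw zy zs by force+
    then have e: "set (takeWhile ?p R @ y # zs) = insert y (set R - {z})"
      unfolding setR by auto
    obtain P' k where P': "word_ins z P = (P', k)" by fastforce
    from Cons.IH[OF s', of P'] show ?thesis
      using row_run_bump[OF zR zy mx, of w] Cons P' unfolding e
      by (simp add: Let_def del: dropWhile_eq_Nil_conv)
  qed
qed

lemma word_run_nonempty: "w \<noteq> [] \<Longrightarrow> word_run [] w = word_run [[]] w"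
  by (cases w) auto

lemma in_diagram_word_run: "i < length (word_run [] w) \<and> j < length (word_run [] w ! i) \<longleftrightarrow> j < rowlen i w"
proof (induction i arbitrary: w)
  case 0
  show ?case
  proof (cases "w = []")
    case False
    obtain R where "sorted_wrt (>) R" "set R = fst (row_run {} w)"
      "word_run [] w = R # word_run [] (snd (row_run {} w))"
      using word_run_Cons[of "[]" w "[]"] word_run_nonempty[OF False] by auto
    moreover have "distinct R"
      using \<open>sorted_wrt (>) R\<close> by (induction R) auto
    ultimately show ?thesis by (metis distinct_card length_Cons nth_Cons_0 rowlen.simps(1) zero_less_Suc)
  qed simp
next
  case (Suc i)
  show ?case
  proof (cases "w = []")
    case True
    have "rowlen i [] = 0" for i by (induction i) auto
    then show ?thesis using True by simp
  next
    case False
    obtain R where "word_run [] w = R # word_run [] (snd (row_run {} w))"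
      using word_run_Cons[of "[]" w "[]"] word_run_nonempty[OF False] by auto
    then show ?thesis using Suc.IH[of "snd (row_run {} w)"] by simp
  qed
qed

text \<open>Equal letters of a word get increasing labels in the standardization, and of two equal letters the
  earlier one, with the smaller label, is in a higher row.\<close>
definition rs_compatible :: "(nat \<Rightarrow> nat) \<Rightarrow> nat list list \<Rightarrow> bool" where
  "rs_compatible f P \<longleftrightarrow> (\<forall>row\<in>set P. sorted_wrt (\<lambda>x x'. f x' < f x) row) \<and>
     sorted_wrt (\<lambda>A B. \<forall>x\<in>set A. \<forall>x'\<in>set B. f x = f x' \<longrightarrow> x' < x) P"

text \<open>Labels and letters bump in the same places provided that equal letters already present
  carry smaller labels. For the label bumped into the next row this proviso is supplied by
  \<open>rs_compatible\<close>.\<close>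

lemma rs_ins_word_ins:
  assumes "rs_ins y P = (P', r)" "rs_compatible f P"
    and "\<And>x. x \<in> set (concat P) \<Longrightarrow> f x = f y \<Longrightarrow> x < y"
    and "\<And>x x'. x \<in> insert y (set (concat P)) \<Longrightarrow> x' \<in> insert y (set (concat P)) \<Longrightarrow> x < x' \<Longrightarrow> f x \<le> f x'"
  shows "rs_compatible f P' \<and> set (concat P') = insert y (set (concat P)) \<and>
         word_ins (f y) (map (map f) P) = (map (map f) P', r)"
  using assms
proof (induction P arbitrary: y P' r)
  case Nil
  then show ?case by (auto simp: rs_compatible_def)
next
  case (Cons row rows)
  note prems = Cons.prems and IH0 = Cons.IH
  let ?p = "\<lambda>x. y \<le> x" and ?q = "\<lambda>v. f y < v"
  \<comment> \<open>The boundary case is \<open>f x = f y\<close>, where \<open>x < y\<close> by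
    assumption, so that \<open>x\<close> is bumped in both insertions.\<close>
  have pq: "y \<le> x \<longleftrightarrow> f y < f x" if "x \<in> set row" for x
  proof -
    have x: "x \<in> set (concat (row # rows))" using that by simp
    show ?thesis using prems(3)[OF x] prems(4)[of x y] prems(4)[of y x] x
      by (metis insertCI leD le_less linorder_not_le order_less_irrefl)
  qed
  have tw: "takeWhile ?q (map f row) = map f (takeWhile ?p row)"
  proof -
    have "takeWhile (?q \<circ> f) row = takeWhile ?p row"
      by (rule takeWhile_cong) (simp_all add: pq)
    then show ?thesis by (simp add: takeWhile_map)
  qed
  have dw: "dropWhile ?q (map f row) = map f (dropWhile ?p row)"
  proof -
    have "dropWhile (?q \<circ> f) row = dropWhile ?p row"
      by (rule dropWhile_cong) (simp_all add: pq)
    then show ?thesis by (simp add: dropWhile_map)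
  qed
  have g: "sorted_wrt (\<lambda>x x'. f x' < f x) row" "rs_compatible f rows"
    "\<And>B x x'. B \<in> set rows \<Longrightarrow> x \<in> set row \<Longrightarrow> x' \<in> set B \<Longrightarrow> f x = f x' \<Longrightarrow> x' < x"
    using prems(2) by (auto simp: rs_compatible_def)
  show ?case
  proof (cases "dropWhile ?p row")
    case Nil
    then have all: "\<And>x. x \<in> set row \<Longrightarrow> f y < f x" using pq by (auto simp: dropWhile_eq_Nil_conv)
    have P': "P' = (row @ [y]) # rows" "r = 0"
      using prems(1) Nil by (auto simp: Let_def simp del: dropWhile_eq_Nil_conv)
    have "rs_compatible f P'"
      using prems(2,3) all unfolding P' by (fastforce simp: rs_compatible_def sorted_wrt_append)
    moreover have "word_ins (f y) (map (map f) (row # rows)) = (map (map f) P', r)"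
      using dw Nil by (simp add: P' Let_def del: dropWhile_eq_Nil_conv)
    ultimately show ?thesis by (auto simp: P')
  next
    case (Cons z zs)
    have R: "row = takeWhile ?p row @ z # zs" using Cons by (metis takeWhile_dropWhile_id)
    have setR: "set row = set (takeWhile ?p row) \<union> {z} \<union> set zs" by (subst R) auto
    have zy: "\<not> y \<le> z" using Cons by (metis dropWhile_eq_Cons_conv)
    have zr: "z \<in> set row" using setR by auto
    have fzy: "f z \<le> f y" using zy prems(4)[of z y] zr by auto
    have s: "sorted_wrt (\<lambda>x x'. f x' < f x) (takeWhile ?p row @ z # zs)" using R g(1) by metis
    have s': "sorted_wrt (\<lambda>x x'. f x' < f x) (takeWhile ?p row @ y # zs)"
    proof -
      have "f y < f x" if "x \<in> set (takeWhile ?p row)" for x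
        using set_takeWhileD[OF that] pq by blast
      moreover have "f x < f y" if "x \<in> set zs" for x
        using s fzy that by (auto simp: sorted_wrt_append)
      ultimately show ?thesis using s by (auto simp: sorted_wrt_append)
    qed
    have ne: "f x \<noteq> f z" if "x \<in> set (takeWhile ?p row) \<union> set zs" for x
      using that s by (auto simp: sorted_wrt_append)
    obtain Q k where Q: "rs_ins z rows = (Q, k)" by fastforce
    have P': "P' = (takeWhile ?p row @ y # zs) # Q" "r = Suc k"
      using prems(1) Cons Q by (auto simp: Let_def simp del: dropWhile_eq_Nil_conv)
    have IH: "rs_compatible f Q \<and> set (concat Q) = insert z (set (concat rows)) \<and>
         word_ins (f z) (map (map f) rows) = (map (map f) Q, k)"
    proof (rule IH0[OF Q g(2)])
      show "x < z" if "x \<in> set (concat rows)" "f x = f z" for x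
        using that g(3)[OF _ zr] by fastforce
      show "f x \<le> f x'"
        if "x \<in> insert z (set (concat rows))" "x' \<in> insert z (set (concat rows))" "x < x'" for x x'
        using that prems(4)[of x x'] zr by auto
    qed
    have "rs_compatible f P'"
    proof -
      have "x' < x" if "x \<in> set (takeWhile ?p row @ y # zs)" "B \<in> set Q" "x' \<in> set B" "f x = f x'" for x x' B
      proof -
        have "x' \<in> insert z (set (concat rows))" using IH that(2,3) by auto
        then consider "x' = z" | "x' \<in> set (concat rows)" by auto
        then show ?thesis
        proof cases
          case 1
          then have "x = y" using that(1,4) ne by auto
          then show ?thesis using 1 zy by simp
        next
          case 2
          then obtain C where C: "C \<in> set rows" "x' \<in> set C" by auto
          show ?thesis
          proof (cases "x = y")
            case True
            then show ?thesis using prems(3)[of x'] 2 that(4) by simp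
          next
            case False
            then have "x \<in> set row" using that(1) setR by auto
            then show ?thesis using g(3) C that(4) by blast
          qed
        qed
      qed
      then show ?thesis using IH s' unfolding P' by (auto simp: rs_compatible_def)
    qed
    moreover have "word_ins (f y) (map (map f) (row # rows)) = (map (map f) P', r)"
      using dw Cons IH tw by (simp add: P' Let_def del: dropWhile_eq_Nil_conv)
    moreover have "set (concat P') = insert y (set (concat (row # rows)))"
      using IH setR by (auto simp: P')
    ultimately show ?thesis by blast
  qed
qed

section \<open>Boxes and entries of the recording tableau\<close>

definition in_diagram :: "'a list list \<Rightarrow> nat \<Rightarrow> nat \<Rightarrow> bool" where
  "in_diagram P i j \<longleftrightarrow> i < length P \<and> j < length (P ! i)"

abbreviation rs_run :: "nat list \<Rightarrow> nat list list" where
  "rs_run \<equiv> foldl (\<lambda>P y. fst (rs_ins y P)) []"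

lemma rs_ins_shape:
  "rs_ins y P = (P', r) \<Longrightarrow> r \<le> length P \<and>
   map length P' = (if r < length P then (map length P)[r := Suc (length (P ! r))] else map length P @ [1])"
proof (induction y P arbitrary: P' r rule: rs_ins.induct)
  case (2 y row rows)
  let ?p = "\<lambda>x. y \<le> x"
  show ?case
  proof (cases "dropWhile ?p row")
    case Nil
    then show ?thesis using "2.prems" by (auto simp: Let_def simp del: dropWhile_eq_Nil_conv)
  next
    case (Cons z zs)
    have R: "row = takeWhile ?p row @ z # zs" using Cons by (metis takeWhile_dropWhile_id)
    then have l: "length (takeWhile ?p row @ y # zs) = length row"
      by (metis length_append length_Cons)
    obtain Q k where Q: "rs_ins z rows = (Q, k)" by fastforce
    have P': "P' = (takeWhile ?p row @ y # zs) # Q" "r = Suc k"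
      using "2.prems"(1) Cons Q by (auto simp: Let_def simp del: dropWhile_eq_Nil_conv)
    show ?thesis
      using "2.IH"[OF refl refl, simplified Cons, simplified, OF Q] l by (auto simp: P')
  qed
qed auto

lemma in_diagram_cong: "map length P = map length Q \<Longrightarrow> in_diagram P i j = in_diagram Q i j"
  by (metis in_diagram_def length_map nth_map)

lemma in_diagram_map: "in_diagram (map (map f) P) i j = in_diagram P i j"
  by (rule in_diagram_def[THEN trans]) (auto simp: in_diagram_def)

lemma in_diagram_rs_ins:
  assumes "rs_ins y P = (P', r)"
  shows "in_diagram P' i j \<longleftrightarrow> in_diagram P i j \<or> (i = r \<and> j = (if r < length P then length (P ! r) else 0))"
proof -
  note s = rs_ins_shape[OF assms]
  have l: "length P' = (if r < length P then length P else Suc (length P))"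
    using s by (metis length_append length_list_update length_map list.size(3,4) One_nat_def add_0 add.commute plus_1_eq_Suc)
  have n: "length (P' ! i) = (if i = r then (if r < length P then Suc (length (P ! r)) else 1) else length (P ! i))"
    if "i < length P'"
  proof -
    have "length (P' ! i) = map length P' ! i" using that by simp
    also have "\<dots> = (if i = r then (if r < length P then Suc (length (P ! r)) else 1) else length (P ! i))"
      using s that l by (auto simp: nth_append nth_list_update split: if_splits)
    finally show ?thesis .
  qed
  show ?thesis using n l s by (auto simp: in_diagram_def split: if_splits)
qed

lemma in_diagram_rs_run_take: "in_diagram (rs_run (take l u)) i j \<Longrightarrow> in_diagram (rs_run u) i j"
proof (induction u rule: rev_induct)
  case (snoc y u)
  obtain P' r where r: "rs_ins y (rs_run u) = (P', r)" by fastforce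
  show ?case
  proof (cases "l \<le> length u")
    case True
    then show ?thesis using snoc in_diagram_rs_ins[OF r] r by simp
  next
    case False
    then show ?thesis using snoc by simp
  qed
qed simp

lemma rs_run_nonempty: "[] \<notin> set (rs_run u)"
proof (induction u rule: rev_induct)
  case (snoc y u)
  obtain P' r where r: "rs_ins y (rs_run u) = (P', r)" by fastforce
  have "[] \<notin> set P'"
  proof
    assume "[] \<in> set P'"
    then have "0 \<in> set (map length P')" by force
    then have "0 \<in> set (map length (rs_run u))"
      using rs_ins_shape[OF r] by (auto dest!: set_update_subset_insert[THEN subsetD] split: if_splits)
    then show False using snoc by auto
  qed
  then show ?case using r by simp
qed simp

text \<open>Recording labels decrease from \<open>m\<close>, so the boxes with entry greater than
  \<open>s\<close> are those created by the first \<open>m - s\<close> letters. These level sets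
  reduce statements on recording tableaux to statements on shapes of insertion tableaux.\<close>

lemma recording_entries:
  assumes "foldl (rs_step m) ([], [], 0) u = (P, Q, k)" "length u \<le> m"
  shows "k = length u \<and> P = rs_run u \<and> map length Q = map length P \<and>
    (\<forall>i j s. in_diagram Q i j \<longrightarrow> (s < Q ! i ! j \<longleftrightarrow> in_diagram (rs_run (take (m - s) u)) i j))"
  using assms
proof (induction u arbitrary: P Q k rule: rev_induct)
  case Nil
  then show ?case by (auto simp: in_diagram_def)
next
  case (snoc y u)
  obtain P0 Q0 k0 where 0: "foldl (rs_step m) ([], [], 0) u = (P0, Q0, k0)" by (metis prod_cases3)
  note IH = snoc.IH[OF 0]
  have IH: "k0 = length u" "P0 = rs_run u" "map length Q0 = map length P0"
    "\<And>i j s. in_diagram Q0 i j \<Longrightarrow> s < Q0 ! i ! j \<longleftrightarrow> in_diagram (rs_run (take (m - s) u)) i j"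
    using snoc.IH[OF 0] snoc.prems(2) by auto
  have "rs_step m (P0, Q0, k0) y = (P, Q, k)" using snoc.prems(1) 0 by simp
  then obtain r where r: "rs_ins y P0 = (P, r)" and Q: "Q = add_at r (m - k0) Q0" and k: "k = Suc k0"
    by (auto simp: rs_step_def split: prod.splits)
  have P: "P = rs_run (u @ [y])" using r IH(2) by simp
  have lQ: "length Q0 = length P0" using IH(3) by (metis length_map)
  have lQi: "length (Q0 ! i) = length (P0 ! i)" if "i < length P0" for i
    using IH(3) that lQ by (metis nth_map)
  note s = rs_ins_shape[OF r]
  have mQ: "map length Q = map length P"
    using s IH(3) lQ lQi by (auto simp: Q add_at_def map_update)
  have "s < Q ! i ! j \<longleftrightarrow> in_diagram (rs_run (take (m - s) (u @ [y]))) i j" if b: "in_diagram Q i j" for i j s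
  proof (cases "in_diagram Q0 i j")
    case True
    then have v: "Q ! i ! j = Q0 ! i ! j"
      by (auto simp: Q add_at_def in_diagram_def nth_append nth_list_update)
    show ?thesis
    proof (cases "m - s \<le> length u")
      case True
      then show ?thesis using IH(4)[OF \<open>in_diagram Q0 i j\<close>] v by simp
    next
      case False
      then have "take (m - s) u = u" "take (m - s) (u @ [y]) = u @ [y]" by auto
      moreover have "in_diagram P i j" using b in_diagram_cong[OF mQ] by blast
      moreover have "in_diagram P0 i j" using True in_diagram_cong[OF IH(3)] by blast
      ultimately show ?thesis using IH(4)[OF True] v IH(2) P by simp
    qed
  next
    case False
    then have nP: "\<not> in_diagram P0 i j" using in_diagram_cong[OF IH(3)] by blast
    then have ij: "i = r" "j = (if r < length P0 then length (P0 ! r) else 0)"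
      using b in_diagram_cong[OF mQ] in_diagram_rs_ins[OF r] by auto
    \<comment> \<open>The counter is read before its increment, so the new entry is positive as long
      as the word has at most \<open>m\<close> letters.\<close>
    have v: "Q ! i ! j = m - length u"
      using ij s lQ lQi by (auto simp: Q add_at_def IH(1) nth_append split: if_splits)
    show ?thesis
    proof (cases "m - s \<le> length u")
      case True
      then have "take (m - s) (u @ [y]) = take (m - s) u" by simp
      moreover have "\<not> in_diagram (rs_run (take (m - s) u)) i j"
        using in_diagram_rs_run_take nP IH(2) by blast
      moreover have "\<not> s < m - length u" using True by simp
      ultimately show ?thesis using v by simp
    next
      case False
      then have "take (m - s) (u @ [y]) = u @ [y]" by simp
      moreover have "in_diagram P i j" using b in_diagram_cong[OF mQ] by blast
      ultimately show ?thesis using v P False by simp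
    qed
  qed
  then show ?case using mQ P k IH(1) by simp
qed

section \<open>Labels of the standardization\<close>

lemma length_std [simp]: "length (std w) = length w"
  by (simp add: std_def)

lemma length_filter_upt: "length (filter P [0..<n]) = card {j. j < n \<and> P j}"
proof -
  have "card (set (filter P [0..<n])) = length (filter P [0..<n])" by (rule distinct_card) simp
  moreover have "set (filter P [0..<n]) = {j. j < n \<and> P j}" by auto
  ultimately show ?thesis by simp
qed

lemma std_nth:
  "p < length w \<Longrightarrow> std w ! p = 1 + card {j. j < length w \<and> w ! j < w ! p} + card {j. j < p \<and> w ! j = w ! p}"
  by (simp add: std_def length_filter_upt)

text \<open>Every position counted for \<open>p\<close> is also counted for \<open>q\<close>, and
  \<open>p\<close> itself is counted only for \<open>q\<close>.\<close>

lemma std_le: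
  assumes "p < q" "q < length w" "w ! p \<le> w ! q"
  shows "std w ! p < std w ! q"
proof -
  define A B C D where defs: "A = {j. j < length w \<and> w ! j < w ! p}" "B = {j. j < p \<and> w ! j = w ! p}"
    "C = {j. j < length w \<and> w ! j < w ! q}" "D = {j. j < q \<and> w ! j = w ! q}"
  have fin: "finite A" "finite B" "finite C" "finite D" by (simp_all add: defs)
  have "A \<union> B \<subseteq> C \<union> D" using assms by (auto simp: defs)
  moreover have "p \<in> C \<union> D" "p \<notin> A \<union> B" using assms by (auto simp: defs)
  ultimately have "card (A \<union> B) < card (C \<union> D)" using fin by (intro psubset_card_mono) auto
  moreover have "A \<inter> B = {}" "C \<inter> D = {}" by (auto simp: defs)
  ultimately have "card A + card B < card C + card D" using fin by (simp add: card_Un_disjoint)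
  moreover have "p < length w" using assms by simp
  ultimately show ?thesis using assms(2) unfolding defs by (simp only: std_nth)
qed

lemma std_gt:
  assumes "p < q" "q < length w" "w ! q < w ! p"
  shows "std w ! q < std w ! p"
proof -
  define A B C where defs: "A = {j. j < length w \<and> w ! j < w ! q}" "B = {j. j < q \<and> w ! j = w ! q}"
    "C = {j. j < length w \<and> w ! j < w ! p}"
  have fin: "finite A" "finite B" "finite C" by (simp_all add: defs)
  have "A \<union> B \<subseteq> C" using assms by (auto simp: defs)
  have "A \<inter> B = {}" by (auto simp: defs)
  have "std w ! q = 1 + card A + card B" using assms(2) by (simp only: std_nth defs)
  moreover have "std w ! p = 1 + card C + card {j. j < p \<and> w ! j = w ! p}"
    using assms(1,2) by (simp only: std_nth[of p w] defs less_trans[of p q "length w"])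
  moreover have "q \<in> C" "q \<notin> A \<union> B" using assms by (auto simp: defs)
  then have "card (A \<union> B) < card C" using fin \<open>A \<union> B \<subseteq> C\<close> by (intro psubset_card_mono) auto
  then have "card A + card B < card C" using fin \<open>A \<inter> B = {}\<close> by (simp add: card_Un_disjoint)
  ultimately show ?thesis by linarith
qed

lemma distinct_std: "distinct (std w)"
  unfolding distinct_conv_nth length_std
proof (intro allI impI)
  have "std w ! p \<noteq> std w ! q" if "p < q" "q < length w" for p q
    using std_le[OF that] std_gt[OF that] by (metis less_irrefl not_le)
  then show "std w ! i \<noteq> std w ! j" if "i < length w" "j < length w" "i \<noteq> j" for i j
    using that less_linear[of i j] by metis
qed

lemma in_diagram_rs_run_std:
  assumes "l \<le> length w"
  shows "in_diagram (rs_run (take l (std w))) i j \<longleftrightarrow> j < rowlen i (take l w)"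
proof -
  \<comment> \<open>Recovers the letter from its label; well defined because labels are
    distinct.\<close>
  define f where "f v = the (map_of (zip (std w) w) v)" for v
  have f: "f (std w ! p) = w ! p" if "p < length w" for p
    using that map_of_zip_nth[of "std w" w p] distinct_std by (simp add: f_def)
  have "rs_compatible f (rs_run (take l (std w))) \<and> set (concat (rs_run (take l (std w)))) = set (take l (std w)) \<and>
        map (map f) (rs_run (take l (std w))) = word_run [] (take l w)"
    using assms
  proof (induction l)
    case 0
    then show ?case by (simp add: rs_compatible_def)
  next
    case (Suc l)
    let ?P = "rs_run (take l (std w))" and ?y = "std w ! l"
    obtain P' r where r: "rs_ins ?y ?P = (P', r)" by fastforce
    have IH: "rs_compatible f ?P" "set (concat ?P) = set (take l (std w))" "map (map f) ?P = word_run [] (take l w)"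
      using Suc by auto
    have y: "f ?y = w ! l" using f Suc.prems by simp
    have ix1: "\<exists>p. p < l \<and> x = std w ! p" if "x \<in> set (concat ?P)" for x
    proof -
      have "x \<in> set (take l (std w))" using that IH(2) by blast
      then obtain p where "p < length (take l (std w))" "take l (std w) ! p = x"
        by (metis in_set_conv_nth)
      then show ?thesis by auto
    qed
    have ix: "\<exists>p. p < Suc l \<and> x = std w ! p" if "x \<in> insert ?y (set (concat ?P))" for x
      using that ix1 less_SucI by blast
    have 1: "x < ?y" if xm: "x \<in> set (concat ?P)" and xe: "f x = f ?y" for x
    proof -
      obtain p where p: "p < l" "x = std w ! p" using ix1[OF xm] by blast
      then show ?thesis using std_le[of p l w] xe f[of p] y Suc.prems by simp
    qed
    have 2: "f x \<le> f x'" if xm: "x \<in> insert ?y (set (concat ?P))" "x' \<in> insert ?y (set (concat ?P))" and xl: "x < x'" for x x'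
    proof -
      obtain p q where pq: "p < Suc l" "x = std w ! p" "q < Suc l" "x' = std w ! q"
        using ix[OF xm(1)] ix[OF xm(2)] by blast
      then have e: "f x = w ! p" "f x' = w ! q" using f Suc.prems by auto
      show ?thesis
      proof (rule ccontr)
        assume "\<not> f x \<le> f x'"
        then have lt: "w ! q < w ! p" using e by simp
        then consider "p < q" | "q < p" by (metis less_irrefl linorder_neqE_nat)
        then show False
          using std_gt[of p q w] std_le[of q p w] lt pq xl Suc.prems by cases auto
      qed
    qed
    from rs_ins_word_ins[OF r IH(1) 1 2]
    have "rs_compatible f P'" "set (concat P') = insert ?y (set (concat ?P))"
      "word_ins (f ?y) (map (map f) ?P) = (map (map f) P', r)" by auto
    then show ?case using r IH y Suc.prems by (simp add: take_Suc_conv_app_nth)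
  qed
  then have "map (map f) (rs_run (take l (std w))) = word_run [] (take l w)" by blast
  then have "in_diagram (rs_run (take l (std w))) i j \<longleftrightarrow> in_diagram (word_run [] (take l w)) i j"
    by (metis in_diagram_map)
  then show ?thesis using in_diagram_word_run[of i "take l w" j] by (simp add: in_diagram_def)
qed

text \<open>The level sets of the recording tableau, with row lengths of prefixes of the word itself
  in place of its standardization.\<close>

lemma Qtab_std:
  shows "[] \<notin> set (Qtab (std w))"
    and "in_diagram (Qtab (std w)) i j \<and> s < Qtab (std w) ! i ! j \<longleftrightarrow> j < rowlen i (take (length w - s) w)"
    and "in_diagram (Qtab (std w)) i j \<Longrightarrow> 0 < Qtab (std w) ! i ! j"
proof -
  obtain P Q k where e: "foldl (rs_step (length w)) ([], [], 0) (std w) = (P, Q, k)" by (metis prod_cases3)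
  then have Q: "Qtab (std w) = Q" by (simp add: Qtab_def)
  have P: "P = rs_run (std w)" and mQ: "map length Q = map length P"
    and v: "\<And>i j s. in_diagram Q i j \<Longrightarrow> s < Q ! i ! j \<longleftrightarrow> in_diagram (rs_run (take (length w - s) (std w))) i j"
    using recording_entries[OF e] by auto
  show "[] \<notin> set (Qtab (std w))"
  proof
    assume "[] \<in> set (Qtab (std w))"
    then have "0 \<in> set (map length P)" unfolding Q mQ[symmetric] by force
    then show False using rs_run_nonempty[of "std w"] P by auto
  qed
  have c: "in_diagram Q i j \<longleftrightarrow> in_diagram P i j" for i j using in_diagram_cong[OF mQ] .
  show "in_diagram (Qtab (std w)) i j \<and> s < Qtab (std w) ! i ! j \<longleftrightarrow> j < rowlen i (take (length w - s) w)"
    unfolding Q in_diagram_rs_run_std[of "length w - s" w, symmetric, OF diff_le_self]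
    using v c P in_diagram_rs_run_take by blast
  show "in_diagram (Qtab (std w)) i j \<Longrightarrow> 0 < Qtab (std w) ! i ! j"
    unfolding Q using v[of i j 0] c P by simp
qed

section \<open>Slides on straight-shape tableaux\<close>

definition row_entry :: "nat list \<Rightarrow> nat \<Rightarrow> nat" where
  "row_entry R c = (if 1 \<le> c \<and> c \<le> length R then R ! (c - 1) else 0)"

definition decr_row :: "nat list \<Rightarrow> bool" where
  "decr_row R \<longleftrightarrow> 0 \<notin> set R \<and> (\<forall>c\<ge>1. row_entry R (Suc c) \<le> row_entry R c)"

text \<open>\<open>R\<close> lies above \<open>S\<close>. As boxes outside a row count as 0, the
  final strict inequality also asserts that the box of \<open>R\<close> in column
  \<open>Suc c\<close> exists.\<close>

definition row_triple :: "nat list \<Rightarrow> nat list \<Rightarrow> bool" where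
  "row_triple R S \<longleftrightarrow> row_entry R 1 < row_entry S 1 \<and>
     (\<forall>c\<ge>1. 0 < row_entry S (Suc c) \<longrightarrow> row_entry S (Suc c) \<le> row_entry R c \<longrightarrow> row_entry S (Suc c) < row_entry R (Suc c))"

text \<open>The working form of a straight-shape SSRCT: a condition on single rows and on pairs of
  rows, which passes to sublists and needs no row indices.\<close>

definition ssrct :: "tab \<Rightarrow> bool" where
  "ssrct T \<longleftrightarrow> (\<forall>R\<in>set T. R \<noteq> [] \<and> decr_row R) \<and> sorted_wrt row_triple T"

text \<open>For varying \<open>s\<close> these numbers encode the multiset of entries of column
  \<open>c\<close>; a slide changes each of them by at most one, whereas the rows are rearranged in
  a complicated way.\<close>

definition col_count :: "tab \<Rightarrow> nat \<Rightarrow> nat \<Rightarrow> nat" where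
  "col_count T s c = (\<Sum>R\<leftarrow>T. of_bool (s < row_entry R c))"

lemma col_count_simps [simp]:
  "col_count [] s c = 0" "col_count (R # T) s c = of_bool (s < row_entry R c) + col_count T s c"
  "col_count (T @ U) s c = col_count T s c + col_count U s c" "col_count (rev T) s c = col_count T s c"
  by (simp_all add: col_count_def rev_map[symmetric])

lemma col_count_cong: "(\<And>R. R \<in> set T \<Longrightarrow> s < row_entry R c \<longleftrightarrow> s' < row_entry R c') \<Longrightarrow> col_count T s c = col_count T s' c'"
  by (induction T) auto

lemma col_count_le: "(\<And>R. R \<in> set T \<Longrightarrow> s < row_entry R c \<Longrightarrow> s' < row_entry R c') \<Longrightarrow> col_count T s c \<le> col_count T s' c'"
  by (induction T) (auto simp: of_bool_def intro: le_SucI)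

lemma col_count_mono_col: "(\<And>R. R \<in> set T \<Longrightarrow> decr_row R) \<Longrightarrow> 1 \<le> c \<Longrightarrow> col_count T s (Suc c) \<le> col_count T s c"
  by (rule col_count_le) (auto simp: decr_row_def intro: less_le_trans)

lemma row_entry_0 [simp]: "row_entry R 0 = 0" and row_entry_Nil [simp]: "row_entry [] c = 0"
  by (simp_all add: row_entry_def)

lemma row_entry_pos: "0 \<notin> set R \<Longrightarrow> 0 < row_entry R c \<longleftrightarrow> 1 \<le> c \<and> c \<le> length R"
  by (auto simp: row_entry_def) (metis gr0I nth_mem Suc_le_lessD Suc_pred)

lemma row_entry_in: "0 < row_entry R c \<Longrightarrow> row_entry R c \<in> set R"
  by (auto simp: row_entry_def split: if_splits)

lemma row_entry_upd: "1 \<le> t \<Longrightarrow> t \<le> length R \<Longrightarrow> row_entry (R[t - 1 := x]) c = (if c = t then x else row_entry R c)"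
  by (auto simp: row_entry_def nth_list_update)

lemma row_entry_butlast: "row_entry (butlast R) c = (if c = length R then 0 else row_entry R c)"
  by (cases R rule: rev_cases) (auto simp: row_entry_def nth_append)

lemma row_entry_Cons: "row_entry (x # R) c = (if c = 1 then x else row_entry R (c - 1))"
  by (cases c) (auto simp: row_entry_def nth_Cons split: nat.split)

text \<open>The operator phi as a bumping process which carries an entry of column \<open>t\<close> upwards.\<close>
fun bump_up :: "nat \<Rightarrow> nat \<Rightarrow> nat list list \<Rightarrow> nat list list \<times> nat" where
  "bump_up t x [] = ([], x)"
| "bump_up t x (R # Rs) =
     (if x < row_entry R t \<and> row_entry R (Suc t) \<le> x
      then apfst ((#) (R[t - 1 := x])) (bump_up t (row_entry R t) Rs)
      else apfst ((#) R) (bump_up t x Rs))"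

lemma row_tripleD: "row_triple R S \<Longrightarrow> 1 \<le> c \<Longrightarrow> 0 < row_entry S (Suc c) \<Longrightarrow> row_entry S (Suc c) \<le> row_entry R c \<Longrightarrow>
  row_entry S (Suc c) < row_entry R (Suc c)"
  by (auto simp: row_triple_def)

text \<open>The rows of \<open>Rs\<close> are listed from bottom to top and \<open>D\<close> consists of the already updated rows
  below them; the premise comparing \<open>x\<close> with columns \<open>t\<close> and \<open>Suc t\<close> of
  these rows is the invariant which yields the triple rule for the updated rows.\<close>
lemma bump_up_ssrct:
  assumes "bump_up t x Rs = (Rs', e)" "1 \<le> t" "0 < x"
    and "sorted_wrt (\<lambda>S R. row_triple R S) Rs" "\<forall>R\<in>set Rs. R \<noteq> [] \<and> decr_row R"
    and "\<forall>S\<in>D. decr_row S \<and> (\<forall>R\<in>set Rs. row_triple R S)"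
    and "\<forall>S\<in>D. x \<le> row_entry S t \<longrightarrow> x < row_entry S (Suc t)"
    and "\<forall>R\<in>set Rs. if t = 1 then row_entry R 1 < x else x \<le> row_entry R (t - 1) \<longrightarrow> x < row_entry R t"
  shows "sorted_wrt (\<lambda>S R. row_triple R S) Rs' \<and> (\<forall>R\<in>set Rs'. R \<noteq> [] \<and> decr_row R) \<and>
     (\<forall>S\<in>D. \<forall>R\<in>set Rs'. row_triple R S) \<and>
     (\<forall>S\<in>D \<union> set Rs'. e \<le> row_entry S t \<longrightarrow> e < row_entry S (Suc t)) \<and> 0 < e"
  using assms
proof (induction Rs arbitrary: x D Rs' e)
  case Nil
  then show ?case by auto
next
  case (Cons R Rs)
  show ?case
  proof (cases "x < row_entry R t \<and> row_entry R (Suc t) \<le> x")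
    case True
    let ?R = "R[t - 1 := x]"
    obtain Q where Q: "bump_up t (row_entry R t) Rs = (Q, e)" "Rs' = ?R # Q"
      using Cons.prems(1) True by (cases "bump_up t (row_entry R t) Rs") auto
    \<comment> \<open>In the first column entries get smaller upwards, so an entry carried upwards
      bumps nothing there.\<close>
    have t1: "t \<noteq> 1" using Cons.prems(8) True by auto
    then have t2: "1 \<le> t - 1" "Suc (t - 1) = t" using \<open>1 \<le> t\<close> by auto
    have gR: "decr_row R" "R \<noteq> []" using Cons.prems(5) by auto
    have tl: "t \<le> length R" using True row_entry_pos[of R t] gR(1) by (auto simp: decr_row_def)
    note ru = row_entry_upd[OF \<open>1 \<le> t\<close> tl, of x] row_entry_upd[OF \<open>1 \<le> t\<close> tl, of x, unfolded One_nat_def]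
    have gR': "decr_row ?R"
      unfolding decr_row_def
    proof (intro conjI allI impI)
      show "0 \<notin> set ?R" using gR(1) \<open>0 < x\<close> by (auto simp: decr_row_def dest!: set_update_subset_insert[THEN subsetD])
      fix c :: nat assume "1 \<le> c"
      then have "row_entry R (Suc c) \<le> row_entry R c" using gR(1) by (simp add: decr_row_def)
      then show "row_entry ?R (Suc c) \<le> row_entry ?R c" using True by (auto simp: ru)
    qed
    have above: "row_triple R' ?R" if "R' \<in> set Rs" for R'
    proof -
      have tr: "row_triple R' R" using Cons.prems(4) that by simp
      have v: "x \<le> row_entry R' (t - 1) \<Longrightarrow> x < row_entry R' t" using Cons.prems(8) that t1 by auto
      show ?thesis unfolding row_triple_def
      proof (intro conjI allI impI)
        show "row_entry R' 1 < row_entry ?R 1" using tr t1 by (auto simp: row_triple_def ru)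
        fix c assume c: "1 \<le> c" "0 < row_entry ?R (Suc c)" "row_entry ?R (Suc c) \<le> row_entry R' c"
        show "row_entry ?R (Suc c) < row_entry R' (Suc c)"
        proof (cases "Suc c = t")
          case True
          then show ?thesis using c v by (auto simp: ru)
        next
          case False
          then show ?thesis using c row_tripleD[OF tr] by (auto simp: ru)
        qed
      qed
    qed
    have below: "row_triple ?R S" if "S \<in> D" for S
    proof -
      have tr: "row_triple R S" and gS: "decr_row S" using Cons.prems(6) that by auto
      show ?thesis unfolding row_triple_def
      proof (intro conjI allI impI)
        show "row_entry ?R 1 < row_entry S 1" using tr t1 by (auto simp: row_triple_def ru)
        fix c assume c: "1 \<le> c" "0 < row_entry S (Suc c)" "row_entry S (Suc c) \<le> row_entry ?R c"
        have "row_entry S (Suc c) \<le> row_entry R c" using c(3) True by (auto simp: ru split: if_splits)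
        then have lt: "row_entry S (Suc c) < row_entry R (Suc c)" using row_tripleD[OF tr c(1,2)] by simp
        show "row_entry S (Suc c) < row_entry ?R (Suc c)"
        proof (cases "Suc c = t")
          case tc: True
          \<comment> \<open>Otherwise the invariant gives \<open>S\<close> an entry greater than
            \<open>x\<close> in column \<open>Suc t\<close>, and the triple rule with the old row
            \<open>R\<close> gives \<open>R\<close> an even greater one there, against the bumping
            condition.\<close>
          have "row_entry S t < x"
          proof (rule ccontr)
            assume "\<not> row_entry S t < x"
            then have 1: "x < row_entry S (Suc t)" using Cons.prems(7) that by auto
            have "row_entry S (Suc t) \<le> row_entry S t" using gS \<open>1 \<le> t\<close> by (simp add: decr_row_def)
            then have "row_entry S (Suc t) \<le> row_entry R t" using lt tc by simp
            then have "row_entry S (Suc t) < row_entry R (Suc t)" using row_tripleD[OF tr \<open>1 \<le> t\<close>] 1 by simp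
            then show False using 1 True by simp
          qed
          then show ?thesis using tc by (simp add: ru)
        next
          case False
          then show ?thesis using lt by (simp add: ru)
        qed
      qed
    qed
    have inv: "row_entry R t < row_entry S (Suc t)" if S: "S \<in> insert ?R D" "row_entry R t \<le> row_entry S t" for S
    proof (cases "S = ?R")
      case True
      then show ?thesis using S(2) \<open>x < row_entry R t \<and> _\<close> by (simp add: ru)
    next
      case False
      then have SD: "S \<in> D" using S by simp
      have xS: "x < row_entry S (Suc t)" using Cons.prems(7) SD S(2) True by auto
      show ?thesis
      proof (rule ccontr)
        assume "\<not> row_entry R t < row_entry S (Suc t)"
        then have "row_entry S (Suc t) < row_entry R (Suc t)"
          using row_tripleD[of R S t] Cons.prems(6) SD \<open>1 \<le> t\<close> xS by auto
        then show False using xS True by simp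
      qed
    qed
    have V: "\<forall>R'\<in>set Rs. if t = 1 then row_entry R' 1 < row_entry R t else row_entry R t \<le> row_entry R' (t - 1) \<longrightarrow> row_entry R t < row_entry R' t"
    proof
      fix R' assume R': "R' \<in> set Rs"
      have tr: "row_triple R' R" using Cons.prems(4) R' by simp
      show "if t = 1 then row_entry R' 1 < row_entry R t else row_entry R t \<le> row_entry R' (t - 1) \<longrightarrow> row_entry R t < row_entry R' t"
        using row_tripleD[OF tr t2(1)] t1 t2(2) True by auto
    qed
    have "sorted_wrt (\<lambda>S R. row_triple R S) Q \<and> (\<forall>R\<in>set Q. R \<noteq> [] \<and> decr_row R) \<and>
     (\<forall>S\<in>insert ?R D. \<forall>R\<in>set Q. row_triple R S) \<and>
     (\<forall>S\<in>insert ?R D \<union> set Q. e \<le> row_entry S t \<longrightarrow> e < row_entry S (Suc t)) \<and> 0 < e"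
    proof (rule Cons.IH[OF Q(1) \<open>1 \<le> t\<close> _ _ _ _ _ V])
      show "0 < row_entry R t" using True by simp
      show "sorted_wrt (\<lambda>S R. row_triple R S) Rs" "\<forall>R\<in>set Rs. R \<noteq> [] \<and> decr_row R" using Cons.prems(4,5) by auto
      show "\<forall>S\<in>insert ?R D. decr_row S \<and> (\<forall>R\<in>set Rs. row_triple R S)" using Cons.prems(6) gR' above by auto
      show "\<forall>S\<in>insert ?R D. row_entry R t \<le> row_entry S t \<longrightarrow> row_entry R t < row_entry S (Suc t)" using inv by blast
    qed
    then show ?thesis using below gR' gR(2) unfolding Q(2) by auto
  next
    case False
    obtain Q where Q: "bump_up t x Rs = (Q, e)" "Rs' = R # Q"
      using Cons.prems(1) False by (cases "bump_up t x Rs") auto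
    \<comment> \<open>The row is unchanged and joins \<open>D\<close>. Equality of \<open>x\<close>
      with its entry in column \<open>t\<close> is excluded by the premise on columns
      \<open>t - 1\<close> and \<open>t\<close>, as rows decrease.\<close>
    have "x < row_entry R (Suc t)" if "x \<le> row_entry R t"
    proof (cases "x = row_entry R t")
      case True
      have "if t = 1 then row_entry R 1 < x else x \<le> row_entry R (t - 1) \<longrightarrow> x < row_entry R t"
        by (rule bspec[OF Cons.prems(8)]) simp
      moreover have "t \<noteq> 1 \<Longrightarrow> row_entry R t \<le> row_entry R (t - 1)"
        using Cons.prems(2,5) by (simp add: decr_row_def) (metis One_nat_def Suc_le_eq Suc_pred diff_is_0_eq le_antisym not_less_eq_eq)
      ultimately show ?thesis using True by (auto split: if_splits)
    next
      case ne: False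
      then show ?thesis using that False by auto
    qed
    then have "sorted_wrt (\<lambda>S R. row_triple R S) Q \<and> (\<forall>R\<in>set Q. R \<noteq> [] \<and> decr_row R) \<and>
     (\<forall>S\<in>insert R D. \<forall>R\<in>set Q. row_triple R S) \<and>
     (\<forall>S\<in>insert R D \<union> set Q. e \<le> row_entry S t \<longrightarrow> e < row_entry S (Suc t)) \<and> 0 < e"
      by (intro Cons.IH[OF Q(1)]) (use Cons.prems in auto)
    then show ?thesis using Cons.prems(5,6) unfolding Q(2) by auto
  qed
qed

lemma mset_row_update: "1 \<le> t \<Longrightarrow> t \<le> length R \<Longrightarrow> add_mset (row_entry R t) (mset (R[t - 1 := x])) = add_mset x (mset R)"
  by (auto simp: mset_update row_entry_def)

lemma bump_up_content:
  assumes "bump_up t x Rs = (Rs', e)" "1 \<le> t" "\<forall>R\<in>set Rs. decr_row R"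
  shows "map length Rs' = map length Rs \<and>
     (\<forall>R'\<in>set Rs'. \<exists>R\<in>set Rs. \<forall>c. c \<noteq> t \<longrightarrow> row_entry R' c = row_entry R c) \<and>
     col_count Rs' s c + of_bool (c = t \<and> s < e) = col_count Rs s c + of_bool (c = t \<and> s < x) \<and>
     add_mset e (mset (concat Rs')) = add_mset x (mset (concat Rs))"
  using assms
proof (induction Rs arbitrary: x Rs' e)
  case Nil
  then show ?case by auto
next
  case (Cons R Rs)
  show ?case
  proof (cases "x < row_entry R t \<and> row_entry R (Suc t) \<le> x")
    case True
    let ?R = "R[t - 1 := x]"
    obtain Q where Q: "bump_up t (row_entry R t) Rs = (Q, e)" "Rs' = ?R # Q"
      using Cons.prems(1) True by (cases "bump_up t (row_entry R t) Rs") auto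
    have tl: "t \<le> length R" using True row_entry_pos[of R t] Cons.prems(3) by (auto simp: decr_row_def)
    note ru = row_entry_upd[OF \<open>1 \<le> t\<close> tl, of x] row_entry_upd[OF \<open>1 \<le> t\<close> tl, of x, unfolded One_nat_def]
    note IH = Cons.IH[OF Q(1) Cons.prems(2)]
    have IH: "map length Q = map length Rs" "\<forall>R'\<in>set Q. \<exists>R\<in>set Rs. \<forall>c. c \<noteq> t \<longrightarrow> row_entry R' c = row_entry R c"
     "col_count Q s c + of_bool (c = t \<and> s < e) = col_count Rs s c + of_bool (c = t \<and> s < row_entry R t)"
     "add_mset e (mset (concat Q)) = add_mset (row_entry R t) (mset (concat Rs))"
      using IH Cons.prems(3) by auto
    have "add_mset e (mset ?R + mset (concat Q)) = mset ?R + add_mset e (mset (concat Q))" by simp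
    also have "\<dots> = add_mset (row_entry R t) (mset ?R) + mset (concat Rs)" unfolding IH(4) by simp
    also have "\<dots> = add_mset x (mset R + mset (concat Rs))"
      unfolding mset_row_update[OF \<open>1 \<le> t\<close> tl] by simp
    finally have "add_mset e (mset (concat Rs')) = add_mset x (mset (concat (R # Rs)))" by (simp add: Q(2))
    moreover have "col_count Rs' s c + of_bool (c = t \<and> s < e) = col_count (R # Rs) s c + of_bool (c = t \<and> s < x)"
      using IH(3) by (auto simp: Q(2) ru of_bool_def split: if_splits)
    moreover have "\<forall>c. c \<noteq> t \<longrightarrow> row_entry ?R c = row_entry R c" by (simp add: ru)
    ultimately show ?thesis using IH(1,2) by (auto simp: Q(2))
  next
    case False
    obtain Q where Q: "bump_up t x Rs = (Q, e)" "Rs' = R # Q"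
      using Cons.prems(1) False by (cases "bump_up t x Rs") auto
    have IH: "map length Q = map length Rs" "\<forall>R'\<in>set Q. \<exists>R\<in>set Rs. \<forall>c. c \<noteq> t \<longrightarrow> row_entry R' c = row_entry R c"
     "col_count Q s c + of_bool (c = t \<and> s < e) = col_count Rs s c + of_bool (c = t \<and> s < x)"
     "add_mset e (mset (concat Q)) = add_mset x (mset (concat Rs))"
      using Cons.IH[OF Q(1) Cons.prems(2)] Cons.prems(3) by auto
    have "add_mset e (mset R + mset (concat Q)) = mset R + add_mset e (mset (concat Q))" by simp
    also have "\<dots> = add_mset x (mset R + mset (concat Rs))" unfolding IH(4) by simp
    finally show ?thesis using IH(1-3) by (auto simp: Q(2))
  qed
qed

section \<open>The operator phi as a map on lists of rows\<close>

lemma ent_Suc: "j < length T \<Longrightarrow> ent T (Suc j) c = row_entry (T ! j) c"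
  by (simp add: ent_def row_entry_def)

definition chain_update :: "tab \<Rightarrow> nat \<Rightarrow> nat list \<Rightarrow> tab" where
  "chain_update T t ch = foldl (\<lambda>U p. upd U (ch ! Suc p) t (ent T (ch ! p) t)) T [0..<length ch - 1]"

lemma chain_update_snoc:
  assumes "ch \<noteq> []"
  shows "chain_update T t (ch @ [r]) = upd (chain_update T t ch) r t (ent T (last ch) t)"
proof -
  obtain n where n: "length ch = Suc n" using assms by (cases ch) auto
  have "foldl (\<lambda>U p. upd U ((ch @ [r]) ! Suc p) t (ent T ((ch @ [r]) ! p) t)) T [0..<n]
      = foldl (\<lambda>U p. upd U (ch ! Suc p) t (ent T (ch ! p) t)) T [0..<n]"
    by (rule foldl_cong) (auto simp: nth_append n)
  then show ?thesis using assms n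
    by (simp add: chain_update_def nth_append last_conv_nth)
qed

text \<open>\<open>phi\<close> collects the chain of rows and updates them afterwards, whereas
  \<open>bump_up\<close> does both in one pass. They agree because each row is visited once, from
  bottom to top, so that the top \<open>j\<close> rows still have their original entries when they
  are inspected.\<close>

lemma chain_bump_up:
  assumes "ch \<noteq> []" "take j (chain_update T t ch) = take j T" "j \<le> length T" "length (chain_update T t ch) = length T"
    and "ch' = foldl (\<lambda>ch r. if ent T (last ch) t < ent T r t \<and> ent T r (t + 1) \<le> ent T (last ch) t
                             then ch @ [r] else ch) ch (rev [1..<Suc j])"
    and "bump_up t (ent T (last ch) t) (rev (take j T)) = (Rs, e)"
  shows "chain_update T t ch' = rev Rs @ drop j (chain_update T t ch) \<and> ent T (last ch') t = e"
  using assms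
proof (induction j arbitrary: ch Rs)
  case 0
  then show ?case by simp
next
  case (Suc j)
  let ?x = "ent T (last ch) t"
  have jl: "j < length T" using Suc.prems(3) by simp
  have tk: "rev (take (Suc j) T) = T ! j # rev (take j T)" using jl by (simp add: take_Suc_conv_app_nth)
  have r: "rev [1..<Suc (Suc j)] = Suc j # rev [1..<Suc j]" by simp
  have t0: "take j (chain_update T t ch) = take j T"
    using Suc.prems(2) by (metis Suc_leD min.absorb1 order_refl take_take)
  have nj: "chain_update T t ch ! j = T ! j" using Suc.prems(2) by (metis lessI nth_take)
  show ?case
  proof (cases "?x < row_entry (T ! j) t \<and> row_entry (T ! j) (Suc t) \<le> ?x")
    case True
    obtain Q where Q: "bump_up t (row_entry (T ! j) t) (rev (take j T)) = (Q, e)" "Rs = (T ! j)[t - 1 := ?x] # Q"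
      using Suc.prems(6) True unfolding tk by (cases "bump_up t (row_entry (T ! j) t) (rev (take j T))") auto
    have u: "chain_update T t (ch @ [Suc j]) = (chain_update T t ch)[j := (T ! j)[t - 1 := ?x]]"
      using nj by (simp add: chain_update_snoc[OF Suc.prems(1)] upd_def)
    have "chain_update T t ch' = rev Q @ drop j (chain_update T t (ch @ [Suc j])) \<and> ent T (last ch') t = e"
    proof (rule Suc.IH)
      show "take j (chain_update T t (ch @ [Suc j])) = take j T" using t0 u by simp
      show "ch' = foldl (\<lambda>ch r. if ent T (last ch) t < ent T r t \<and> ent T r (t + 1) \<le> ent T (last ch) t
                             then ch @ [r] else ch) (ch @ [Suc j]) (rev [1..<Suc j])"
        using True jl unfolding Suc.prems(5) r by (simp add: ent_Suc del: upt_Suc)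
      show "bump_up t (ent T (last (ch @ [Suc j])) t) (rev (take j T)) = (Q, e)"
        using Q(1) jl by (simp add: ent_Suc)
    qed (use jl u Suc.prems in auto)
    moreover have "drop j (chain_update T t (ch @ [Suc j])) = (T ! j)[t - 1 := ?x] # drop (Suc j) (chain_update T t ch)"
      unfolding u using jl Suc.prems(4)
      by (subst Cons_nth_drop_Suc[symmetric]) auto
    ultimately show ?thesis by (simp add: Q(2))
  next
    case False
    obtain Q where Q: "bump_up t ?x (rev (take j T)) = (Q, e)" "Rs = T ! j # Q"
      using Suc.prems(6) False unfolding tk by (cases "bump_up t ?x (rev (take j T))") auto
    have "chain_update T t ch' = rev Q @ drop j (chain_update T t ch) \<and> ent T (last ch') t = e"
    proof (rule Suc.IH)
      show "ch' = foldl (\<lambda>ch r. if ent T (last ch) t < ent T r t \<and> ent T r (t + 1) \<le> ent T (last ch) t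
                             then ch @ [r] else ch) ch (rev [1..<Suc j])"
        using False jl unfolding Suc.prems(5) r by (auto simp: ent_Suc simp del: upt_Suc)
    qed (use jl Q t0 Suc.prems in auto)
    moreover have "drop j (chain_update T t ch) = T ! j # drop (Suc j) (chain_update T t ch)"
      using jl Suc.prems(4) nj by (metis Cons_nth_drop_Suc)
    ultimately show ?thesis by (simp add: Q(2))
  qed
qed

lemma last_row_split:
  assumes "t \<in> length ` set T"
  obtains A R B where "T = A @ R # B" "length R = t" "\<forall>S\<in>set B. length S \<noteq> t"
proof -
  have "\<exists>R\<in>set T. length R = t" using assms by auto
  from split_list_last_prop[OF this] show ?thesis using that by blast
qed

lemma bump_up_length: "length (fst (bump_up t x Rs)) = length Rs"
  by (induction t x Rs rule: bump_up.induct) auto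

lemma phi_bump_up:
  assumes T: "T = A @ R # B" and R: "length R = t" and B: "\<forall>S\<in>set B. length S \<noteq> t" and t: "1 \<le> t"
    and b: "bump_up t (row_entry R t) (rev A) = (Rs, e)"
  shows "phi (Suc t) T = (rev Rs @ (if t = 1 then [] else [butlast R]) @ B, e)"
proof -
  let ?r = "Suc (length A)"
  have r1: "Max (set (filter (\<lambda>r. length (T ! (r - 1)) = t) [1..<length T + 1])) = ?r"
  proof (rule Max_eqI)
    show "?r \<in> set (filter (\<lambda>r. length (T ! (r - 1)) = t) [1..<length T + 1])" using R by (simp add: T del: upt_Suc)
    fix y assume y: "y \<in> set (filter (\<lambda>r. length (T ! (r - 1)) = t) [1..<length T + 1])"
    show "y \<le> ?r"
    proof (rule ccontr)
      assume "\<not> y \<le> ?r"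
      then obtain k where k: "y = Suc (?r + k)" by (metis less_iff_Suc_add not_le)
      then have "k < length B" using y by (simp add: T del: upt_Suc)
      moreover have "length (B ! k) = t" using y k by (simp add: T nth_append del: upt_Suc)
      ultimately show False using B by auto
    qed
  qed simp
  have x: "ent T ?r t = row_entry R t" using ent_Suc[of "length A" T t] by (simp add: T)
  have len: "length Rs = length A"
    using bump_up_length[of t "row_entry R t" "rev A"] b by simp
  have "chain_update T t (chain T t ?r) = rev Rs @ drop (length A) (chain_update T t [?r]) \<and> ent T (last (chain T t ?r)) t = e"
    by (rule chain_bump_up) (use b x in \<open>auto simp: chain_def chain_update_def T simp del: upt_Suc\<close>)
  then have u: "chain_update T t (chain T t ?r) = rev Rs @ R # B" and e: "ent T (last (chain T t ?r)) t = e"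
    by (auto simp: chain_update_def T)
  show ?thesis
    unfolding phi_def Let_def r1 diff_Suc_1 chain_update_def[symmetric] u e
    using len t by (auto simp: list_update_append nth_append)
qed

lemma dop_last:
  assumes "T = A @ R # B" and R: "length R = t" and B: "\<forall>S\<in>set B. length S \<noteq> t"
  shows "dop t (Some (map length T)) = Some (map length A @ (if t = 1 then [] else [t - 1]) @ map length B)"
proof -
  let ?a = "map length T"
  have "Max (set (filter (\<lambda>i. ?a ! i = t) [0..<length ?a])) = length A"
  proof (rule Max_eqI)
    show "length A \<in> set (filter (\<lambda>i. ?a ! i = t) [0..<length ?a])" using R by (simp add: assms(1) nth_append)
    fix y assume y: "y \<in> set (filter (\<lambda>i. ?a ! i = t) [0..<length ?a])"
    show "y \<le> length A"
    proof (rule ccontr)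
      assume l: "\<not> y \<le> length A"
      have yl: "y < Suc (length A + length B)" using y by (simp add: assms(1) del: upt_Suc)
      then have "y - Suc (length A) < length B" using l by simp
      moreover from this have "?a ! y = length (B ! (y - Suc (length A)))" using l
        by (simp add: assms(1) nth_append nth_Cons')
      ultimately show False using B y by force
    qed
  qed simp
  moreover have "t \<in> set ?a" using R by (auto simp: assms(1))
  ultimately show ?thesis using R
    by (auto simp: dop_def Let_def assms(1) list_update_append)
qed

text \<open>The conclusions are those needed for iteration. The condition on \<open>e\<close> in
  columns \<open>t\<close> and \<open>Suc t\<close> becomes the triple rule against the new last
  row, the columns beyond \<open>t\<close> keep it true later on, and the shortened row of length
  \<open>t - 1\<close> makes the next operator applicable.\<close>

lemma phi_step:
  assumes "ssrct T" "1 \<le> t" "t \<in> length ` set T"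
  shows "\<exists>T' e. phi (Suc t) T = (T', e) \<and> ssrct T' \<and>
     dop t (Some (map length T)) = Some (map length T') \<and>
     (\<forall>S\<in>set T'. e \<le> row_entry S t \<longrightarrow> e < row_entry S (Suc t)) \<and>
     (\<forall>S\<in>set T'. \<exists>R\<in>set T. \<forall>c>t. row_entry S c = row_entry R c) \<and>
     (1 < t \<longrightarrow> t - 1 \<in> length ` set T') \<and>
     (\<forall>s c. col_count T' s c + of_bool (c = t \<and> s < e) = col_count T s c) \<and>
     add_mset e (mset (concat T')) = mset (concat T) \<and> 0 < e"
proof -
  obtain A R B where T: "T = A @ R # B" and R: "length R = t" and B: "\<forall>S\<in>set B. length S \<noteq> t"
    using last_row_split[OF assms(3)] .
  obtain Rs e where b: "bump_up t (row_entry R t) (rev A) = (Rs, e)" by fastforce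
  define C where "C = (if t = 1 then [] else [butlast R])"
  have phi: "phi (Suc t) T = (rev Rs @ C @ B, e)"
    unfolding C_def by (rule phi_bump_up[OF T R B assms(2) b])
  have rows: "\<forall>R\<in>set T. R \<noteq> [] \<and> decr_row R" and srt: "sorted_wrt row_triple T" using assms(1) by (auto simp: ssrct_def)
  have gR: "decr_row R" "R \<noteq> []" using rows by (auto simp: T)
  have x0: "0 < row_entry R t" using gR R assms(2) row_entry_pos[of R t] by (simp add: decr_row_def)
  have AR: "row_triple S R" if "S \<in> set A" for S using srt that by (auto simp: T sorted_wrt_append)
  have RB: "row_triple R S" if "S \<in> set B" for S using srt that by (auto simp: T sorted_wrt_append)
  have AB: "row_triple S S'" if "S \<in> set A" "S' \<in> set B" for S S' using srt that by (auto simp: T sorted_wrt_append)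
  have Rt: "row_entry R c = 0" if "t < c" for c using R that by (simp add: row_entry_def)
  \<comment> \<open>A row below \<open>R\<close> does not have length \<open>t\<close>, so a box in
    column \<open>t\<close> entails one in column \<open>Suc t\<close>; as \<open>R\<close> has no
    box there, the triple rule leaves only a large entry.\<close>
  have nB: "row_entry R t < row_entry S (Suc t)" if S: "S \<in> set B" "row_entry R t \<le> row_entry S t \<or> row_entry S (Suc t) \<noteq> 0" for S
  proof (rule ccontr)
    assume n: "\<not> row_entry R t < row_entry S (Suc t)"
    have gS: "decr_row S" using rows S(1) by (simp add: T)
    have "0 < row_entry S t" using S(2) gS assms(2) x0 by (auto simp: decr_row_def)
    then have "t \<le> length S" using gS row_entry_pos[of S t] by (simp add: decr_row_def)
    then have "0 < row_entry S (Suc t)" using B S(1) gS row_entry_pos[of S "Suc t"] by (auto simp: decr_row_def)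
    then have "row_entry S (Suc t) < row_entry R (Suc t)" using row_tripleD[OF RB[OF S(1)] assms(2)] n by simp
    then show False using Rt by simp
  qed
  have bl: "row_entry (butlast R) c = (if c = t then 0 else row_entry R c)" for c using row_entry_butlast[of R c] R by simp
  have gC: "\<forall>S\<in>set C. S \<noteq> [] \<and> decr_row S"
  proof -
    have "decr_row (butlast R)"
      using gR(1) Rt by (auto simp: decr_row_def bl dest: in_set_butlastD)
    moreover have "butlast R \<noteq> []" if "t \<noteq> 1"
      using that R gR(2) by (cases R) auto
    ultimately show ?thesis by (auto simp: C_def)
  qed
  have AC: "row_triple S S'" if S: "S \<in> set A" "S' \<in> set C" for S S'
  proof -
    have S': "S' = butlast R" "t \<noteq> 1" using S(2) by (auto simp: C_def split: if_splits)
    show ?thesis using AR[OF S(1)] S'(2) unfolding row_triple_def S'(1) bl by auto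
  qed
  have CB: "row_triple S' S" if S: "S \<in> set B" "S' \<in> set C" for S S'
  proof -
    have S': "S' = butlast R" "t \<noteq> 1" using S(2) by (auto simp: C_def split: if_splits)
    have tr: "row_triple R S" using RB[OF S(1)] .
    have gS: "decr_row S" using rows S(1) by (simp add: T)
    have "row_entry S (Suc c) < row_entry (butlast R) (Suc c)"
      if c: "1 \<le> c" "0 < row_entry S (Suc c)" "row_entry S (Suc c) \<le> row_entry (butlast R) c" for c
    proof -
      have "c \<noteq> t" using c by (auto simp: bl)
      then have lt: "row_entry S (Suc c) < row_entry R (Suc c)" using row_tripleD[OF tr c(1,2)] c(3) by (simp add: bl)
      \<comment> \<open>Deleting the last box of \<open>R\<close> could only hurt the triple rule in
        column \<open>t\<close>. But then \<open>S\<close> has entries greater than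
        \<open>row_entry R t\<close> in columns \<open>Suc t\<close> and \<open>t\<close>,
        contradicting \<open>lt\<close>.\<close>
      have "Suc c \<noteq> t"
      proof
        assume ct: "Suc c = t"
        have "t \<le> length S" using c(2) ct gS row_entry_pos[of S t] by (simp add: decr_row_def)
        then have "row_entry S (Suc t) \<noteq> 0" using B S(1) gS row_entry_pos[of S "Suc t"] by (auto simp: decr_row_def)
        then have "row_entry R t < row_entry S (Suc t)" using nB S(1) by blast
        also have "\<dots> \<le> row_entry S t" using gS assms(2) by (simp add: decr_row_def)
        finally show False using lt ct by simp
      qed
      then show ?thesis using lt by (simp add: bl)
    qed
    then show ?thesis using tr S'(2) unfolding row_triple_def S'(1) by (auto simp: bl)
  qed
  have "sorted_wrt (\<lambda>S R. row_triple R S) Rs \<and> (\<forall>R\<in>set Rs. R \<noteq> [] \<and> decr_row R) \<and>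
     (\<forall>S\<in>set C \<union> set B. \<forall>R\<in>set Rs. row_triple R S) \<and>
     (\<forall>S\<in>(set C \<union> set B) \<union> set Rs. e \<le> row_entry S t \<longrightarrow> e < row_entry S (Suc t)) \<and> 0 < e"
  proof (rule bump_up_ssrct[OF b assms(2) x0])
    show "sorted_wrt (\<lambda>S R. row_triple R S) (rev A)" using srt by (simp add: T sorted_wrt_append sorted_wrt_rev)
    show "\<forall>R\<in>set (rev A). R \<noteq> [] \<and> decr_row R" using rows by (simp add: T)
    show "\<forall>S\<in>set C \<union> set B. decr_row S \<and> (\<forall>R\<in>set (rev A). row_triple R S)"
      using gC AC AB rows by (auto simp: T)
    show "\<forall>S\<in>set C \<union> set B. row_entry R t \<le> row_entry S t \<longrightarrow> row_entry R t < row_entry S (Suc t)"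
      using nB x0 by (auto simp: C_def bl)
    show "\<forall>S\<in>set (rev A). if t = 1 then row_entry S 1 < row_entry R t else row_entry R t \<le> row_entry S (t - 1) \<longrightarrow> row_entry R t < row_entry S t"
    proof
      fix S assume "S \<in> set (rev A)"
      then have tr: "row_triple S R" using AR by simp
      show "if t = 1 then row_entry S 1 < row_entry R t else row_entry R t \<le> row_entry S (t - 1) \<longrightarrow> row_entry R t < row_entry S t"
        using row_tripleD[OF tr, of "t - 1"] tr x0 assms(2) by (auto simp: row_triple_def)
    qed
  qed
  note bs = this
  have gA: "\<forall>R\<in>set (rev A). decr_row R" using rows by (simp add: T)
  note bc = bump_up_content[OF b assms(2) gA]
  have ssrct': "ssrct (rev Rs @ C @ B)"
    using bs gC CB rows srt
    by (auto simp: ssrct_def T sorted_wrt_append sorted_wrt_rev) (auto simp: C_def split: if_splits)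
  have lenC: "map length C = (if t = 1 then [] else [t - 1])" using R by (simp add: C_def)
  have dop: "dop t (Some (map length T)) = Some (map length (rev Rs @ C @ B))"
    using dop_last[OF T R B] bc lenC by (simp add: rev_map[symmetric])
  have hC: "col_count C s c + of_bool (c = t \<and> s < row_entry R t) = col_count [R] s c" for s c
  proof (cases "t = 1")
    case True
    then show ?thesis using Rt[of c] by (cases "c = t"; cases "c = 0") (auto simp: C_def)
  next
    case False
    then show ?thesis by (auto simp: C_def bl)
  qed
  have h: "col_count (rev Rs @ C @ B) s c + of_bool (c = t \<and> s < e) = col_count T s c" for s c
    using bc[of s c] hC[of c s] hC[of s c] by (simp add: T)
  have mC: "add_mset (row_entry R t) (mset (concat C)) = mset R"
  proof -
    have "R = butlast R @ [row_entry R t]"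
      using gR(2) R assms(2) by (metis append_butlast_last_id last_conv_nth le_refl row_entry_def)
    then have "mset R = add_mset (row_entry R t) (mset (butlast R))" by (metis mset.simps(2) mset_append union_mset_add_mset_right mset.simps(1) add.right_neutral)
    moreover have "t = 1 \<Longrightarrow> butlast R = []" using R by (cases R) auto
    ultimately show ?thesis by (auto simp: C_def)
  qed
  have "add_mset e (mset (concat (rev Rs @ C @ B))) = add_mset e (mset (concat Rs)) + mset (concat C) + mset (concat B)"
    by (simp add: mset_concat rev_map[symmetric] sum_list_rev)
  also have "\<dots> = mset (concat A) + add_mset (row_entry R t) (mset (concat C)) + mset (concat B)"
    using bc by (simp add: mset_concat rev_map[symmetric] sum_list_rev)
  also have "\<dots> = mset (concat T)" unfolding mC by (simp add: T)
  finally have ms: "add_mset e (mset (concat (rev Rs @ C @ B))) = mset (concat T)" .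
  have cols: "\<forall>S\<in>set (rev Rs @ C @ B). \<exists>R\<in>set T. \<forall>c>t. row_entry S c = row_entry R c"
  proof
    fix S assume "S \<in> set (rev Rs @ C @ B)"
    then consider "S \<in> set Rs" | "S \<in> set C" | "S \<in> set B" by auto
    then show "\<exists>R\<in>set T. \<forall>c>t. row_entry S c = row_entry R c"
    proof cases
      case 1
      then obtain R' where "R' \<in> set A" "\<forall>c. c \<noteq> t \<longrightarrow> row_entry S c = row_entry R' c" using conjunct1[OF conjunct2[OF bc[of 0 0]]] by auto
      then show ?thesis by (intro bexI[of _ R']) (auto simp: T)
    next
      case 2
      then have "S = butlast R" by (auto simp: C_def split: if_splits)
      then show ?thesis by (intro bexI[of _ R]) (auto simp: T bl)
    qed (auto simp: T)
  qed
  have l: "1 < t \<longrightarrow> t - 1 \<in> length ` set (rev Rs @ C @ B)" using R by (auto simp: C_def)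
  have I: "\<forall>S\<in>set (rev Rs @ C @ B). e \<le> row_entry S t \<longrightarrow> e < row_entry S (Suc t)" using bs by auto
  show ?thesis
    using phi ssrct' dop I cols l h ms bs by blast
qed

text \<open>Entries leave columns \<open>t\<close>, ..., 1 in this order, so
  \<open>es ! (t - c)\<close> is the one leaving column \<open>c\<close>. \<open>e'\<close> stands
  for the entry that has just left column \<open>Suc t\<close>; the last premise says that with it
  put back, column \<open>t\<close> would still dominate column \<open>Suc t\<close>. This forces
  the exiting entries to increase weakly.\<close>

lemma mu_loop:
  assumes "ssrct U" "0 < t \<Longrightarrow> t \<in> length ` set U"
    and "\<And>s. 0 < t \<Longrightarrow> col_count U s (Suc t) + of_bool (s < e') \<le> col_count U s t"
  shows "\<exists>U' es. foldl (\<lambda>(U, H) s. case phi s U of (U', e) \<Rightarrow> (U', H @ [e])) (U, H) (rev [2..<t + 2]) = (U', H @ es) \<and>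
     length es = t \<and> sorted es \<and> (\<forall>e\<in>set es. e' \<le> e) \<and> ssrct U' \<and>
     foldl (\<lambda>b s. dop s b) (Some (map length U)) (rev [1..<Suc t]) = Some (map length U') \<and>
     (\<forall>s. \<forall>c\<ge>1. col_count U' s c + of_bool (c \<le> t \<and> s < es ! (t - c)) = col_count U s c) \<and>
     (\<forall>S\<in>set U'. \<forall>c. 1 \<le> c \<and> c \<le> t \<longrightarrow> es ! (t - c) \<le> row_entry S c \<longrightarrow> es ! (t - c) < row_entry S (Suc c)) \<and>
     (\<forall>S\<in>set U'. \<exists>R\<in>set U. \<forall>c>t. row_entry S c = row_entry R c) \<and>
     mset (concat U') + mset es = mset (concat U) \<and> 0 \<notin> set es"
  using assms
proof (induction t arbitrary: U H e')
  case 0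
  show ?case by (rule exI[of _ U], rule exI[of _ "[]"]) (use 0 in auto)
next
  case (Suc t)
  let ?t = "Suc t"
  obtain U1 e where p: "phi (Suc ?t) U = (U1, e)" "ssrct U1"
     "dop ?t (Some (map length U)) = Some (map length U1)"
     "\<forall>S\<in>set U1. e \<le> row_entry S ?t \<longrightarrow> e < row_entry S (Suc ?t)"
     "\<forall>S\<in>set U1. \<exists>R\<in>set U. \<forall>c>?t. row_entry S c = row_entry R c"
     "1 < ?t \<longrightarrow> ?t - 1 \<in> length ` set U1"
     "\<And>s c. col_count U1 s c + of_bool (c = ?t \<and> s < e) = col_count U s c"
     "add_mset e (mset (concat U1)) = mset (concat U)" "0 < e"
    using phi_step[OF Suc.prems(1), of ?t] Suc.prems(2) by auto
  have gU: "\<And>R. R \<in> set U \<Longrightarrow> decr_row R" using Suc.prems(1) by (auto simp: ssrct_def)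
  \<comment> \<open>If \<open>e < e'\<close>, count the entries greater than \<open>e\<close>: the
    premise gives column \<open>?t\<close> more of them than the next column, while the exit
    condition of \<open>phi_step\<close> gives it at most as many.\<close>
  have ee: "e' \<le> e"
  proof (rule ccontr)
    assume "\<not> e' \<le> e"
    then have "col_count U e (Suc ?t) + 1 \<le> col_count U e ?t" using Suc.prems(3)[of e] by simp
    moreover have "col_count U1 e ?t \<le> col_count U1 e (Suc ?t)" by (rule col_count_le) (use p(4) in auto)
    ultimately show False using p(7)[of e ?t] p(7)[of e "Suc ?t"] by simp
  qed
  have pre: "col_count U1 s (Suc t) + of_bool (s < e) \<le> col_count U1 s t" if "0 < t" for s
    using p(7)[of s "Suc t"] p(7)[of s t] col_count_mono_col[of U t s] gU that by simp
  obtain U' es where q: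
     "foldl (\<lambda>(U, H) s. case phi s U of (U', e) \<Rightarrow> (U', H @ [e])) (U1, H @ [e]) (rev [2..<t + 2]) = (U', (H @ [e]) @ es)"
     "length es = t" "sorted es" "\<forall>x\<in>set es. e \<le> x" "ssrct U'"
     "foldl (\<lambda>b s. dop s b) (Some (map length U1)) (rev [1..<Suc t]) = Some (map length U')"
     "\<And>s c. 1 \<le> c \<Longrightarrow> col_count U' s c + of_bool (c \<le> t \<and> s < es ! (t - c)) = col_count U1 s c"
     "\<And>S c. S\<in>set U' \<Longrightarrow> 1 \<le> c \<Longrightarrow> c \<le> t \<Longrightarrow> es ! (t - c) \<le> row_entry S c \<Longrightarrow> es ! (t - c) < row_entry S (Suc c)"
     "\<forall>S\<in>set U'. \<exists>R\<in>set U1. \<forall>c>t. row_entry S c = row_entry R c"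
     "mset (concat U') + mset es = mset (concat U1)" "0 \<notin> set es"
    using Suc.IH[OF p(2) _ pre, of "H @ [e]"] p(6) by auto
  have r: "rev [2..<?t + 2] = Suc ?t # rev [2..<t + 2]" "rev [1..<Suc ?t] = ?t # rev [1..<?t]" by simp_all
  have cols: "\<exists>R\<in>set U1. \<forall>c>t. row_entry S c = row_entry R c" if "S \<in> set U'" for S using q(9) that by blast
  have trip: "(e # es) ! (?t - c) < row_entry S (Suc c)"
    if S: "S \<in> set U'" "1 \<le> c" "c \<le> ?t" "(e # es) ! (?t - c) \<le> row_entry S c" for S c
  proof (cases "c = ?t")
    case True
    obtain R where "R \<in> set U1" "\<forall>c>t. row_entry S c = row_entry R c" using cols[OF S(1)] by blast
    then show ?thesis using p(4) S(4) True by auto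
  next
    case False
    then have "?t - c = Suc (t - c)" using S(3) by simp
    then show ?thesis using q(8)[of S c] S False by simp
  qed
  have cnt: "col_count U' s c + of_bool (c \<le> ?t \<and> s < (e # es) ! (?t - c)) = col_count U s c" if c: "1 \<le> c" for s c
  proof (cases "c \<le> t")
    case True
    then have "?t - c = Suc (t - c)" by simp
    then show ?thesis using q(7)[OF c, of s] p(7)[of s c] True by simp
  next
    case False
    then show ?thesis using q(7)[OF c, of s] p(7)[of s c] by (cases "c = ?t") auto
  qed
  have "mset (concat U') + mset (e # es) = add_mset e (mset (concat U') + mset es)" by simp
  also have "\<dots> = mset (concat U)" unfolding q(10) p(8) ..
  finally have ms: "mset (concat U') + mset (e # es) = mset (concat U)" .
  have cols': "\<exists>R\<in>set U. \<forall>c>?t. row_entry S c = row_entry R c" if "S \<in> set U'" for S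
    using cols[OF that] p(5) by (metis Suc_lessD)
  show ?case
  proof (rule exI[of _ U'], rule exI[of _ "e # es"], intro conjI)
    show "foldl (\<lambda>(U, H) s. case phi s U of (U', e) \<Rightarrow> (U', H @ [e])) (U, H) (rev [2..<?t + 2]) = (U', H @ e # es)"
      using q(1) p(1) unfolding r by simp
    show "foldl (\<lambda>b s. dop s b) (Some (map length U)) (rev [1..<Suc ?t]) = Some (map length U')"
      using q(6) p(3) unfolding r by simp
    show "\<forall>e\<in>set (e # es). e' \<le> e" using ee q(4) by auto
  qed (use q(2,3,4,5,11) p(9) trip cnt ms cols' in auto)
qed

section \<open>The slide mu\<close>

lemma in_maxent: "x \<in> set (concat T) \<Longrightarrow> x \<le> maxent T"
proof -
  have "x \<in> set xs \<Longrightarrow> x \<le> foldr max xs 0" for xs by (induction xs) auto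
  then show "x \<in> set (concat T) \<Longrightarrow> x \<le> maxent T" by (simp add: maxent_def)
qed

lemma row_entry_le_maxent: "R \<in> set T \<Longrightarrow> row_entry R c \<le> maxent T"
  using row_entry_in[of R c] in_maxent[of "row_entry R c" T] by (cases "row_entry R c = 0") auto

lemma part_in_set:
  assumes "Defs.part lam r = Suc c"
  shows "Suc c \<in> set lam"
proof -
  have "1 \<le> r" "r \<le> length lam" "lam ! (r - 1) = Suc c"
    using assms by (simp_all add: Defs.part_def split: if_split_asm)
  moreover from this have "r - 1 < length lam" by simp
  ultimately show ?thesis by (metis nth_mem)
qed

text \<open>An addable node in column \<open>i > 1\<close> supplies a part \<open>i - 1\<close>, as
  the operator applied at the start requires; the operators after it find the rows shortened by
  their predecessors.\<close>

lemma mu_step: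
  assumes T: "ssrct T" and "addable_in_col (sorted_partition T) i"
  shows "\<exists>U ds. mu i T = U @ [(maxent T + 1) # ds] \<and> length ds = i - 1 \<and> ssrct (mu i T) \<and>
     uop i (Some (map length T)) = Some (map length (mu i T)) \<and>
     (\<forall>s. \<forall>c\<ge>1. col_count U s c + of_bool (s < row_entry ds c) = col_count T s c) \<and>
     mset (concat (mu i T)) = add_mset (maxent T + 1) (mset (concat T))"
proof -
  obtain t where t: "i = Suc t" using assms(2) by (cases i) (auto simp: addable_in_col_def)
  have tin: "t \<in> length ` set T" if "0 < t"
  proof -
    obtain r where "Defs.part (sorted_partition T) r = t" using assms(2) t by (auto simp: addable_in_col_def)
    then have "t \<in> set (sorted_partition T)" using part_in_set that by (cases t) auto
    then show ?thesis by (simp add: sorted_partition_def shape_def)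
  qed
  have gT: "\<And>R. R \<in> set T \<Longrightarrow> decr_row R" using T by (auto simp: ssrct_def)
  have pre: "col_count T s (Suc t) + of_bool (s < 0) \<le> col_count T s t" if "0 < t" for s
    using col_count_mono_col[of T t s] gT that by simp
  obtain U es where q:
     "foldl (\<lambda>(U, H) s. case phi s U of (U', e) \<Rightarrow> (U', H @ [e])) (T, []) (rev [2..<t + 2]) = (U, [] @ es)"
     "length es = t" "sorted es" "ssrct U"
     "foldl (\<lambda>b s. dop s b) (Some (map length T)) (rev [1..<Suc t]) = Some (map length U)"
     "\<And>s c. 1 \<le> c \<Longrightarrow> col_count U s c + of_bool (c \<le> t \<and> s < es ! (t - c)) = col_count T s c"
     "\<And>S c. S\<in>set U \<Longrightarrow> 1 \<le> c \<Longrightarrow> c \<le> t \<Longrightarrow> es ! (t - c) \<le> row_entry S c \<Longrightarrow> es ! (t - c) < row_entry S (Suc c)"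
     "mset (concat U) + mset es = mset (concat T)" "0 \<notin> set es"
    using mu_loop[OF T tin pre, of "[]"] by auto
  let ?N = "(maxent T + 1) # rev es"
  have se: "sort es = es" using q(3) by (simp add: sorted_sort_id)
  have mu: "mu i T = U @ [?N]" using q(1) se by (simp add: mu_def t)
  have rd: "row_entry (rev es) c = (if 1 \<le> c \<and> c \<le> t then es ! (t - c) else 0)" for c
    using q(2) by (auto simp: row_entry_def rev_nth)
  have sub: "set es \<subseteq> set (concat T)" "set (concat U) \<subseteq> set (concat T)"
    using q(8) by (metis set_mset_mono mset_subset_eq_add_right mset_subset_eq_add_left set_mset_mset)+
  have mx: "x \<le> maxent T" if "x \<in> set es \<or> x \<in> set (concat U)" for x
    using in_maxent sub that by blast
  have gN: "decr_row ?N"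
    unfolding decr_row_def
  proof (intro conjI allI impI)
    show "0 \<notin> set ?N" using q(9) by simp
    fix c :: nat assume c: "1 \<le> c"
    show "row_entry ?N (Suc c) \<le> row_entry ?N c"
    proof (cases "c = 1")
      case True
      have "row_entry (rev es) 1 \<le> maxent T"
        using row_entry_in[of "rev es" 1] mx[of "row_entry (rev es) 1"] by (cases "row_entry (rev es) 1 = 0") auto
      then show ?thesis using True by (simp add: row_entry_Cons)
    next
      case False
      have "row_entry (rev es) c \<le> row_entry (rev es) (c - 1)"
        using sorted_nth_mono[OF q(3), of "t - c" "t - (c - 1)"] q(2) False c by (auto simp: rd)
      then show ?thesis using False c by (simp add: row_entry_Cons)
    qed
  qed
  \<comment> \<open>Because of the new maximum in front, column \<open>Suc c\<close> of the new row
    holds the entry that left column \<open>c\<close>, so the exit condition of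
    \<open>mu_loop\<close> is the triple rule.\<close>
  have tr: "row_triple S ?N" if S: "S \<in> set U" for S
    unfolding row_triple_def
  proof (intro conjI allI impI)
    have "row_entry S 1 \<le> maxent T"
      using row_entry_in[of S 1] mx[of "row_entry S 1"] S by (cases "row_entry S 1 = 0") auto
    then show "row_entry S 1 < row_entry ?N 1" by (simp add: row_entry_Cons)
    fix c assume c: "1 \<le> c" "0 < row_entry ?N (Suc c)" "row_entry ?N (Suc c) \<le> row_entry S c"
    then have "c \<le> t" by (auto simp: row_entry_Cons rd split: if_splits)
    then show "row_entry ?N (Suc c) < row_entry S (Suc c)" using c q(7)[OF S c(1)] by (simp add: row_entry_Cons rd)
  qed
  have ssrct': "ssrct (mu i T)" using q(4) gN tr by (auto simp: mu ssrct_def sorted_wrt_append)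
  have uop: "uop i (Some (map length T)) = Some (map length (mu i T))"
    using q(2,5) by (simp add: uop_def vop_def aop_def t mu[unfolded t] del: upt_Suc)
  have ms: "mset (concat (mu i T)) = add_mset (maxent T + 1) (mset (concat T))"
    using q(8) by (simp add: mu)
  have "col_count U s c + of_bool (s < row_entry (rev es) c) = col_count T s c" if "1 \<le> c" for s c
    using q(6)[OF that, of s] that by (auto simp: rd of_bool_def split: if_splits)
  then show ?thesis using mu ssrct' uop ms q(2) t by (intro exI[of _ U] exI[of _ "rev es"]) auto
qed

text \<open>The column of the box by which the entries greater than \<open>s\<close> grow when the last row of
  \<open>T\<close> is added by a slide.\<close>
definition slide_col :: "tab \<Rightarrow> nat \<Rightarrow> nat" where
  "slide_col T s = length (filter (\<lambda>e. s < e) (last T))"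

lemma decr_row_gt_iff:
  assumes "decr_row R"
  shows "s < row_entry R c \<longleftrightarrow> 1 \<le> c \<and> c \<le> length (filter (\<lambda>e. s < e) R)"
  using assms
proof (induction R arbitrary: c)
  case (Cons x R)
  have R: "row_entry R c = row_entry (x # R) (Suc c)" if "1 \<le> c" for c using that by (simp add: row_entry_Cons)
  have "decr_row R" using Cons.prems by (auto simp: decr_row_def R)
  note IH = Cons.IH[OF this]
  have le: "row_entry R 1 \<le> x" using Cons.prems unfolding decr_row_def by (metis R le_refl row_entry_Cons)
  show ?case
  proof (cases "s < x")
    case True
    then show ?thesis using IH[of "c - 1"] by (cases c) (auto simp: row_entry_Cons)
  next
    case False
    then have "filter (\<lambda>e. s < e) R = []" using IH[of 1] le by (cases "filter (\<lambda>e. s < e) R") auto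
    then show ?thesis using False IH[of "c - 1"] by (auto simp: row_entry_Cons)
  qed
qed simp

text \<open>If \<open>q\<close> exiting entries exceed \<open>s\<close>, they are removed from
  columns 1 to \<open>q\<close>, and with the new maximum they occupy columns 1 to
  \<open>q + 1\<close> of the last row. The net gain is one box in column
  \<open>q + 1\<close>.\<close>

lemma slide_counts:
  assumes T: "ssrct T" and a: "addable_in_col (sorted_partition T) i" and s: "s \<le> maxent T"
    and c: "1 \<le> c"
  shows "col_count (mu i T) s c = col_count T s c + of_bool (c = slide_col (mu i T) s)"
proof -
  obtain U ds where m: "mu i T = U @ [(maxent T + 1) # ds]" "ssrct (mu i T)"
     "col_count U s c + of_bool (s < row_entry ds c) = col_count T s c"
    using mu_step[OF T a] c by blast
  let ?N = "(maxent T + 1) # ds"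
  have gN: "decr_row ?N" using m(1,2) by (auto simp: ssrct_def)
  have j: "slide_col (mu i T) s = Suc (length (filter (\<lambda>e. s < e) ds))" using s by (simp add: slide_col_def m(1))
  have gd: "decr_row ds"
  proof -
    have R: "row_entry ds c = row_entry ?N (Suc c)" if "1 \<le> c" for c using that by (simp add: row_entry_Cons)
    show ?thesis using gN by (auto simp: decr_row_def R)
  qed
  define q where "q = length (filter (\<lambda>e. s < e) ds)"
  have "s < row_entry ds c \<longleftrightarrow> c \<le> q" using decr_row_gt_iff[OF gd, of s c] c by (simp add: q_def)
  moreover have "s < row_entry ?N c \<longleftrightarrow> c \<le> Suc q" using decr_row_gt_iff[OF gN, of s c] s c by (simp add: q_def)
  ultimately show ?thesis
    using m(3) unfolding j q_def[symmetric] by (cases "c \<le> q"; cases "c = Suc q") (auto simp: m(1))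
qed

lemma slide_col_0:
  assumes "ssrct T" "addable_in_col (sorted_partition T) i"
  shows "slide_col (mu i T) 0 = i"
proof -
  obtain U ds where m: "mu i T = U @ [(maxent T + 1) # ds]" "ssrct (mu i T)" "length ds = i - 1"
    using mu_step[OF assms] by blast
  have "0 \<notin> set ((maxent T + 1) # ds)" using m(1,2) by (auto simp: ssrct_def decr_row_def)
  then have "filter (\<lambda>e. 0 < e) (last (mu i T)) = last (mu i T)" by (auto simp: m(1) filter_id_conv intro!: gr0I)
  then show ?thesis using m(1,3) assms(2) by (auto simp: slide_col_def addable_in_col_def)
qed

lemma slide_col_pos:
  assumes "ssrct T" "addable_in_col (sorted_partition T) i" "s \<le> maxent T"
  shows "1 \<le> slide_col (mu i T) s"
proof -
  obtain U ds where "mu i T = U @ [(maxent T + 1) # ds]" using mu_step[OF assms(1,2)] by blast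
  then show ?thesis using assms(3) by (simp add: slide_col_def)
qed

text \<open>The two letters differ only if \<open>Suc s\<close> lies in the new row, necessarily in
  column \<open>Suc b\<close>. By the triple rule every other row with an entry greater than
  \<open>s\<close> in column \<open>b\<close> then has one greater than \<open>Suc s\<close> in
  column \<open>Suc b\<close>, so both columns have equally many entries above either
  threshold.\<close>

lemma slide_col_Suc:
  assumes T: "ssrct T" and a: "addable_in_col (sorted_partition T) i" and s: "Suc s \<le> maxent T"
    and d: "distinct (concat (mu i T))"
  defines "b \<equiv> slide_col (mu i T) (Suc s)"
  shows "slide_col (mu i T) s = b \<or> slide_col (mu i T) s = Suc b \<and> col_count T (Suc s) b = col_count T (Suc s) (Suc b) \<and>
      col_count (mu i T) s b = col_count (mu i T) s (Suc b)"
proof -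
  obtain U ds where m: "mu i T = U @ [(maxent T + 1) # ds]" "ssrct (mu i T)"
     "\<And>s c. 1 \<le> c \<Longrightarrow> col_count U s c + of_bool (s < row_entry ds c) = col_count T s c"
    using mu_step[OF T a] by blast
  let ?N = "(maxent T + 1) # ds"
  have gN: "decr_row ?N" and tr: "\<And>S. S \<in> set U \<Longrightarrow> row_triple S ?N" and gU: "\<And>S. S \<in> set U \<Longrightarrow> decr_row S"
    using m(1,2) by (auto simp: ssrct_def sorted_wrt_append)
  have dN: "distinct ?N" using d by (simp add: m(1))
  have jc: "slide_col (mu i T) r = length (filter (\<lambda>e. r < e) ?N)" for r by (simp add: slide_col_def m(1))
  have b1: "1 \<le> b" using s by (simp add: b_def jc)
  have fl: "length (filter (\<lambda>e. s < e) ?N) = length (filter (\<lambda>e. Suc s < e) ?N) + count_list ?N (Suc s)"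
  proof -
    have "length (filter (\<lambda>e. s < e) xs) = length (filter (\<lambda>e. Suc s < e) xs) + count_list xs (Suc s)" for xs
      by (induction xs) auto
    then show ?thesis .
  qed
  define k where "k = count_list ?N (Suc s)"
  have jk: "slide_col (mu i T) s = b + k" unfolding b_def jc k_def by (rule fl)
  show "slide_col (mu i T) s = b \<or> slide_col (mu i T) s = Suc b \<and> col_count T (Suc s) b = col_count T (Suc s) (Suc b) \<and>
      col_count (mu i T) s b = col_count (mu i T) s (Suc b)"
  proof (cases "Suc s \<in> set ?N")
    case False
    then have "k = 0" unfolding k_def by (rule iffD2[OF count_list_0_iff])
    then show ?thesis using jk by simp
  next
    case True
    have c1: "count_list xs x = 1" if "distinct xs" "x \<in> set xs" for xs and x :: nat
      using that by (induction xs) (auto simp: count_list_0_iff)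
    have "k = 1" unfolding k_def by (rule c1[OF dN True])
    then have js: "slide_col (mu i T) s = Suc b" using jk by simp
    have 1: "s < row_entry ?N c \<longleftrightarrow> 1 \<le> c \<and> c \<le> Suc b" for c using decr_row_gt_iff[OF gN, of s c] js by (simp add: jc)
    have 2: "Suc s < row_entry ?N c \<longleftrightarrow> 1 \<le> c \<and> c \<le> b" for c using decr_row_gt_iff[OF gN, of "Suc s" c] by (simp add: b_def jc)
    have e: "row_entry ?N (Suc b) = Suc s" using 1[of "Suc b"] 2[of "Suc b"] by linarith
    have S: "s < row_entry S b \<Longrightarrow> Suc s < row_entry S (Suc b)" if "S \<in> set U" for S
      using row_tripleD[OF tr[OF that] b1] e by simp
    have S2: "row_entry S (Suc b) \<le> row_entry S b" if "S \<in> set U" for S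
      using gU[OF that] b1 by (simp add: decr_row_def)
    have S3: "s < row_entry S b \<longleftrightarrow> s < row_entry S (Suc b)" "Suc s < row_entry S b \<longleftrightarrow> Suc s < row_entry S (Suc b)"
      if "S \<in> set U" for S
      using S[OF that] S2[OF that] by linarith+
    have hs: "col_count (mu i T) s b = col_count (mu i T) s (Suc b)"
    proof (rule col_count_cong)
      fix R assume "R \<in> set (mu i T)"
      then have "R \<in> set U \<or> R = ?N" unfolding m(1) by auto
      moreover have "s < row_entry ?N b \<longleftrightarrow> s < row_entry ?N (Suc b)"
        unfolding 1 using b1 by simp
      ultimately show "s < row_entry R b \<longleftrightarrow> s < row_entry R (Suc b)"
        using S3(1) by metis
    qed
    have "col_count U (Suc s) b = col_count U (Suc s) (Suc b)"
      by (rule col_count_cong) (rule S3(2))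
    then have hT: "col_count T (Suc s) b = col_count T (Suc s) (Suc b)"
    proof -
      \<comment> \<open>\<open>ds\<close> is \<open>?N\<close> without its first entry, so its
        entries greater than \<open>Suc s\<close> end before column \<open>b\<close>.\<close>
      have "row_entry ds b = row_entry ?N (Suc b)" "row_entry ds (Suc b) = row_entry ?N (Suc (Suc b))"
        using b1 by (simp_all add: row_entry_Cons)
      then have "\<not> Suc s < row_entry ds b" "\<not> Suc s < row_entry ds (Suc b)" using 2 by auto
      then show ?thesis
        using m(3)[OF b1, of "Suc s"] m(3)[of "Suc b" "Suc s"] \<open>col_count U (Suc s) b = _\<close> by simp
    qed
    show ?thesis using js hs hT by simp
  qed
qed

section \<open>Slides and row insertion\<close>

text \<open>The combinatorial core without tableaux: \<open>x s k c\<close> is the number of entries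
  greater than \<open>s\<close> in column \<open>c\<close> after \<open>k\<close> slides, and
  \<open>J s k\<close> is the column gaining a box at slide \<open>k\<close>, with slides counted
  from 0. The two equalities in \<open>low\<close> refer to level \<open>Suc s\<close> before the
  slide and to level \<open>s\<close> after it.\<close>

lemma word_chain:
  fixes x :: "nat \<Rightarrow> nat \<Rightarrow> nat \<Rightarrow> nat" and J :: "nat \<Rightarrow> nat \<Rightarrow> nat"
  assumes mono: "\<And>s k c. s \<le> n \<Longrightarrow> k \<le> m \<Longrightarrow> 1 \<le> c \<Longrightarrow> x s k (Suc c) \<le> x s k c"
    and step: "\<And>s k c. s \<le> n \<Longrightarrow> k < m \<Longrightarrow> 1 \<le> c \<Longrightarrow> x s (Suc k) c = x s k c + of_bool (c = J s k)"
    and pos: "\<And>s k. s \<le> n \<Longrightarrow> k < m \<Longrightarrow> 1 \<le> J s k"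
    and low: "\<And>s k. s < n \<Longrightarrow> k < m \<Longrightarrow> J s k = J (Suc s) k \<or>
      J s k = Suc (J (Suc s) k) \<and> x (Suc s) k (J (Suc s) k) = x (Suc s) k (Suc (J (Suc s) k)) \<and>
      x s (Suc k) (J (Suc s) k) = x s (Suc k) (Suc (J (Suc s) k))"
    and zero: "\<And>c. 1 \<le> c \<Longrightarrow> x n 0 c = 0"
  shows "j < rowlen i (rev (map (J 0) [0..<m])) \<longleftrightarrow> i < x n m (Suc j)"
proof -
  have cnt: "count_list (map (J s) [l..<k]) c + x s l c = x s k c"
    if "l \<le> k" "k \<le> m" "s \<le> n" "1 \<le> c" for s l k c
    using that(1,2)
  proof (induction k rule: dec_induct)
    case (step k)
    then have "[l..<Suc k] = [l..<k] @ [k]" by simp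
    then show ?case using step.IH step.prems assms(2)[of s k c] that(3,4) by auto
  qed simp
  \<comment> \<open>Hybrid words: raising \<open>k\<close> by one changes the letter of a single
    slide from level \<open>s\<close> to level \<open>Suc s\<close>.\<close>
  have hyb: "rowlen i (rev (map (J (Suc s)) [0..<k] @ map (J s) [k..<m])) = rowlen i (rev (map (J s) [0..<m]))"
    if "s < n" "k \<le> m" for s k
    using that(2)
  proof (induction k)
    case (Suc k)
    let ?w1 = "rev (map (J s) [Suc k..<m])" and ?w2 = "rev (map (J (Suc s)) [0..<k])" and ?b = "J (Suc s) k"
    have k: "k < m" using Suc by simp
    have e: "rev (map (J (Suc s)) [0..<k] @ map (J s) [k..<m]) = ?w1 @ J s k # ?w2"
      "rev (map (J (Suc s)) [0..<Suc k] @ map (J s) [Suc k..<m]) = ?w1 @ ?b # ?w2"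
      using k by (simp_all add: upt_conv_Cons)
    have b1: "1 \<le> ?b" using pos[of "Suc s" k] that(1) k by simp
    have "rowlen i (?w1 @ J s k # ?w2) = rowlen i (?w1 @ ?b # ?w2)"
    proof (cases "J s k = ?b")
      case False
      then have l: "J s k = Suc ?b" "x (Suc s) k ?b = x (Suc s) k (Suc ?b)" "x s (Suc k) ?b = x s (Suc k) (Suc ?b)"
        using low[OF that(1) k] by auto
      \<comment> \<open>A suffix of \<open>?w1\<close> consists of the slides from
        \<open>Suc k\<close> up to some time \<open>h\<close>. Columns \<open>?b\<close> and
        \<open>Suc ?b\<close> agree at its start, and at time \<open>h\<close> the latter is not
        longer, so it has gained no more boxes.\<close>
      have "unmatched ?b 0 ?w1 = 0"
      proof (rule unmatched_zeroI)
        fix p q assume "?w1 = p @ q"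
        then have "map (J s) [Suc k..<m] = rev q @ rev p" by (simp add: rev_swap)
        moreover define h where "h = Suc k + length q"
        ultimately have q: "rev q = map (J s) [Suc k..<h]" "h \<le> m"
        proof -
          assume a: "map (J s) [Suc k..<m] = rev q @ rev p"
          have le: "length q \<le> m - Suc k" using arg_cong[OF a, of length] by simp
          have "rev q = take (length q) (map (J s) [Suc k..<m])" unfolding a by simp
          also have "\<dots> = map (J s) [Suc k..<h]" using le k by (simp add: take_map h_def take_upt)
          finally show "rev q = map (J s) [Suc k..<h]" .
          show "h \<le> m" using le k by (simp add: h_def)
        qed
        have c: "count_list q c + x s (Suc k) c = x s h c" if "1 \<le> c" for c
        proof -
          have "count_list (rev q) c + x s (Suc k) c = x s h c"
            unfolding q(1) using \<open>s < n\<close> by (intro cnt q(2) that) (simp_all add: h_def)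
          then show ?thesis by simp
        qed
        show "count_list q (Suc ?b) \<le> count_list q ?b"
          using c[OF b1] c[of "Suc ?b"] l(3) mono[of s h ?b] q(2) that(1) b1 by simp
      qed
      \<comment> \<open>Here the columns agree at the end: column \<open>?b\<close> was not shorter
        at time \<open>h\<close>, so between \<open>h\<close> and \<open>k\<close> it gains no more
        boxes than column \<open>Suc ?b\<close>.\<close>
      moreover have "prefix_matched ?b 0 ?w2"
      proof (rule prefix_matchedI)
        fix p q assume "?w2 = p @ q"
        then have a: "map (J (Suc s)) [0..<k] = rev q @ rev p" by (simp add: rev_swap)
        define h where "h = length q"
        have le: "h \<le> k" using arg_cong[OF a, of length] by (simp add: h_def)
        have "rev p = drop (length q) (map (J (Suc s)) [0..<k])" unfolding a by simp
        also have "\<dots> = map (J (Suc s)) [h..<k]" by (simp add: drop_map h_def)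
        finally have q: "rev p = map (J (Suc s)) [h..<k]" .
        have c: "count_list p c + x (Suc s) h c = x (Suc s) k c" if "1 \<le> c" for c
        proof -
          have "count_list (rev p) c + x (Suc s) h c = x (Suc s) k c"
            unfolding q using \<open>s < n\<close> k by (intro cnt le that) simp_all
          then show ?thesis by simp
        qed
        show "count_list p ?b \<le> 0 + count_list p (Suc ?b)"
          using c[OF b1] c[of "Suc ?b"] l(2) mono[of "Suc s" h ?b] le k that(1) b1 by simp
      qed
      ultimately have "lowers ?b (?w1 @ Suc ?b # ?w2) (?w1 @ ?b # ?w2)" by (rule lowers_appendI)
      then show ?thesis unfolding l(1) by (rule rowlen_lowers)
    qed simp
    then show ?case using Suc k unfolding e by simp
  qed simp
  have all: "rowlen i (rev (map (J s) [0..<m])) = rowlen i (rev (map (J 0) [0..<m]))" if "s \<le> n" for s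
    using that
  proof (induction s)
    case (Suc s)
    then show ?case using hyb[of s m] by simp
  qed simp
  have "rowlen i (rev (map (J 0) [0..<m])) = rowlen i (rev (map (J n) [0..<m]))"
    by (rule all[OF order_refl, symmetric])
  \<comment> \<open>At level \<open>n\<close> all columns start empty, so the letter counts of a
    suffix of the reversed word are column lengths.\<close>
  moreover have "lattice_word (rev (map (J n) [0..<m]))"
    unfolding lattice_word_def
  proof (intro conjI allI impI)
    show "0 \<notin> set (rev (map (J n) [0..<m]))"
    proof
      assume "0 \<in> set (rev (map (J n) [0..<m]))"
      then obtain k where "k < m" "J n k = 0" by auto
      then show False using pos[of n k] by simp
    qed
    fix a :: nat assume a1: "1 \<le> a"
    show "unmatched a 0 (rev (map (J n) [0..<m])) = 0"
    proof (rule unmatched_zeroI)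
      fix p q assume "rev (map (J n) [0..<m]) = p @ q"
      then have a: "map (J n) [0..<m] = rev q @ rev p" by (simp add: rev_swap)
      have le: "length q \<le> m" using arg_cong[OF a, of length] by simp
      have "rev q = take (length q) (map (J n) [0..<m])" unfolding a by simp
      also have "\<dots> = map (J n) [0..<length q]" using le by (simp add: take_map take_upt)
      finally have q: "rev q = map (J n) [0..<length q]" .
      have c: "count_list q c = x n (length q) c" if "1 \<le> c" for c
      proof -
        have "count_list (rev q) c + x n 0 c = x n (length q) c"
          unfolding q by (intro cnt le that) simp_all
        then show ?thesis using zero[OF that] by simp
      qed
      show "count_list q (Suc a) \<le> count_list q a"
        using c[OF a1] c[of "Suc a"] mono[of n "length q" a] le a1 by simp
    qed
  qed
  moreover have "count_list (map (J n) [0..<m]) (Suc j) = x n m (Suc j)"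
    using cnt[of 0 m n "Suc j"] zero by simp
  ultimately show ?thesis using rowlen_lattice_word by simp
qed

section \<open>Sequences of slides\<close>

definition std_filling :: "nat \<Rightarrow> tab \<Rightarrow> bool" where
  "std_filling n T \<longleftrightarrow> distinct (concat T) \<and> set (concat T) = {1..n}"

lemma maxent_std_filling:
  assumes "std_filling n T"
  shows "maxent T = n"
proof (rule antisym)
  have "foldr max xs 0 \<in> insert (0::nat) (set xs)" for xs
    by (induction xs) (auto simp: max_def)
  then have "maxent T \<in> insert 0 (set (concat T))" unfolding maxent_def .
  also have "\<dots> = insert 0 {1..n}" using assms unfolding std_filling_def by blast
  finally show "maxent T \<le> n" by auto
  have "n \<in> set (concat T)" if "n \<noteq> 0"
  proof -
    have "n \<in> {1..n}" using that by simp
    then show ?thesis using assms unfolding std_filling_def by blast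
  qed
  then show "n \<le> maxent T" using in_maxent[of n T] by (cases "n = 0") blast+
qed

lemma std_filling_add:
  assumes "std_filling n T" "mset (concat U) = add_mset (maxent T + 1) (mset (concat T))"
  shows "std_filling (Suc n) U"
proof -
  have m: "maxent T = n" by (rule maxent_std_filling[OF assms(1)])
  have "set (concat U) = insert (Suc n) {1..n}"
  proof -
    have "set (concat U) = insert (Suc n) (set (concat T))"
      using arg_cong[OF assms(2), of set_mset] unfolding m by (simp del: set_concat)
    then show ?thesis using assms(1) unfolding std_filling_def by simp
  qed
  moreover have "distinct (concat U)"
  proof -
    have "mset (concat U) = mset (Suc n # concat T)" using assms(2) m by simp
    moreover have "distinct (Suc n # concat T)" using assms(1) by (simp add: std_filling_def del: set_concat)
    ultimately show ?thesis by (metis mset_eq_imp_distinct_iff)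
  qed
  moreover have "insert (Suc n) {1..n} = {1..Suc n}" by auto
  ultimately show ?thesis unfolding std_filling_def by simp
qed

lemma museq_simps: "museq [] T = T" "museq (j # js) T = museq js (mu j T)"
  "museq (js @ [j]) T = mu j (museq js T)" "museq (js @ js') T = museq js' (museq js T)"
  by (simp_all add: museq_def)

lemma slides_museq:
  assumes "ssrct T" "std_filling n T" "slides_defined js T"
  shows "ssrct (museq js T) \<and> std_filling (n + length js) (museq js T) \<and>
         useq js (map length T) = Some (map length (museq js T))"
  using assms
proof (induction js arbitrary: T n)
  case Nil
  then show ?case by (simp add: museq_simps useq_def)
next
  case (Cons j js)
  have m: "ssrct (mu j T)" "uop j (Some (map length T)) = Some (map length (mu j T))"
    "mset (concat (mu j T)) = add_mset (maxent T + 1) (mset (concat T))"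
    using mu_step[OF Cons.prems(1), of j] Cons.prems(3) by auto
  have "std_filling (Suc n) (mu j T)" by (rule std_filling_add[OF Cons.prems(2) m(3)])
  from Cons.IH[OF m(1) this] Cons.prems(3) show ?case
    by (simp add: museq_simps useq_def m(2))
qed

lemma slides_defined_append:
  "slides_defined (js @ js') T \<longleftrightarrow> slides_defined js T \<and> slides_defined js' (museq js T)"
  by (induction js arbitrary: T) (auto simp: museq_simps)

text \<open>The threshold \<open>n\<close> is the maximum of \<open>T\<close>, so nothing is counted
  before slide 0; at level 0 the letters are the slides themselves by
  \<open>slide_col_0\<close>.\<close>

lemma rowlen_slides:
  assumes "ssrct T" "std_filling n T" "slides_defined js T"
  shows "j < rowlen i (rev js) \<longleftrightarrow> i < col_count (museq js T) n (Suc j)"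
proof -
  define U where "U k = museq (take k js) T" for k
  define m where "m = length js"
  have d: "slides_defined (take k js) T" for k
    using assms(3) slides_defined_append[of "take k js" "drop k js" T] by simp
  have U: "ssrct (U k)" "std_filling (n + k) (U k)" if "k \<le> m" for k
    using slides_museq[OF assms(1,2) d[of k]] that by (auto simp: U_def m_def min_def split: if_splits)
  have US: "U (Suc k) = mu (js ! k) (U k)" if "k < m" for k
    using that by (simp add: U_def m_def take_Suc_conv_app_nth museq_simps)
  have ad: "addable_in_col (sorted_partition (U k)) (js ! k)" if "k < m" for k
    using d[of "Suc k"] that slides_defined_append[of "take k js" "[js ! k]" T]
    by (simp add: U_def m_def take_Suc_conv_app_nth)
  have mx: "maxent (U k) = n + k" if "k \<le> m" for k using maxent_std_filling[OF U(2)[OF that]] .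
  have dist: "distinct (concat (mu (js ! k) (U k)))" if "k < m" for k
    using U(2)[of "Suc k"] US[OF that] that by (simp add: std_filling_def)
  have "j < rowlen i (rev (map ((\<lambda>s k. slide_col (U (Suc k)) s) 0) [0..<m])) \<longleftrightarrow> i < col_count (U m) n (Suc j)"
  proof (rule word_chain[where x = "\<lambda>s k. col_count (U k) s"])
    fix s k c :: nat assume "s \<le> n" "k \<le> m" "1 \<le> c"
    then show "col_count (U k) s (Suc c) \<le> col_count (U k) s c"
      using U(1)[of k] by (intro col_count_mono_col) (auto simp: ssrct_def)
  next
    fix s k c :: nat assume a: "s \<le> n" "k < m" "1 \<le> c"
    then show "col_count (U (Suc k)) s c = col_count (U k) s c + of_bool (c = slide_col (U (Suc k)) s)"
      using slide_counts[OF U(1) ad, of k s c] mx[of k] by (simp add: US)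
  next
    fix s k :: nat assume a: "s \<le> n" "k < m"
    then show "1 \<le> slide_col (U (Suc k)) s"
      using slide_col_pos[OF U(1) ad, of k s] mx[of k] by (simp add: US)
  next
    fix s k :: nat assume a: "s < n" "k < m"
    then show "slide_col (U (Suc k)) s = slide_col (U (Suc k)) (Suc s) \<or>
      slide_col (U (Suc k)) s = Suc (slide_col (U (Suc k)) (Suc s)) \<and>
      col_count (U k) (Suc s) (slide_col (U (Suc k)) (Suc s)) = col_count (U k) (Suc s) (Suc (slide_col (U (Suc k)) (Suc s))) \<and>
      col_count (U (Suc k)) s (slide_col (U (Suc k)) (Suc s)) = col_count (U (Suc k)) s (Suc (slide_col (U (Suc k)) (Suc s)))"
      using slide_col_Suc[OF U(1) ad _ dist, of k s] mx[of k] by (simp add: US)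
  next
    fix c :: nat
    have "col_count T n c = 0"
    proof -
      have "\<not> n < row_entry R c" if "R \<in> set T" for R
        using row_entry_le_maxent[OF that, of c] maxent_std_filling[OF assms(2)] by simp
      then have "col_count T n c = col_count T n 0" by (intro col_count_cong) simp
      moreover have "col_count T n 0 = 0" by (induction T) auto
      ultimately show ?thesis by simp
    qed
    then show "col_count (U 0) n c = 0" by (simp add: U_def museq_simps)
  qed
  moreover have "map (\<lambda>k. slide_col (U (Suc k)) 0) [0..<m] = js"
    by (rule nth_equalityI) (use slide_col_0[OF U(1) ad] US in \<open>auto simp: m_def\<close>)
  ultimately show ?thesis by (simp add: U_def m_def)
qed

section \<open>The map rho\<close>

text \<open>If \<open>h s c\<close> counts the entries greater than \<open>s\<close> in column
  \<open>c\<close>, this describes the tableau with decreasing, bottom-justified columns. Both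
  \<open>rho T\<close> and the recording tableau are described in this way, which allows their
  comparison.\<close>

definition entries_given_by :: "nat list list \<Rightarrow> (nat \<Rightarrow> nat \<Rightarrow> nat) \<Rightarrow> bool" where
  "entries_given_by P h \<longleftrightarrow> (\<forall>R\<in>set P. R \<noteq> [] \<and> 0 \<notin> set R) \<and>
     (\<forall>i s c. 1 \<le> c \<longrightarrow> (i < length P \<and> s < row_entry (P ! i) c \<longleftrightarrow> i < h s c))"

lemma nat_eq_lessI: "(\<And>s. s < (a::nat) \<longleftrightarrow> s < b) \<Longrightarrow> a = b"
  by (metis less_irrefl linorder_neqE_nat)

lemma row_eqI:
  assumes "0 \<notin> set R" "0 \<notin> set R'" "\<And>c. 1 \<le> c \<Longrightarrow> row_entry R c = row_entry R' c"
  shows "R = R'"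
proof (rule nth_equalityI)
  have "i < length R \<longleftrightarrow> i < length R'" for i
    using row_entry_pos[OF assms(1), of "Suc i"] row_entry_pos[OF assms(2), of "Suc i"] assms(3)[of "Suc i"] by auto
  then show l: "length R = length R'" by (rule nat_eq_lessI)
  fix i assume "i < length R"
  then show "R ! i = R' ! i" using assms(3)[of "Suc i"] l by (simp add: row_entry_def)
qed

lemma entries_given_byD: "entries_given_by P h \<Longrightarrow> i < length P \<Longrightarrow> 1 \<le> c \<Longrightarrow> s < row_entry (P ! i) c \<longleftrightarrow> i < h s c"
  unfolding entries_given_by_def by blast

lemma entries_unique:
  assumes P: "entries_given_by P h" and P': "entries_given_by P' h"
  shows "P = P'"
proof (rule nth_equalityI)
  have len: "i < length P \<longleftrightarrow> i < h 0 1" if "entries_given_by P h" for P i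
  proof -
    have "0 < row_entry (P ! i) 1" if "i < length P"
      using \<open>entries_given_by P h\<close> nth_mem[OF that] row_entry_pos[of "P ! i" 1] by (auto simp: entries_given_by_def Suc_le_eq)
    then show ?thesis using \<open>entries_given_by P h\<close> unfolding entries_given_by_def by (metis order_refl)
  qed
  show l: "length P = length P'"
    by (rule nat_eq_lessI) (simp only: len[OF P] len[OF P'])
  fix i assume i: "i < length P"
  show "P ! i = P' ! i"
  proof (rule row_eqI)
    show "0 \<notin> set (P ! i)" "0 \<notin> set (P' ! i)" using P P' i l nth_mem by (auto simp: entries_given_by_def)
    fix c :: nat assume "1 \<le> c"
    then show "row_entry (P ! i) c = row_entry (P' ! i) c"
      using entries_given_byD[OF P i] entries_given_byD[OF P', of i c] i l by (intro nat_eq_lessI) simp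
  qed
qed

lemma entries_fun_unique:
  assumes "entries_given_by P h" "entries_given_by P h'" "1 \<le> c"
  shows "h s c = h' s c"
  using assms by (intro nat_eq_lessI) (metis entries_given_by_def)

lemma entries_cong:
  assumes "entries_given_by P h" "\<And>s c. 1 \<le> c \<Longrightarrow> h s c = h' s c"
  shows "entries_given_by P h'"
  using assms by (simp add: entries_given_by_def)

text \<open>For threshold \<open>s\<close> the slides are cut after the first \<open>s\<close>. The
  remaining ones act on a tableau with maximum \<open>n + s\<close>, and their reversed word is the
  prefix of length \<open>length js - s\<close> of the whole word, so \<open>rowlen_slides\<close>
  describes this level set.\<close>

lemma Qtab_entries:
  assumes "ssrct T" "std_filling n T" "slides_defined js T"
  shows "entries_given_by (Qtab (std (rev js))) (\<lambda>s c. col_count (museq js T) (n + s) c)"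
  unfolding entries_given_by_def
proof (intro conjI ballI allI impI)
  let ?Q = "Qtab (std (rev js))"
  fix R assume R: "R \<in> set ?Q"
  then show "R \<noteq> []" using Qtab_std(1) by metis
  obtain i where i: "i < length ?Q" "R = ?Q ! i" using R by (metis in_set_conv_nth)
  show "0 \<notin> set R"
  proof
    assume "0 \<in> set R"
    then obtain j where "j < length R" "R ! j = 0" by (metis in_set_conv_nth)
    then show False using Qtab_std(3)[of "rev js" i j] i by (simp add: in_diagram_def)
  qed
next
  let ?Q = "Qtab (std (rev js))"
  fix i s c :: nat assume c: "1 \<le> c"
  then obtain j where j: "c = Suc j" by (cases c) auto
  have "(i < length ?Q \<and> s < row_entry (?Q ! i) c) \<longleftrightarrow> (in_diagram ?Q i j \<and> s < ?Q ! i ! j)"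
    by (auto simp: in_diagram_def j row_entry_def)
  also have "\<dots> \<longleftrightarrow> j < rowlen i (take (length js - s) (rev js))"
    using Qtab_std(2)[of "rev js" i j s] by simp
  also have "\<dots> \<longleftrightarrow> i < col_count (museq js T) (n + s) c"
  proof (cases "s \<le> length js")
    case True
    have d: "slides_defined (take s js) T" "slides_defined (drop s js) (museq (take s js) T)"
      using assms(3) slides_defined_append[of "take s js" "drop s js" T] by auto
    have "ssrct (museq (take s js) T)" "std_filling (n + s) (museq (take s js) T)"
      using slides_museq[OF assms(1,2) d(1)] True by (auto simp: min_absorb2)
    from rowlen_slides[OF this d(2), of j i]
    have "j < rowlen i (rev (drop s js)) \<longleftrightarrow> i < col_count (museq js T) (n + s) c"
      using museq_simps(4)[of "take s js" "drop s js" T] by (simp add: j)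
    then show ?thesis by (simp add: rev_drop)
  next
    case False
    have z: "rowlen i [] = 0" for i by (induction i) auto
    \<comment> \<open>No entry of the final tableau exceeds \<open>n + length js\<close>, so here
      both sides fail.\<close>
    have "\<not> n + s < row_entry R c" if "R \<in> set (museq js T)" for R
      using row_entry_le_maxent[OF that, of c] maxent_std_filling slides_museq[OF assms] False
      by (metis add_le_cancel_left le_trans less_imp_le not_le)
    then have "col_count (museq js T) (n + s) c = col_count (museq js T) (n + s) 0" by (intro col_count_cong) simp
    moreover have "col_count U r 0 = 0" for U r by (induction U) auto
    ultimately show ?thesis using False z by simp
  qed
  finally show "(i < length ?Q \<and> s < row_entry (?Q ! i) c) = (i < col_count (museq js T) (n + s) c)" .
qed

lemma rev_sort_gt_iff:
  fixes xs :: "nat list"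
  assumes "0 \<notin> set xs" "i < length xs"
  shows "s < rev (sort xs) ! i \<longleftrightarrow> i < length (filter (\<lambda>e. s < e) xs)"
proof -
  let ?R = "rev (sort xs)"
  have "row_entry ?R (Suc c) \<le> row_entry ?R c" if "1 \<le> c" for c
  proof (cases "Suc c \<le> length xs")
    case True
    then show ?thesis using that sorted_nth_mono[OF sorted_sort[of xs], of "length xs - Suc c" "length xs - c"]
      by (simp add: row_entry_def rev_nth)
  qed (simp add: row_entry_def)
  then have g: "decr_row ?R" using assms(1) by (simp add: decr_row_def)
  have "length (filter (\<lambda>e. s < e) ?R) = size (filter_mset (\<lambda>e. s < e) (mset ?R))"
    by (metis mset_filter size_mset)
  also have "\<dots> = size (filter_mset (\<lambda>e. s < e) (mset xs))" by simp
  also have "\<dots> = length (filter (\<lambda>e. s < e) xs)" by (metis mset_filter size_mset)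
  finally have "s < row_entry ?R (Suc i) \<longleftrightarrow> i < length (filter (\<lambda>e. s < e) xs)"
    using decr_row_gt_iff[OF g, of s "Suc i"] by (simp add: Suc_le_eq)
  then show ?thesis using assms(2) by (simp add: row_entry_def)
qed

lemma col_rows: "col T c = map (\<lambda>R. R ! (c - 1)) (filter (\<lambda>R. c \<le> length R) T)"
proof -
  have "map (\<lambda>R. R ! (c - 1)) (filter (\<lambda>R. c \<le> length R) (map ((!) T) [0..<length T])) = col T c"
    by (simp add: filter_map col_def comp_def)
  then show ?thesis by (simp add: map_nth)
qed

lemma filter_col: "1 \<le> c \<Longrightarrow> length (filter (\<lambda>e. s < e) (col T c)) = col_count T s c"
  unfolding col_rows by (induction T) (auto simp: row_entry_def)

text \<open>Used for the columns with more than \<open>i\<close> boxes: they form an initial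
  segment, so that row \<open>i\<close> of \<open>rho T\<close> has no gaps.\<close>

lemma filter_antimono_upt:
  assumes "\<And>c. 1 \<le> c \<Longrightarrow> p (Suc c) \<Longrightarrow> p c"
  shows "\<exists>k\<le>w. filter p [1..<w + 1] = [1..<k + 1] \<and> (\<forall>c. 1 \<le> c \<longrightarrow> c \<le> w \<longrightarrow> (p c \<longleftrightarrow> c \<le> k))"
proof (induction w)
  case (Suc w)
  then obtain k where k: "k \<le> w" "filter p [1..<w + 1] = [1..<k + 1]"
    "\<And>c. 1 \<le> c \<Longrightarrow> c \<le> w \<Longrightarrow> p c \<longleftrightarrow> c \<le> k" by auto
  have u: "[1..<Suc w + 1] = [1..<w + 1] @ [Suc w]" by simp
  show ?case
  proof (cases "p (Suc w)")
    case True
    have "k = w" using assms[OF _ True] k(1) k(3)[of w] by (cases "w = 0") auto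
    then show ?thesis using True k unfolding u
      by (intro exI[of _ "Suc w"]) (auto simp: le_Suc_eq)
  next
    case False
    then show ?thesis using k unfolding u by (intro exI[of _ k]) (auto simp: le_Suc_eq)
  qed
qed auto

lemma ssrct_col_count_1:
  assumes "ssrct T"
  shows "col_count T 0 1 = length T"
proof -
  have "0 < row_entry R 1" if "R \<in> set T" for R
    using assms that row_entry_pos[of R 1] by (auto simp: ssrct_def decr_row_def Suc_le_eq)
  then show ?thesis by (induction T) auto
qed

text \<open>In a column sorted decreasingly upwards the entries greater than \<open>s\<close> occupy
  the lowest positions, so position \<open>i\<close> is among them exactly if there are more than
  \<open>i\<close> of them.\<close>

lemma rho_entries:
  assumes "ssrct T"
  shows "entries_given_by (rho T) (col_count T)"
proof -
  define w where "w = foldr max (map length T) 0"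
  have rows: "R \<noteq> []" "decr_row R" "0 \<notin> set R" if "R \<in> set T" for R
    using assms that by (auto simp: ssrct_def decr_row_def)
  have wl: "length R \<le> w" if "R \<in> set T" for R
  proof -
    have "x \<in> set xs \<Longrightarrow> x \<le> foldr max xs 0" for x :: nat and xs by (induction xs) auto
    then show ?thesis using that by (simp add: w_def)
  qed
  have col0: "0 \<notin> set (col T c)" if "1 \<le> c" for c
  proof
    assume "0 \<in> set (col T c)"
    then obtain R where R: "R \<in> set T" "c \<le> length R" "R ! (c - 1) = 0" by (auto simp: col_rows)
    then have "0 \<in> set R" using that nth_mem[of "c - 1" R] by simp
    then show False using rows(3)[OF R(1)] by simp
  qed
  have lc: "length (col T c) = col_count T 0 c" if "1 \<le> c" for c
  proof -
    have "filter (\<lambda>e. 0 < e) (col T c) = col T c" using col0[OF that] by (auto simp: filter_id_conv intro!: gr0I)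
    then show ?thesis using filter_col[OF that, of 0 T] by simp
  qed
  have mono: "col_count T 0 (Suc c) \<le> col_count T 0 c" if "1 \<le> c" for c using col_count_mono_col[of T c 0] rows that by blast
  have hs: "col_count T s c \<le> col_count T 0 c" for s c by (rule col_count_le) simp
  have h1: "col_count T 0 1 = length T" by (rule ssrct_col_count_1[OF assms])
  have large_part: "col_count T 0 c = 0" if "w < c" for c
  proof -
    have "row_entry R c = 0" if "R \<in> set T" for R using wl[OF that] \<open>w < c\<close> by (simp add: row_entry_def)
    then show ?thesis by (induction T) auto
  qed
  have row: "\<exists>k\<ge>1. rho T ! i = map (\<lambda>c. rev (sort (col T c)) ! i) [1..<k + 1] \<and>
      (\<forall>c\<ge>1. i < col_count T 0 c \<longleftrightarrow> c \<le> k)" if i: "i < length T" for i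
  proof -
    have pm: "i < length (col T c)" if "1 \<le> c" "i < length (col T (Suc c))" for c
      using mono[of c] that lc[of c] lc[of "Suc c"] by simp
    obtain k where k: "k \<le> w" "filter (\<lambda>c. i < length (col T c)) [1..<w + 1] = [1..<k + 1]"
      "\<And>c. 1 \<le> c \<Longrightarrow> c \<le> w \<Longrightarrow> i < length (col T c) \<longleftrightarrow> c \<le> k"
      using filter_antimono_upt[of "\<lambda>c. i < length (col T c)" w, OF pm] by blast
    have kc: "i < col_count T 0 c \<longleftrightarrow> c \<le> k" if "1 \<le> c" for c
      using k(1) k(3)[OF that] lc[OF that] large_part[of c] by (cases "c \<le> w") auto
    moreover have "rho T ! i = map (\<lambda>c. rev (sort (col T c)) ! i) [1..<k + 1]"
    proof -
      have "rho T ! i = map (\<lambda>c. rev (sort (col T c)) ! i) (filter (\<lambda>c. i < length (col T c)) [1..<w + 1])"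
        using i by (simp add: rho_def Let_def w_def del: upt_Suc)
      then show ?thesis unfolding k(2) .
    qed
    moreover have "1 \<le> k" using kc[of 1] h1 i by simp
    ultimately show ?thesis by blast
  qed
  have lrho: "length (rho T) = length T" by (simp add: rho_def Let_def)
  have re: "s < row_entry (rho T ! i) c \<longleftrightarrow> i < col_count T s c" if i: "i < length T" and c: "1 \<le> c" for i s c
  proof -
    obtain k where k: "rho T ! i = map (\<lambda>c. rev (sort (col T c)) ! i) [1..<k + 1]" "\<forall>c\<ge>1. i < col_count T 0 c \<longleftrightarrow> c \<le> k"
      using row[OF i] by blast
    have r: "row_entry (rho T ! i) c = (if c \<le> k then rev (sort (col T c)) ! i else 0)"
      using c unfolding k(1) by (auto simp: row_entry_def nth_append simp del: upt_Suc)
    show ?thesis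
    proof (cases "c \<le> k")
      case True
      then show ?thesis
        using rev_sort_gt_iff[OF col0[OF c], of i s] lc[OF c] k(2) c r filter_col[OF c, of s T] by simp
    next
      case False
      then have "\<not> i < col_count T s c" using k(2) c hs[of s c] by (metis less_le_trans)
      then show ?thesis using r False by simp
    qed
  qed
  have "R \<noteq> [] \<and> 0 \<notin> set R" if R: "R \<in> set (rho T)" for R
  proof -
    obtain i where i: "i < length T" "R = rho T ! i" using R lrho by (metis in_set_conv_nth)
    obtain k where k: "1 \<le> k" "rho T ! i = map (\<lambda>c. rev (sort (col T c)) ! i) [1..<k + 1]" "\<forall>c\<ge>1. i < col_count T 0 c \<longleftrightarrow> c \<le> k"
      using row[OF i(1)] by blast
    have lR: "length R = k" using k(2) i by (simp del: upt_Suc)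
    have "0 < R ! j" if "j < length R" for j
    proof -
      have "i < col_count T 0 (Suc j)" using k(3) that lR by simp
      then have "0 < row_entry R (Suc j)" using re[OF i(1), of "Suc j" 0] i(2) by simp
      then show ?thesis using that by (simp add: row_entry_def)
    qed
    then have "0 \<notin> set R" by (metis in_set_conv_nth less_irrefl)
    then show ?thesis using lR k(1) by auto
  qed
  moreover have "i < length T \<and> s < row_entry (rho T ! i) c \<longleftrightarrow> i < col_count T s c" if "1 \<le> c" for i s c
  proof -
    have "col_count T s c \<le> length T" by (induction T) (auto simp: of_bool_def)
    then show ?thesis using re[OF _ that, of i s] by (cases "i < length T") auto
  qed
  ultimately show ?thesis unfolding entries_given_by_def lrho by blast
qed

section \<open>Reconstruction of an SSRCT from its columns\<close>

lemma col_count_Suc: "col_count T s c = col_count T (Suc s) c + length (filter (\<lambda>R. row_entry R c = Suc s) T)"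
  by (induction T) (auto simp: of_bool_def)

lemma entry_iff: "(\<exists>R\<in>set T. row_entry R c = Suc s) \<longleftrightarrow> col_count T s c \<noteq> col_count T (Suc s) c"
proof -
  have "(\<exists>R\<in>set T. row_entry R c = Suc s) \<longleftrightarrow> filter (\<lambda>R. row_entry R c = Suc s) T \<noteq> []"
    by (auto simp: filter_empty_conv)
  then show ?thesis using col_count_Suc[of T s c] by simp
qed

lemma entries_eq:
  assumes "\<And>s. col_count T s c = col_count U s c" "0 < y"
  shows "(\<exists>R\<in>set T. row_entry R c = y) \<longleftrightarrow> (\<exists>R\<in>set U. row_entry R c = y)"
  using entry_iff[of T c "y - 1"] entry_iff[of U c "y - 1"] assms by simp

text \<open>A column of an SSRCT is determined by its set of entries and the column to its left:
  in the position of the largest misplaced entry the triple rule is violated.\<close>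
lemma misplaced_entry:
  assumes "ssrct U" "length T = length U" "1 \<le> c"
    and "\<And>r. r < length T \<Longrightarrow> row_entry (T ! r) c = row_entry (U ! r) c" "\<And>r. r < length T \<Longrightarrow> decr_row (T ! r)"
    and "\<And>z r. y < z \<Longrightarrow> r < length T \<Longrightarrow> row_entry (T ! r) (Suc c) = z \<longleftrightarrow> row_entry (U ! r) (Suc c) = z"
    and "r < r'" "r' < length T" "row_entry (T ! r) (Suc c) = y" "row_entry (U ! r') (Suc c) = y" "0 < y"
  shows False
proof -
  have "row_triple (U ! r) (U ! r')"
    using assms(1,2,7,8) by (auto simp: ssrct_def sorted_wrt_iff_nth_less)
  moreover have "y \<le> row_entry (U ! r) c"
    using assms(3,4,5,7,8,9) by (metis decr_row_def less_trans)
  ultimately have "y < row_entry (U ! r) (Suc c)" using row_tripleD assms(3,10,11) by metis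
  then show False using assms(6)[of "row_entry (U ! r) (Suc c)" r] assms(7,8,9) by simp
qed

text \<open>The first column is increasing, hence determined by its set of entries. Any other column
  is recovered from its left neighbour by \<open>misplaced_entry\<close>, used in both
  directions.\<close>

lemma ssrct_unique:
  assumes T: "ssrct T" and U: "ssrct U" and h: "\<And>s c. 1 \<le> c \<Longrightarrow> col_count T s c = col_count U s c"
  shows "T = U"
proof -
  have l: "length T = length U" using ssrct_col_count_1[OF T] ssrct_col_count_1[OF U] h[of 1 0] by simp
  have g: "decr_row (T ! r)" "decr_row (U ! r)" if "r < length T" for r
    using T U that l by (auto simp: ssrct_def)
  have en: "(\<exists>r<length T. row_entry (T ! r) c = y) \<longleftrightarrow> (\<exists>r<length T. row_entry (U ! r) c = y)" if "1 \<le> c" "0 < y" for c y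
    using entries_eq[of T c U y] h[OF that(1)] that(2) l by (metis in_set_conv_nth)
  have c1: "map (\<lambda>R. row_entry R 1) T = map (\<lambda>R. row_entry R 1) U"
  proof -
    have "sorted_wrt (\<lambda>R S. row_entry R 1 < row_entry S 1) V" if "ssrct V" for V
      by (rule sorted_wrt_mono_rel[of V row_triple]) (use that in \<open>auto simp: ssrct_def row_triple_def\<close>)
    then have srt: "sorted_wrt (<) (map (\<lambda>R. row_entry R 1) V)" if "ssrct V" for V
      using that by (simp add: sorted_wrt_map)
    have p: "0 < row_entry R 1" if "R \<in> set T \<union> set U" for R
      using T U that row_entry_pos[of R 1] by (auto simp: ssrct_def decr_row_def Suc_le_eq)
    have ee: "(\<exists>R\<in>set T. row_entry R 1 = y) \<longleftrightarrow> (\<exists>R\<in>set U. row_entry R 1 = y)" if "0 < y" for y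
      by (rule entries_eq) (use h that in auto)
    have "y \<in> set (map (\<lambda>R. row_entry R 1) T) \<longleftrightarrow> y \<in> set (map (\<lambda>R. row_entry R 1) U)" for y
    proof -
      have m: "y \<in> set (map (\<lambda>R. row_entry R 1) V) \<longleftrightarrow> (\<exists>R\<in>set V. row_entry R 1 = y)" for V by auto
      show ?thesis unfolding m
      proof (cases "y = 0")
        case True
        then show "(\<exists>R\<in>set T. row_entry R 1 = y) \<longleftrightarrow> (\<exists>R\<in>set U. row_entry R 1 = y)" using p by (metis UnCI less_irrefl)
      qed (use ee[of y] in simp)
    qed
    then have "set (map (\<lambda>R. row_entry R 1) T) = set (map (\<lambda>R. row_entry R 1) U)" by blast
    then show ?thesis by (rule strict_sorted_equal[OF srt[OF U] srt[OF T]])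
  qed
  have cols: "row_entry (T ! r) c = row_entry (U ! r) c" if "1 \<le> c" "r < length T" for c r
    using that
  proof (induction c arbitrary: r rule: dec_induct)
    case base
    then show ?case using c1 l by (metis nth_map)
  next
    case (step c)
    define M where "M = max (maxent T) (maxent U)"
    have bd: "row_entry (T ! r) (Suc c) \<le> M" "row_entry (U ! r) (Suc c) \<le> M" if "r < length T" for r
      using row_entry_le_maxent[of "T ! r" T "Suc c"] row_entry_le_maxent[of "U ! r" U "Suc c"] that l
      by (auto simp: M_def)
    have "\<forall>r<length T. row_entry (T ! r) (Suc c) = y \<longleftrightarrow> row_entry (U ! r) (Suc c) = y" if "0 < y" for y
      using that
    \<comment> \<open>Largest values are placed before smaller ones; as \<open>M\<close> bounds all
      entries, values above it occur in neither tableau.\<close>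
    proof (induction "M - y" arbitrary: y rule: less_induct)
      case less
      have up: "row_entry (T ! r) (Suc c) = z \<longleftrightarrow> row_entry (U ! r) (Suc c) = z" if "y < z" "r < length T" for z r
      proof (cases "z \<le> M")
        case True
        then show ?thesis using less(1)[of z] that less(2) by (simp add: diff_less_mono2)
      next
        case False
        then show ?thesis using bd[OF that(2)] by auto
      qed
      have 1: False if "r < r'" "r' < length T" "row_entry (T ! r) (Suc c) = y" "row_entry (U ! r') (Suc c) = y" for r r'
        by (rule misplaced_entry[OF U l step(1) _ _ _ that less(2)])
          (rule step.IH g up; assumption)+
      have 2: False if "r < r'" "r' < length T" "row_entry (U ! r) (Suc c) = y" "row_entry (T ! r') (Suc c) = y" for r r'
        by (rule misplaced_entry[OF T l[symmetric] step(1) _ _ _ that(1) that(2)[unfolded l] that(3,4) less(2)])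
          (rule step.IH[symmetric] g up[symmetric]; simp add: l)+
      show ?case
      proof (intro allI impI iffI)
        fix r assume r: "r < length T" "row_entry (T ! r) (Suc c) = y"
        then obtain r' where "r' < length T" "row_entry (U ! r') (Suc c) = y" using en[of "Suc c" y] less(2) by auto
        then show "row_entry (U ! r) (Suc c) = y"
          using 1[of r r'] 2[of r' r] r less(2) by (cases r r' rule: linorder_cases) auto
      next
        fix r assume r: "r < length T" "row_entry (U ! r) (Suc c) = y"
        then obtain r' where "r' < length T" "row_entry (T ! r') (Suc c) = y" using en[of "Suc c" y] less(2) by auto
        then show "row_entry (T ! r) (Suc c) = y"
          using 1[of r' r] 2[of r r'] r less(2) by (cases r r' rule: linorder_cases) auto
      qed
    qed
    then show ?case using step.prems by (metis gr0I)
  qed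
  show "T = U"
  proof (rule nth_equalityI[OF l])
    fix r assume r: "r < length T"
    show "T ! r = U ! r" by (rule row_eqI) (use g[OF r] cols[OF _ r] in \<open>auto simp: decr_row_def\<close>)
  qed
qed

section \<open>From \<open>is_SSRCT\<close> to the working form\<close>

lemma ssrct_if_SSRCT:
  assumes "is_SSRCT T \<beta> []"
  shows "ssrct T" "\<beta> = map length T"
proof -
  note S = assms[unfolded is_SSRCT_def]
  show b: "\<beta> = map length T" using S by (elim conjE) (rule sym)
  have comp: "is_comp \<beta>" using S by (elim conjE)
  have S1: "\<forall>r c. in_shape \<beta> r c \<longrightarrow> (ent T r c = 0 \<longleftrightarrow> inner \<beta> [] r c)" using S by (elim conjE)
  have S2: "\<forall>r c. filled \<beta> [] r c \<and> filled \<beta> [] r (c+1) \<longrightarrow> ent T r (c+1) \<le> ent T r c" using S by (elim conjE)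
  have S3: "\<forall>r s. r < s \<and> filled \<beta> [] r 1 \<and> filled \<beta> [] s 1 \<longrightarrow> ent T r 1 < ent T s 1" using S by (elim conjE)
  have S4: "\<forall>r s c. r < s \<and> 1 \<le> c \<and> filled \<beta> [] s (c+1) \<and>
        (inner \<beta> [] r c \<or> (filled \<beta> [] r c \<and> ent T s (c+1) \<le> ent T r c)) \<longrightarrow>
        (inner \<beta> [] r (c+1) \<or> (filled \<beta> [] r (c+1) \<and> ent T s (c+1) < ent T r (c+1)))" using S by (elim conjE)
  have inn: "\<not> inner \<beta> [] r c" for r c by (auto simp: inner_def)
  have ins: "in_shape \<beta> (Suc r) c \<longleftrightarrow> 1 \<le> c \<and> c \<le> length (T ! r)" if "r < length T" for r c
    using that by (auto simp: in_shape_def b)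
  have fil: "filled \<beta> [] r c \<longleftrightarrow> in_shape \<beta> r c" for r c by (simp add: filled_def inn)
  have pos: "0 \<notin> set (T ! r)" if "r < length T" for r
  proof
    assume "0 \<in> set (T ! r)"
    then obtain c where c: "c < length (T ! r)" "T ! r ! c = 0" by (metis in_set_conv_nth)
    then have "in_shape \<beta> (Suc r) (Suc c)" using ins[OF that] by simp
    then have "ent T (Suc r) (Suc c) \<noteq> 0" using S1 inn by blast
    then show False using c that by (simp add: ent_Suc row_entry_def)
  qed
  have ins': "in_shape \<beta> (Suc r) c \<longleftrightarrow> 0 < row_entry (T ! r) c" if "r < length T" for r c
    using ins[OF that] row_entry_pos[OF pos[OF that]] by simp
  have rows: "T ! r \<noteq> [] \<and> decr_row (T ! r)" if "r < length T" for r
  proof -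
    have "length (T ! r) \<in> set \<beta>" using that by (simp add: b)
    then have "T ! r \<noteq> []" using comp by (auto simp: is_comp_def)
    moreover have "row_entry (T ! r) (Suc c) \<le> row_entry (T ! r) c" if "1 \<le> c" for c
    proof (cases "0 < row_entry (T ! r) (Suc c)")
      case True
      then have "Suc c \<le> length (T ! r)" using row_entry_pos[OF pos[OF \<open>r < length T\<close>]] by simp
      then have "in_shape \<beta> (Suc r) (Suc c)" "in_shape \<beta> (Suc r) c"
        unfolding ins[OF \<open>r < length T\<close>] using that by simp_all
      then have "ent T (Suc r) (c + 1) \<le> ent T (Suc r) c" using S2[rule_format, of "Suc r" c] fil by simp
      then show ?thesis using ent_Suc[OF \<open>r < length T\<close>] by simp
    qed simp
    ultimately show ?thesis using pos[OF that] by (auto simp: decr_row_def)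
  qed
  have "row_triple (T ! r) (T ! s)" if rs: "r < s" "s < length T" for r s
  proof -
    have r: "r < length T" using rs by simp
    have f1: "filled \<beta> [] (Suc q) 1" if "q < length T" for q
      using ins[OF that] rows[OF that] fil by (auto simp: Suc_le_eq)
    have 1: "row_entry (T ! r) 1 < row_entry (T ! s) 1"
      using S3[rule_format, of "Suc r" "Suc s"] f1[OF r] f1[OF rs(2)] rs(1) ent_Suc[OF r] ent_Suc[OF rs(2)]
      by simp
    have "row_entry (T ! s) (Suc c) < row_entry (T ! r) (Suc c)"
      if c: "1 \<le> c" "0 < row_entry (T ! s) (Suc c)" "row_entry (T ! s) (Suc c) \<le> row_entry (T ! r) c" for c
    proof -
      have "filled \<beta> [] (Suc s) (c + 1)" "filled \<beta> [] (Suc r) c"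
        using c ins'[OF r, of c] ins'[OF rs(2), of "Suc c"] fil by simp_all
      moreover have "ent T (Suc s) (c + 1) \<le> ent T (Suc r) c" using c ent_Suc[OF r] ent_Suc[OF rs(2)] by simp
      moreover have "Suc r < Suc s" using rs by simp
      ultimately have "ent T (Suc s) (c + 1) < ent T (Suc r) (c + 1)"
        using S4[rule_format, of "Suc r" "Suc s" c] c(1) inn by blast
      then show ?thesis using ent_Suc[OF r] ent_Suc[OF rs(2)] by simp
    qed
    then show ?thesis using 1 by (simp add: row_triple_def)
  qed
  then show "ssrct T" using rows by (auto simp: ssrct_def sorted_wrt_iff_nth_less in_set_conv_nth)
qed

section \<open>The inner shape\<close>

text \<open>As the first column increases downwards and rows decrease, the entries greater than
  \<open>n\<close> sit left-justified in the last rows, which is the position required of an inner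
  shape. Lowering them by \<open>n\<close> makes them comparable with the labels of the recording
  tableau.\<close>

definition large_part :: "nat \<Rightarrow> tab \<Rightarrow> tab" where
  "large_part n T = map (\<lambda>R. map (\<lambda>x. x - n) (takeWhile (\<lambda>x. n < x) R)) (dropWhile (\<lambda>R. row_entry R 1 \<le> n) T)"

text \<open>Truncated subtraction sends the entries at most \<open>n\<close> to 0, the value of a
  missing box.\<close>

lemma row_entry_truncate:
  assumes "decr_row R"
  shows "row_entry (map (\<lambda>x. x - n) (takeWhile (\<lambda>x. n < x) R)) c = row_entry R c - n"
proof -
  let ?W = "takeWhile (\<lambda>x. n < x) R"
  have lw: "length ?W \<le> length R" by (rule length_takeWhile_le)
  show ?thesis
  proof (cases "1 \<le> c \<and> c \<le> length ?W")
    case True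
    then show ?thesis using lw takeWhile_nth[of "c - 1" "\<lambda>x. n < x" R] by (auto simp: row_entry_def)
  next
    case False
    have "\<not> n < row_entry R c"
    proof
      assume a: "n < row_entry R c"
      then have c: "1 \<le> c" "length ?W < c" using False by (auto simp: row_entry_def split: if_splits)
      then have "n < row_entry R (Suc (length ?W))" using a decr_row_gt_iff[OF assms] by auto
      moreover have "c \<le> length R" using a by (auto simp: row_entry_def split: if_splits)
      then have "\<not> n < R ! length ?W" using c(2) by (intro nth_length_takeWhile) simp
      ultimately show False by (auto simp: row_entry_def split: if_splits)
    qed
    then show ?thesis using False by (auto simp: row_entry_def)
  qed
qed

lemma large_part_split:
  assumes "ssrct T"
  obtains A B where "T = A @ B" "\<And>R. R \<in> set A \<Longrightarrow> row_entry R 1 \<le> n" "\<And>R. R \<in> set B \<Longrightarrow> n < row_entry R 1"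
    "large_part n T = map (\<lambda>R. map (\<lambda>x. x - n) (takeWhile (\<lambda>x. n < x) R)) B"
proof -
  let ?A = "takeWhile (\<lambda>R. row_entry R 1 \<le> n) T" and ?B = "dropWhile (\<lambda>R. row_entry R 1 \<le> n) T"
  have T: "T = ?A @ ?B" by simp
  have "n < row_entry R 1" if "R \<in> set ?B" for R
  proof (cases ?B)
    case Nil
    then show ?thesis using that by (simp del: dropWhile_eq_Nil_conv)
  next
    case (Cons S Q)
    have "n < row_entry S 1" using Cons by (metis dropWhile_eq_Cons_conv not_le)
    moreover have "sorted_wrt row_triple ?B" using assms T unfolding ssrct_def by (metis sorted_wrt_append)
    ultimately show ?thesis using that unfolding Cons by (auto simp: row_triple_def)
  qed
  moreover have "row_entry R 1 \<le> n" if "R \<in> set ?A" for R using set_takeWhileD[OF that] by simp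
  ultimately show ?thesis using that[OF T] by (simp add: large_part_def)
qed

lemma ssrct_large_part:
  assumes "ssrct T"
  shows "ssrct (large_part n T)" "1 \<le> c \<Longrightarrow> col_count (large_part n T) s c = col_count T (n + s) c"
proof -
  obtain A B where T: "T = A @ B" and A: "\<And>R. R \<in> set A \<Longrightarrow> row_entry R 1 \<le> n"
    and B: "\<And>R. R \<in> set B \<Longrightarrow> n < row_entry R 1"
    and b: "large_part n T = map (\<lambda>R. map (\<lambda>x. x - n) (takeWhile (\<lambda>x. n < x) R)) B"
    using large_part_split[OF assms] by metis
  let ?f = "\<lambda>R. map (\<lambda>x. x - n) (takeWhile (\<lambda>x. n < x) R)"
  have g: "decr_row R" if "R \<in> set T" for R using assms that by (simp add: ssrct_def)
  have rf: "row_entry (?f R) c = row_entry R c - n" if "R \<in> set B" for R c using row_entry_truncate g that T by auto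
  have gf: "?f R \<noteq> [] \<and> decr_row (?f R)" if "R \<in> set B" for R
  proof -
    have "0 < row_entry (?f R) 1" using rf[OF that] B[OF that] by simp
    then have "?f R \<noteq> []" by (auto simp: row_entry_def split: if_splits)
    moreover have "0 \<notin> set (?f R)" by (auto dest: set_takeWhileD)
    moreover have "row_entry (?f R) (Suc c) \<le> row_entry (?f R) c" if "1 \<le> c" for c
      using g[of R] \<open>R \<in> set B\<close> that unfolding rf[OF \<open>R \<in> set B\<close>] by (auto simp: T decr_row_def intro: diff_le_mono)
    ultimately show ?thesis by (auto simp: decr_row_def)
  qed
  have "sorted_wrt row_triple B" using assms by (simp add: T ssrct_def sorted_wrt_append)
  then have "sorted_wrt (\<lambda>R S. row_triple (?f R) (?f S)) B"
  proof (rule sorted_wrt_mono_rel[rotated])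
    fix R S assume RS: "R \<in> set B" "S \<in> set B" "row_triple R S"
    show "row_triple (?f R) (?f S)"
      unfolding row_triple_def rf[OF RS(1)] rf[OF RS(2)]
    proof (intro conjI allI impI)
      show "row_entry R 1 - n < row_entry S 1 - n" using RS(3) B[OF RS(1)] by (simp add: row_triple_def diff_less_mono)
      fix c assume c: "1 \<le> c" "0 < row_entry S (Suc c) - n" "row_entry S (Suc c) - n \<le> row_entry R c - n"
      then have "row_entry S (Suc c) \<le> row_entry R c" by arith
      moreover have "n < row_entry S (Suc c)" using c(2) by simp
      ultimately show "row_entry S (Suc c) - n < row_entry R (Suc c) - n"
        using row_tripleD[OF RS(3) c(1)] by (simp add: diff_less_mono)
    qed
  qed
  then show "ssrct (large_part n T)" using gf by (auto simp: ssrct_def b sorted_wrt_map)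
  assume c: "1 \<le> c"
  have "\<not> n + s < row_entry R c" if "R \<in> set A" for R
    using A[OF that] decr_row_gt_iff[OF g, of R n c] decr_row_gt_iff[OF g, of R n 1] that T by auto
  then have "col_count A (n + s) c = 0" by (induction A) auto
  moreover have "col_count (map ?f B) s c = col_count B (n + s) c"
    using rf by (induction B) auto
  ultimately show "col_count (large_part n T) s c = col_count T (n + s) c" unfolding b by (simp add: T)
qed

text \<open>An inner box replaces an entry greater than \<open>n\<close> and so behaves like an
  entry exceeding all filled ones. With the old values put back, both alternatives of the skew
  triple rule become the triple rule of \<open>T\<close>.\<close>

lemma SSRCT_bullet:
  assumes "ssrct T"
  shows "is_SSRCT (bullet n T) (map length T) (shape (large_part n T))"
proof -
  obtain A B where T: "T = A @ B" and A: "\<And>R. R \<in> set A \<Longrightarrow> row_entry R 1 \<le> n"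
    and B: "\<And>R. R \<in> set B \<Longrightarrow> n < row_entry R 1"
    and b: "large_part n T = map (\<lambda>R. map (\<lambda>x. x - n) (takeWhile (\<lambda>x. n < x) R)) B"
    using large_part_split[OF assms] by metis
  let ?\<beta> = "map length T" and ?\<gamma> = "shape (large_part n T)" and ?e = "\<lambda>r c. row_entry (T ! (r - 1)) c"
  let ?in = "\<lambda>r. 1 \<le> r \<and> r \<le> length T"
  have rows: "R \<noteq> []" "decr_row R" "0 \<notin> set R" if "R \<in> set T" for R
    using assms that by (auto simp: ssrct_def decr_row_def)
  have mem: "T ! (r - 1) \<in> set T" if "?in r" for r using that by (intro nth_mem) auto
  have sb: "ssrct (large_part n T)" by (rule ssrct_large_part(1)[OF assms])
  have lb: "length (large_part n T) = length B" by (simp add: b)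
  have lT: "length T = length A + length B" by (simp add: T)
  have inn: "inner ?\<beta> ?\<gamma> r c \<longleftrightarrow> ?in r \<and> n < ?e r c" for r c
  proof (cases "?in r")
    case True
    show ?thesis
    proof (cases "r \<le> length A")
      case r: True
      have "T ! (r - 1) \<in> set A" using r True by (auto simp: T nth_append)
      then have "\<not> n < ?e r c"
        using A decr_row_gt_iff[OF rows(2)[OF mem[OF True]], of n c] decr_row_gt_iff[OF rows(2)[OF mem[OF True]], of n 1] by fastforce
      then show ?thesis using r by (simp add: inner_def shape_def lb lT)
    next
      case False
      let ?k = "r - 1 - length A"
      have k: "?k < length B" "T ! (r - 1) = B ! ?k" using False True by (auto simp: T nth_append)
      have "large_part n T ! ?k \<in> set (large_part n T)" using k lb by simp
      then have "0 \<notin> set (large_part n T ! ?k)" using sb by (auto simp: ssrct_def decr_row_def)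
      from row_entry_pos[OF this, of c]
      have "1 \<le> c \<and> c \<le> length (large_part n T ! ?k) \<longleftrightarrow> 0 < row_entry (large_part n T ! ?k) c" by simp
      also have "\<dots> \<longleftrightarrow> n < ?e r c"
        using row_entry_truncate[OF rows(2)[OF mem[OF True]], of n c] k by (simp add: b)
      finally show ?thesis using False True k lb by (simp add: inner_def shape_def T)
    qed
  next
    case False
    then show ?thesis by (auto simp: inner_def)
  qed
  have ins: "in_shape ?\<beta> r c \<longleftrightarrow> ?in r \<and> 0 < ?e r c" for r c
    using row_entry_pos[OF rows(3)[OF mem], of r c] by (auto simp: in_shape_def)
  have fil: "filled ?\<beta> ?\<gamma> r c \<longleftrightarrow> ?in r \<and> 0 < ?e r c \<and> ?e r c \<le> n" for r c
    by (auto simp: filled_def inn ins)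
  have en: "ent (bullet n T) r c = (if n < ?e r c then 0 else ?e r c)" if "?in r" for r c
    using that by (auto simp: ent_def bullet_def row_entry_def)
  have dec: "?e r (c + 1) \<le> ?e r c" if "?in r" "1 \<le> c" for r c
    using rows(2)[OF mem[OF that(1)]] that(2) by (simp add: decr_row_def)
  have tr: "row_triple (T ! (r - 1)) (T ! (s - 1))" if "?in r" "?in s" "r < s" for r s
    using assms that by (auto simp: ssrct_def sorted_wrt_iff_nth_less)
  have pos1: "0 < c" if "0 < ?e r c" for r c using that by (cases c) auto
  show ?thesis
    unfolding is_SSRCT_def
  proof (intro conjI allI impI)
    show "is_comp ?\<beta>" using rows(1) by (auto simp: is_comp_def)
    show "is_comp ?\<gamma>" using sb by (auto simp: is_comp_def shape_def ssrct_def)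
    show "length ?\<gamma> \<le> length ?\<beta>" by (simp add: shape_def lb lT)
    show "map length (bullet n T) = ?\<beta>" by (simp add: bullet_def)
    fix r c assume "inner ?\<beta> ?\<gamma> r c"
    then show "in_shape ?\<beta> r c" by (auto simp: inn ins)
  next
    fix r c assume "in_shape ?\<beta> r c"
    then show "(ent (bullet n T) r c = 0) = inner ?\<beta> ?\<gamma> r c" using en by (auto simp: inn ins)
  next
    fix r c assume "filled ?\<beta> ?\<gamma> r c \<and> filled ?\<beta> ?\<gamma> r (c + 1)"
    then show "ent (bullet n T) r (c + 1) \<le> ent (bullet n T) r c"
      using en dec[of r c] pos1[of r c] by (simp add: fil Suc_le_eq)
  next
    fix r s assume "r < s \<and> filled ?\<beta> ?\<gamma> r 1 \<and> filled ?\<beta> ?\<gamma> s 1"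
    then show "ent (bullet n T) r 1 < ent (bullet n T) s 1"
      using en tr[of r s] by (simp add: fil row_triple_def)
  next
    fix r s c
    assume a: "r < s \<and> 1 \<le> c \<and> filled ?\<beta> ?\<gamma> s (c + 1) \<and>
      (inner ?\<beta> ?\<gamma> r c \<or> filled ?\<beta> ?\<gamma> r c \<and> ent (bullet n T) s (c + 1) \<le> ent (bullet n T) r c)"
    then have i: "?in r" "?in s" by (auto simp: inn fil)
    have "?e s (Suc c) \<le> ?e r c" using a en[OF i(1)] en[OF i(2)] by (auto simp: inn fil)
    then have "?e s (Suc c) < ?e r (Suc c)"
      using a row_tripleD[OF tr[OF i], of c] by (simp add: fil)
    then show "inner ?\<beta> ?\<gamma> r (c + 1) \<or> filled ?\<beta> ?\<gamma> r (c + 1) \<and> ent (bullet n T) s (c + 1) < ent (bullet n T) r (c + 1)"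
      using a en[OF i(1)] en[OF i(2)] i by (auto simp: inn fil)
  qed
qed

text \<open>The case \<open>n = maxent T\<close> of \<open>SSRCT_bullet\<close>, where no entry is
  removed and the inner shape is empty.\<close>

lemma SSRCT_if_ssrct:
  assumes "ssrct T"
  shows "is_SSRCT T (shape T) []"
proof -
  have "bullet (maxent T) T = T"
    unfolding bullet_def using in_maxent[of _ T] by (intro map_idI) (force simp: not_less)
  moreover have "large_part (maxent T) T = []" using row_entry_le_maxent[of _ T 1] by (simp add: large_part_def dropWhile_eq_Nil_conv)
  ultimately show ?thesis using SSRCT_bullet[OF assms, of "maxent T"] by (simp add: shape_def)
qed

text \<open>For the \<open>THE\<close> in \<open>rho_inv\<close>, existence comes from
  \<open>rho_entries\<close> and uniqueness from \<open>ssrct_unique\<close>; bijectivity of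
  \<open>rho\<close> is not presupposed.\<close>

lemma rho_inv_eq:
  assumes "ssrct S" "entries_given_by P (col_count S)"
  shows "rho_inv P = S"
  unfolding rho_inv_def
proof (rule the_equality)
  have "rho S = P" using entries_unique[OF rho_entries[OF assms(1)] assms(2)] .
  then show "is_SSRCT S (shape S) [] \<and> rho S = P" using SSRCT_if_ssrct[OF assms(1)] by simp
  fix T assume "is_SSRCT T (shape T) [] \<and> rho T = P"
  then have T: "ssrct T" "entries_given_by P (col_count T)" using ssrct_if_SSRCT(1) rho_entries by auto
  show "T = S" by (rule ssrct_unique[OF T(1) assms(1)]) (rule entries_fun_unique[OF T(2) assms(2)])
qed

theorem theorem8p10:
  fixes \<tau>1 :: "nat list list" and \<alpha> :: "nat list" and n :: nat and js :: "nat list"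
  assumes "is_SRCT \<tau>1 \<alpha> []"
    and "sum_list \<alpha> = n"
    and "\<forall>j\<in>set js. 0 < j"
    and "slides_defined js \<tau>1"
  shows "\<exists>\<beta>. useq js \<alpha> = Some \<beta> \<and>
           is_SRCT (bullet n (museq js \<tau>1)) \<beta> (shape (rho_inv (Qtab (std (rev js)))))"
proof -
  have "is_SSRCT \<tau>1 \<alpha> []" using assms(1) by (simp add: is_SRCT_def)
  note s1 = ssrct_if_SSRCT[OF this]
  have nz: "0 \<notin> set (concat T)" if "ssrct T" for T using that by (auto simp: ssrct_def decr_row_def)
  have std1: "std_filling n \<tau>1"
  proof -
    have "filter (\<lambda>x. x \<noteq> 0) (concat \<tau>1) = concat \<tau>1" unfolding filter_id_conv using nz[OF s1(1)] by metis
    moreover have "length (concat \<tau>1) = n" using assms(2) s1(2) by (simp add: length_concat)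
    ultimately show ?thesis using assms(1) unfolding is_SRCT_def Let_def std_filling_def by metis
  qed
  define T where "T = museq js \<tau>1"
  have T: "ssrct T" "std_filling (n + length js) T" "useq js \<alpha> = Some (map length T)"
    using slides_museq[OF s1(1) std1 assms(4)] s1(2) by (auto simp: T_def)
  \<comment> \<open>Lowering the entries by \<open>n\<close> turns the threshold
    \<open>n + s\<close> for the final tableau into the threshold \<open>s\<close> of the recording
    tableau.\<close>
  have "rho_inv (Qtab (std (rev js))) = large_part n T"
  proof (rule rho_inv_eq[OF ssrct_large_part(1)[OF T(1)]])
    show "entries_given_by (Qtab (std (rev js))) (col_count (large_part n T))"
      using Qtab_entries[OF s1(1) std1 assms(4)] by (rule entries_cong) (simp add: ssrct_large_part(2)[OF T(1)] flip: T_def)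
  qed
  moreover have "is_SRCT (bullet n T) (map length T) (shape (large_part n T))"
  proof -
    have cb: "concat (bullet n T) = map (\<lambda>x. if n < x then 0 else x) (concat T)"
      by (simp add: bullet_def map_concat)
    \<comment> \<open>As all entries are positive, the zeros of the bulleted tableau are exactly the
      boxes whose entry exceeded \<open>n\<close>.\<close>
    have "filter (\<lambda>x. x \<noteq> 0) (map (\<lambda>x. if n < x then 0 else x) xs) = filter (\<lambda>x. x \<le> n) xs"
      if "0 \<notin> set xs" for xs :: "nat list" using that by (induction xs) auto
    then have f: "filter (\<lambda>x. x \<noteq> 0) (concat (bullet n T)) = filter (\<lambda>x. x \<le> n) (concat T)"
      unfolding cb using nz[OF T(1)] by blast
    have d: "distinct (filter (\<lambda>x. x \<le> n) (concat T))" using T(2) by (simp add: std_filling_def)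
    have st: "set (filter (\<lambda>x. x \<le> n) (concat T)) = {1..n}"
      using T(2) unfolding std_filling_def set_filter by auto
    have "length (filter (\<lambda>x. x \<le> n) (concat T)) = n" using distinct_card[OF d] unfolding st by simp
    then show ?thesis using SSRCT_bullet[OF T(1), of n] d st unfolding is_SRCT_def Let_def f by simp
  qed
  ultimately show ?thesis using T(3) unfolding T_def by auto
qed

end
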